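(* For any symmetric monoidal functor $F:\mathcal A\to[\mathcal C,\mathcal B]$ and any symmetric monoidal category $\mathcal D$, the following two composites $[\mathcal B,\mathcal D]\to[\mathcal A,[\mathcal C,\mathcal D]]$ in $\mathrm{SMC}$ are equal: $$[\mathcal B,\mathcal D]\xrightarrow{[\mathcal A,-]}[[\mathcal A,\mathcal B],[\mathcal A,\mathcal D]]\xrightarrow{[F^*,1]}[\mathcal C,[\mathcal A,\mathcal D]]\xrightarrow{D}[\mathcal A,[\mathcal C,\mathcal D]]$$ and $$[\mathcal B,\mathcal D]\xrightarrow{[\mathcal C,-]}[[\mathcal C,\mathcal B],[\mathcal C,\mathcal D]]\xrightarrow{[F,1]}[\mathcal A,[\mathcal C,\mathcal D]].$$
   Context: All symmetric monoidal categories are small, with tensor $\otimes$, unit $I$ and natural isomorphisms $ass_{a,b,c}:a\otimes(b\otimes c)\to(a\otimes b)\otimes c$, $r_a:a\otimes I\to a$, $l_a:I\otimes a\to a$, $s_{a,b}:a\otimes b\to b\otimes a$ satisfying the usual coherence axioms. A symmetric monoidal functor $F:\mathcal A\to\mathcal B$ is a lax one: a functor with an arrow $F^0:I\to F(I)$ and a natural family $F^2_{x,y}:Fx\otimes Fy\to F(x\otimes y)$ satisfying the usual associativity, unit and symmetry axioms; it is strict if $F^0$ and all $F^2_{x,y}$ are identities. $\mathrm{SMC}$ is the 2-category of symmetric monoidal categories, symmetric monoidal functors and monoidal natural transformations. $[\mathcal A,\mathcal B]$ is the category $\mathrm{SMC}(\mathcal A,\mathcal B)$ with the pointwise symmetric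 monoidal structure: $(F\Box G)(a)=Fa\otimes Ga$, $(F\Box G)^0$ is $I\cong I\otimes I\xrightarrow{F^0\otimes G^0}F(I)\otimes G(I)$, $(F\Box G)^2_{a,b}$ is the canonical interchange $(Fa\otimes Ga)\otimes(Fb\otimes Gb)\cong(Fa\otimes Fb)\otimes(Ga\otimes Gb)$ followed by $F^2_{a,b}\otimes G^2_{a,b}$; $(\sigma\Box\tau)_a=\sigma_a\otimes\tau_a$; the unit is the constant functor at $I_{\mathcal B}$ (with $I\to I$ the identity and $I\otimes I\to I$ the canonical arrow); $ass,r,l,s$ are pointwise. For $G:\mathcal B\to\mathcal D$, $[\mathcal A,G]:[\mathcal A,\mathcal B]\to[\mathcal A,\mathcal D]$ is $H\mapsto G\circ H$, $\theta\mapsto G*\theta$, with $[\mathcal A,G]^0$ having all components $G^0$ and $[\mathcal A,G]^2_{H,K}$ having component $G^2_{Ha,Ka}$ at $a$; for a 2-cell $\sigma$, $[\mathcal A,\sigma]_H=\sigma*H$. The assignment $G\mapsto[\mathcal A,G]$, $\sigma\mapsto[\mathcal A,\sigma]$ is a strict symmetric monoidal functor $[\mathcal A,-]:[\mathcal B,\mathcal D]\to[[\mathcal A,\mathcal B],[\mathcal A,\mathcal D]]$. For a symmetric monoidal functor $K:\mathcal X\to\mathcal Y$, $[K,1]:[\mathcal Y,\mathcal Z]\to[\mathcal X,\mathcal Z]$ is precomposition with $K$, which is strict. For $F:\mathcal A\to[\mathcal B,\mathcal C]$ in $\mathrm{SMC}$, its dual $F^*:\mathcal B\to[\mathcal A,\mathcal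 C]$ is given by $F^*(b)(a)=F(a)(b)$, $F^*(b)(f)=F(f)_b$, $(F^*b)^0=(F^0)_b$, $(F^*b)^2_{a,a'}=(F^2_{a,a'})_b$, $F^*(g)_a=F(a)(g)$, $((F^* )^0)_a=(Fa)^0$, $((F^* )^2_{b,b'})_a=(Fa)^2_{b,b'}$; for a 2-cell $\theta:F\to G$, $(\theta^*_b)_a=(\theta_a)_b$. This gives a strict symmetric monoidal isomorphism $D:[\mathcal A,[\mathcal B,\mathcal C]]\to[\mathcal B,[\mathcal A,\mathcal C]]$, $F\mapsto F^*$, $\theta\mapsto\theta^*$. *)

theory Defs
  imports "HOL-Library.FuncSet"
begin

text \<open>
  Small symmetric monoidal categories, lax symmetric monoidal functors and monoidal natural
  transformations, given by data on carrier sets. Functors and transformations are required to be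
  \<open>undefined\<close> outside the carriers, so that HOL equality of the data is equality of 1-cells
  and of 2-cells, and functors can serve as the objects of an internal hom.
\<close>

section \<open>Symmetric monoidal categories\<close>

text \<open>Composition is written in applicative order: \<open>g \<cdot>\<^bsub>C\<^esub> f\<close> is \<open>f\<close> followed by \<open>g\<close>. Tensor is
  \<open>\<otimes>\<close> on objects and \<open>\<boxtimes>\<close> on arrows.\<close>

record ('o, 'm) smc_data =
  Obj :: "'o set"
  Arr :: "'m set"
  Dom :: "'m \<Rightarrow> 'o"
  Cod :: "'m \<Rightarrow> 'o"
  Idt :: "'o \<Rightarrow> 'm"
  Comp :: "'m \<Rightarrow> 'm \<Rightarrow> 'm" (infixr "\<cdot>\<index>" 55)
  Tens :: "'o \<Rightarrow> 'o \<Rightarrow> 'o" (infixl "\<otimes>\<index>" 70)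
  TensA :: "'m \<Rightarrow> 'm \<Rightarrow> 'm" (infixl "\<boxtimes>\<index>" 70)
  Unit :: "'o"
  Assoc :: "'o \<Rightarrow> 'o \<Rightarrow> 'o \<Rightarrow> 'm"
  RUnit :: "'o \<Rightarrow> 'm"
  LUnit :: "'o \<Rightarrow> 'm"
  Symm :: "'o \<Rightarrow> 'o \<Rightarrow> 'm"

definition Hom :: "('o, 'm) smc_data \<Rightarrow> 'o \<Rightarrow> 'o \<Rightarrow> 'm set" where
  "Hom C a b = {f \<in> Arr C. Dom C f = a \<and> Cod C f = b}"

definition inverse_of :: "('o, 'm) smc_data \<Rightarrow> 'm \<Rightarrow> 'm \<Rightarrow> bool" where
  "inverse_of C f g \<longleftrightarrow> f \<in> Arr C \<and> g \<in> Hom C (Cod C f) (Dom C f) \<and>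
     g \<cdot>\<^bsub>C\<^esub> f = Idt C (Dom C f) \<and> f \<cdot>\<^bsub>C\<^esub> g = Idt C (Cod C f)"

definition iso_arr :: "('o, 'm) smc_data \<Rightarrow> 'm \<Rightarrow> bool" where
  "iso_arr C f \<longleftrightarrow> (\<exists>g. inverse_of C f g)"

definition inv_arr :: "('o, 'm) smc_data \<Rightarrow> 'm \<Rightarrow> 'm" where
  "inv_arr C f = (THE g. inverse_of C f g)"

locale category =
  fixes C :: "('o, 'm) smc_data" (structure)
  assumes dom_obj: "f \<in> Arr C \<Longrightarrow> Dom C f \<in> Obj C"
    and cod_obj: "f \<in> Arr C \<Longrightarrow> Cod C f \<in> Obj C"
    and idt_hom: "a \<in> Obj C \<Longrightarrow> Idt C a \<in> Hom C a a"
    and comp_hom: "\<lbrakk>f \<in> Hom C a b; g \<in> Hom C b c\<rbrakk> \<Longrightarrow> g \<cdot> f \<in> Hom C a c"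
    and comp_idt: "f \<in> Hom C a b \<Longrightarrow> f \<cdot> Idt C a = f"
    and idt_comp: "f \<in> Hom C a b \<Longrightarrow> Idt C b \<cdot> f = f"
    and comp_assoc: "\<lbrakk>f \<in> Hom C a b; g \<in> Hom C b c; h \<in> Hom C c d\<rbrakk>
      \<Longrightarrow> (h \<cdot> g) \<cdot> f = h \<cdot> (g \<cdot> f)"

locale symmetric_monoidal_category = category +
  assumes tens_obj: "\<lbrakk>a \<in> Obj C; b \<in> Obj C\<rbrakk> \<Longrightarrow> a \<otimes> b \<in> Obj C"
    and tens_hom: "\<lbrakk>f \<in> Hom C a b; g \<in> Hom C a' b'\<rbrakk> \<Longrightarrow> f \<boxtimes> g \<in> Hom C (a \<otimes> a') (b \<otimes> b')"
    and tens_idt: "\<lbrakk>a \<in> Obj C; b \<in> Obj C\<rbrakk> \<Longrightarrow> Idt C a \<boxtimes> Idt C b = Idt C (a \<otimes> b)"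
    and tens_comp: "\<lbrakk>f \<in> Hom C a b; g \<in> Hom C b c; f' \<in> Hom C a' b'; g' \<in> Hom C b' c'\<rbrakk>
      \<Longrightarrow> (g \<cdot> f) \<boxtimes> (g' \<cdot> f') = (g \<boxtimes> g') \<cdot> (f \<boxtimes> f')"
    and unit_obj: "Unit C \<in> Obj C"
    and assoc_hom: "\<lbrakk>a \<in> Obj C; b \<in> Obj C; c \<in> Obj C\<rbrakk>
      \<Longrightarrow> Assoc C a b c \<in> Hom C (a \<otimes> (b \<otimes> c)) ((a \<otimes> b) \<otimes> c)"
    and assoc_iso: "\<lbrakk>a \<in> Obj C; b \<in> Obj C; c \<in> Obj C\<rbrakk> \<Longrightarrow> iso_arr C (Assoc C a b c)"
    and assoc_nat: "\<lbrakk>f \<in> Hom C a a'; g \<in> Hom C b b'; h \<in> Hom C c c'\<rbrakk>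
      \<Longrightarrow> Assoc C a' b' c' \<cdot> (f \<boxtimes> (g \<boxtimes> h)) = ((f \<boxtimes> g) \<boxtimes> h) \<cdot> Assoc C a b c"
    and runit_hom: "a \<in> Obj C \<Longrightarrow> RUnit C a \<in> Hom C (a \<otimes> Unit C) a"
    and runit_iso: "a \<in> Obj C \<Longrightarrow> iso_arr C (RUnit C a)"
    and runit_nat: "f \<in> Hom C a b \<Longrightarrow> RUnit C b \<cdot> (f \<boxtimes> Idt C (Unit C)) = f \<cdot> RUnit C a"
    and lunit_hom: "a \<in> Obj C \<Longrightarrow> LUnit C a \<in> Hom C (Unit C \<otimes> a) a"
    and lunit_iso: "a \<in> Obj C \<Longrightarrow> iso_arr C (LUnit C a)"
    and lunit_nat: "f \<in> Hom C a b \<Longrightarrow> LUnit C b \<cdot> (Idt C (Unit C) \<boxtimes> f) = f \<cdot> LUnit C a"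
    and symm_hom: "\<lbrakk>a \<in> Obj C; b \<in> Obj C\<rbrakk> \<Longrightarrow> Symm C a b \<in> Hom C (a \<otimes> b) (b \<otimes> a)"
    and symm_nat: "\<lbrakk>f \<in> Hom C a a'; g \<in> Hom C b b'\<rbrakk>
      \<Longrightarrow> Symm C a' b' \<cdot> (f \<boxtimes> g) = (g \<boxtimes> f) \<cdot> Symm C a b"
    and symm_symm: "\<lbrakk>a \<in> Obj C; b \<in> Obj C\<rbrakk> \<Longrightarrow> Symm C b a \<cdot> Symm C a b = Idt C (a \<otimes> b)"
    and pentagon: "\<lbrakk>a \<in> Obj C; b \<in> Obj C; c \<in> Obj C; d \<in> Obj C\<rbrakk>
      \<Longrightarrow> Assoc C (a \<otimes> b) c d \<cdot> Assoc C a b (c \<otimes> d)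
        = (Assoc C a b c \<boxtimes> Idt C d) \<cdot> Assoc C a (b \<otimes> c) d \<cdot> (Idt C a \<boxtimes> Assoc C b c d)"
    and triangle: "\<lbrakk>a \<in> Obj C; b \<in> Obj C\<rbrakk>
      \<Longrightarrow> (RUnit C a \<boxtimes> Idt C b) \<cdot> Assoc C a (Unit C) b = Idt C a \<boxtimes> LUnit C b"
    and unit_coh: "LUnit C (Unit C) = RUnit C (Unit C)"
    and symm_unit: "a \<in> Obj C \<Longrightarrow> LUnit C a \<cdot> Symm C a (Unit C) = RUnit C a"
    and hexagon: "\<lbrakk>a \<in> Obj C; b \<in> Obj C; c \<in> Obj C\<rbrakk>
      \<Longrightarrow> Assoc C c a b \<cdot> Symm C (a \<otimes> b) c \<cdot> Assoc C a b c
        = (Symm C a c \<boxtimes> Idt C b) \<cdot> Assoc C a c b \<cdot> (Idt C a \<boxtimes> Symm C b c)"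

text \<open>The canonical arrow \<open>(a \<otimes> b) \<otimes> (c \<otimes> d) \<rightarrow> (a \<otimes> c) \<otimes> (b \<otimes> d)\<close>.\<close>

definition interchange :: "('o, 'm) smc_data \<Rightarrow> 'o \<Rightarrow> 'o \<Rightarrow> 'o \<Rightarrow> 'o \<Rightarrow> 'm" where
  "interchange C a b c d =
     Assoc C a c (b \<otimes>\<^bsub>C\<^esub> d)
     \<cdot>\<^bsub>C\<^esub> (Idt C a \<boxtimes>\<^bsub>C\<^esub> inv_arr C (Assoc C c b d))
     \<cdot>\<^bsub>C\<^esub> (Idt C a \<boxtimes>\<^bsub>C\<^esub> (Symm C b c \<boxtimes>\<^bsub>C\<^esub> Idt C d))
     \<cdot>\<^bsub>C\<^esub> (Idt C a \<boxtimes>\<^bsub>C\<^esub> Assoc C b c d)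
     \<cdot>\<^bsub>C\<^esub> inv_arr C (Assoc C a b (c \<otimes>\<^bsub>C\<^esub> d))"


section \<open>Symmetric monoidal functors and monoidal natural transformations\<close>

text \<open>\<open>fzero F\<close> and \<open>ftwo F x y\<close> are the structure arrows $F^0$ and $F^2_{x,y}$.\<close>

record ('o1, 'm1, 'o2, 'm2) smf =
  fob :: "'o1 \<Rightarrow> 'o2"
  far :: "'m1 \<Rightarrow> 'm2"
  fzero :: "'m2"
  ftwo :: "'o1 \<Rightarrow> 'o1 \<Rightarrow> 'm2"

locale symmetric_monoidal_functor =
  fixes A :: "('o1, 'm1) smc_data" and B :: "('o2, 'm2) smc_data"
    and F :: "('o1, 'm1, 'o2, 'm2) smf"
  assumes fob_ext: "fob F \<in> extensional (Obj A)"
    and far_ext: "far F \<in> extensional (Arr A)"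
    and ftwo_ext: "ftwo F \<in> extensional (Obj A)"
    and ftwo_ext': "x \<in> Obj A \<Longrightarrow> ftwo F x \<in> extensional (Obj A)"
    and fob_obj: "x \<in> Obj A \<Longrightarrow> fob F x \<in> Obj B"
    and far_hom: "f \<in> Hom A x y \<Longrightarrow> far F f \<in> Hom B (fob F x) (fob F y)"
    and far_idt: "x \<in> Obj A \<Longrightarrow> far F (Idt A x) = Idt B (fob F x)"
    and far_comp: "\<lbrakk>f \<in> Hom A x y; g \<in> Hom A y z\<rbrakk> \<Longrightarrow> far F (g \<cdot>\<^bsub>A\<^esub> f) = far F g \<cdot>\<^bsub>B\<^esub> far F f"
    and fzero_hom: "fzero F \<in> Hom B (Unit B) (fob F (Unit A))"
    and ftwo_hom: "\<lbrakk>x \<in> Obj A; y \<in> Obj A\<rbrakk>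
      \<Longrightarrow> ftwo F x y \<in> Hom B (fob F x \<otimes>\<^bsub>B\<^esub> fob F y) (fob F (x \<otimes>\<^bsub>A\<^esub> y))"
    and ftwo_nat: "\<lbrakk>f \<in> Hom A x x'; g \<in> Hom A y y'\<rbrakk>
      \<Longrightarrow> ftwo F x' y' \<cdot>\<^bsub>B\<^esub> (far F f \<boxtimes>\<^bsub>B\<^esub> far F g) = far F (f \<boxtimes>\<^bsub>A\<^esub> g) \<cdot>\<^bsub>B\<^esub> ftwo F x y"
    and ftwo_assoc: "\<lbrakk>x \<in> Obj A; y \<in> Obj A; z \<in> Obj A\<rbrakk>
      \<Longrightarrow> ftwo F (x \<otimes>\<^bsub>A\<^esub> y) z \<cdot>\<^bsub>B\<^esub> (ftwo F x y \<boxtimes>\<^bsub>B\<^esub> Idt B (fob F z))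
            \<cdot>\<^bsub>B\<^esub> Assoc B (fob F x) (fob F y) (fob F z)
        = far F (Assoc A x y z) \<cdot>\<^bsub>B\<^esub> ftwo F x (y \<otimes>\<^bsub>A\<^esub> z)
            \<cdot>\<^bsub>B\<^esub> (Idt B (fob F x) \<boxtimes>\<^bsub>B\<^esub> ftwo F y z)"
    and ftwo_runit: "x \<in> Obj A
      \<Longrightarrow> far F (RUnit A x) \<cdot>\<^bsub>B\<^esub> ftwo F x (Unit A) \<cdot>\<^bsub>B\<^esub> (Idt B (fob F x) \<boxtimes>\<^bsub>B\<^esub> fzero F)
        = RUnit B (fob F x)"
    and ftwo_lunit: "x \<in> Obj A
      \<Longrightarrow> far F (LUnit A x) \<cdot>\<^bsub>B\<^esub> ftwo F (Unit A) x \<cdot>\<^bsub>B\<^esub> (fzero F \<boxtimes>\<^bsub>B\<^esub> Idt B (fob F x))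
        = LUnit B (fob F x)"
    and ftwo_symm: "\<lbrakk>x \<in> Obj A; y \<in> Obj A\<rbrakk>
      \<Longrightarrow> ftwo F y x \<cdot>\<^bsub>B\<^esub> Symm B (fob F x) (fob F y) = far F (Symm A x y) \<cdot>\<^bsub>B\<^esub> ftwo F x y"

record ('o1, 'm1, 'o2, 'm2) mnt =
  nsrc :: "('o1, 'm1, 'o2, 'm2) smf"
  ntrg :: "('o1, 'm1, 'o2, 'm2) smf"
  ncmp :: "'o1 \<Rightarrow> 'm2"

locale monoidal_transformation =
  fixes A :: "('o1, 'm1) smc_data" and B :: "('o2, 'm2) smc_data"
    and \<theta> :: "('o1, 'm1, 'o2, 'm2) mnt"
  assumes src_functor: "symmetric_monoidal_functor A B (nsrc \<theta>)"
    and trg_functor: "symmetric_monoidal_functor A B (ntrg \<theta>)"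
    and ncmp_ext: "ncmp \<theta> \<in> extensional (Obj A)"
    and ncmp_hom: "x \<in> Obj A \<Longrightarrow> ncmp \<theta> x \<in> Hom B (fob (nsrc \<theta>) x) (fob (ntrg \<theta>) x)"
    and ncmp_nat: "f \<in> Hom A x y
      \<Longrightarrow> ncmp \<theta> y \<cdot>\<^bsub>B\<^esub> far (nsrc \<theta>) f = far (ntrg \<theta>) f \<cdot>\<^bsub>B\<^esub> ncmp \<theta> x"
    and ncmp_unit: "ncmp \<theta> (Unit A) \<cdot>\<^bsub>B\<^esub> fzero (nsrc \<theta>) = fzero (ntrg \<theta>)"
    and ncmp_tens: "\<lbrakk>x \<in> Obj A; y \<in> Obj A\<rbrakk>
      \<Longrightarrow> ncmp \<theta> (x \<otimes>\<^bsub>A\<^esub> y) \<cdot>\<^bsub>B\<^esub> ftwo (nsrc \<theta>) x y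
        = ftwo (ntrg \<theta>) x y \<cdot>\<^bsub>B\<^esub> (ncmp \<theta> x \<boxtimes>\<^bsub>B\<^esub> ncmp \<theta> y)"

definition smf_comp :: "('o1, 'm1) smc_data \<Rightarrow> ('o3, 'm3) smc_data
    \<Rightarrow> ('o2, 'm2, 'o3, 'm3) smf \<Rightarrow> ('o1, 'm1, 'o2, 'm2) smf \<Rightarrow> ('o1, 'm1, 'o3, 'm3) smf" where
  "smf_comp X Z G F = \<lparr>
     fob = (\<lambda>x \<in> Obj X. fob G (fob F x)),
     far = (\<lambda>f \<in> Arr X. far G (far F f)),
     fzero = far G (fzero F) \<cdot>\<^bsub>Z\<^esub> fzero G,
     ftwo = (\<lambda>x \<in> Obj X. \<lambda>y \<in> Obj X. far G (ftwo F x y) \<cdot>\<^bsub>Z\<^esub> ftwo G (fob F x) (fob F y)) \<rparr>"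

text \<open>The whiskerings $G * \theta$ and $\sigma * H$, for functors and transformations on \<open>X\<close>, through some
  middle category, to \<open>Z\<close>.\<close>

definition whisker_left :: "('o1, 'm1) smc_data \<Rightarrow> ('o3, 'm3) smc_data
    \<Rightarrow> ('o2, 'm2, 'o3, 'm3) smf \<Rightarrow> ('o1, 'm1, 'o2, 'm2) mnt \<Rightarrow> ('o1, 'm1, 'o3, 'm3) mnt" where
  "whisker_left X Z G \<theta> = \<lparr>
     nsrc = smf_comp X Z G (nsrc \<theta>),
     ntrg = smf_comp X Z G (ntrg \<theta>),
     ncmp = (\<lambda>x \<in> Obj X. far G (ncmp \<theta> x)) \<rparr>"

definition whisker_right :: "('o1, 'm1) smc_data \<Rightarrow> ('o3, 'm3) smc_data
    \<Rightarrow> ('o2, 'm2, 'o3, 'm3) mnt \<Rightarrow> ('o1, 'm1, 'o2, 'm2) smf \<Rightarrow> ('o1, 'm1, 'o3, 'm3) mnt" where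
  "whisker_right X Z \<sigma> H = \<lparr>
     nsrc = smf_comp X Z (nsrc \<sigma>) H,
     ntrg = smf_comp X Z (ntrg \<sigma>) H,
     ncmp = (\<lambda>x \<in> Obj X. ncmp \<sigma> (fob H x)) \<rparr>"

text \<open>The functor with given action on objects and arrows and identity structure arrows; for a
  strict functor \<open>ob x \<otimes> ob y = ob (x \<otimes> y)\<close>, so $F^2_{x,y}$ is the identity of either side.\<close>

definition strict_smf :: "('o1, 'm1) smc_data \<Rightarrow> ('o2, 'm2) smc_data
    \<Rightarrow> ('o1 \<Rightarrow> 'o2) \<Rightarrow> ('m1 \<Rightarrow> 'm2) \<Rightarrow> ('o1, 'm1, 'o2, 'm2) smf" where
  "strict_smf X Y ob ar = \<lparr>
     fob = (\<lambda>x \<in> Obj X. ob x),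
     far = (\<lambda>f \<in> Arr X. ar f),
     fzero = Idt Y (Unit Y),
     ftwo = (\<lambda>x \<in> Obj X. \<lambda>y \<in> Obj X. Idt Y (ob x \<otimes>\<^bsub>Y\<^esub> ob y)) \<rparr>"


section \<open>The internal hom\<close>

text \<open>The canonical arrows \<open>I \<rightarrow> I \<otimes> I\<close> and \<open>I \<otimes> I \<rightarrow> I\<close> are taken to be the inverse of $r_I$ and $r_I$ itself;
  recall $r_I = l_I$.\<close>

definition smf_tens :: "('o1, 'm1) smc_data \<Rightarrow> ('o2, 'm2) smc_data
    \<Rightarrow> ('o1, 'm1, 'o2, 'm2) smf \<Rightarrow> ('o1, 'm1, 'o2, 'm2) smf \<Rightarrow> ('o1, 'm1, 'o2, 'm2) smf" where
  "smf_tens A B F G = \<lparr>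
     fob = (\<lambda>a \<in> Obj A. fob F a \<otimes>\<^bsub>B\<^esub> fob G a),
     far = (\<lambda>f \<in> Arr A. far F f \<boxtimes>\<^bsub>B\<^esub> far G f),
     fzero = (fzero F \<boxtimes>\<^bsub>B\<^esub> fzero G) \<cdot>\<^bsub>B\<^esub> inv_arr B (RUnit B (Unit B)),
     ftwo = (\<lambda>a \<in> Obj A. \<lambda>b \<in> Obj A.
       (ftwo F a b \<boxtimes>\<^bsub>B\<^esub> ftwo G a b) \<cdot>\<^bsub>B\<^esub> interchange B (fob F a) (fob G a) (fob F b) (fob G b)) \<rparr>"

definition smf_unit :: "('o1, 'm1) smc_data \<Rightarrow> ('o2, 'm2) smc_data \<Rightarrow> ('o1, 'm1, 'o2, 'm2) smf" where
  "smf_unit A B = \<lparr>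
     fob = (\<lambda>a \<in> Obj A. Unit B),
     far = (\<lambda>f \<in> Arr A. Idt B (Unit B)),
     fzero = Idt B (Unit B),
     ftwo = (\<lambda>a \<in> Obj A. \<lambda>b \<in> Obj A. RUnit B (Unit B)) \<rparr>"

definition ihom :: "('o1, 'm1) smc_data \<Rightarrow> ('o2, 'm2) smc_data
    \<Rightarrow> (('o1, 'm1, 'o2, 'm2) smf, ('o1, 'm1, 'o2, 'm2) mnt) smc_data" (infixr "\<Rrightarrow>" 60) where
  "A \<Rrightarrow> B = \<lparr>
     Obj = {F. symmetric_monoidal_functor A B F},
     Arr = {\<theta>. monoidal_transformation A B \<theta>},
     Dom = nsrc,
     Cod = ntrg,
     Idt = (\<lambda>F. \<lparr> nsrc = F, ntrg = F, ncmp = (\<lambda>a \<in> Obj A. Idt B (fob F a)) \<rparr>),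
     Comp = (\<lambda>\<tau> \<sigma>. \<lparr> nsrc = nsrc \<sigma>, ntrg = ntrg \<tau>, ncmp = (\<lambda>a \<in> Obj A. ncmp \<tau> a \<cdot>\<^bsub>B\<^esub> ncmp \<sigma> a) \<rparr>),
     Tens = smf_tens A B,
     TensA = (\<lambda>\<sigma> \<tau>. \<lparr> nsrc = smf_tens A B (nsrc \<sigma>) (nsrc \<tau>), ntrg = smf_tens A B (ntrg \<sigma>) (ntrg \<tau>),
       ncmp = (\<lambda>a \<in> Obj A. ncmp \<sigma> a \<boxtimes>\<^bsub>B\<^esub> ncmp \<tau> a) \<rparr>),
     Unit = smf_unit A B,
     Assoc = (\<lambda>F G H. \<lparr> nsrc = smf_tens A B F (smf_tens A B G H),
       ntrg = smf_tens A B (smf_tens A B F G) H,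
       ncmp = (\<lambda>a \<in> Obj A. Assoc B (fob F a) (fob G a) (fob H a)) \<rparr>),
     RUnit = (\<lambda>F. \<lparr> nsrc = smf_tens A B F (smf_unit A B), ntrg = F,
       ncmp = (\<lambda>a \<in> Obj A. RUnit B (fob F a)) \<rparr>),
     LUnit = (\<lambda>F. \<lparr> nsrc = smf_tens A B (smf_unit A B) F, ntrg = F,
       ncmp = (\<lambda>a \<in> Obj A. LUnit B (fob F a)) \<rparr>),
     Symm = (\<lambda>F G. \<lparr> nsrc = smf_tens A B F G, ntrg = smf_tens A B G F,
       ncmp = (\<lambda>a \<in> Obj A. Symm B (fob F a) (fob G a)) \<rparr>) \<rparr>"


section \<open>The functors $[\mathcal A,G]$, $[\mathcal A,-]$ and $[K,1]$\<close>

definition ihom_map :: "('oa, 'ma) smc_data \<Rightarrow> ('ob, 'mb) smc_data \<Rightarrow> ('od, 'md) smc_data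
    \<Rightarrow> ('ob, 'mb, 'od, 'md) smf
    \<Rightarrow> (('oa, 'ma, 'ob, 'mb) smf, ('oa, 'ma, 'ob, 'mb) mnt,
        ('oa, 'ma, 'od, 'md) smf, ('oa, 'ma, 'od, 'md) mnt) smf" where
  "ihom_map A B D G = \<lparr>
     fob = (\<lambda>H \<in> Obj (A \<Rrightarrow> B). smf_comp A D G H),
     far = (\<lambda>\<theta> \<in> Arr (A \<Rrightarrow> B). whisker_left A D G \<theta>),
     fzero = \<lparr> nsrc = Unit (A \<Rrightarrow> D), ntrg = smf_comp A D G (Unit (A \<Rrightarrow> B)),
       ncmp = (\<lambda>a \<in> Obj A. fzero G) \<rparr>,
     ftwo = (\<lambda>H \<in> Obj (A \<Rrightarrow> B). \<lambda>K \<in> Obj (A \<Rrightarrow> B).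
       \<lparr> nsrc = smf_comp A D G H \<otimes>\<^bsub>A \<Rrightarrow> D\<^esub> smf_comp A D G K,
         ntrg = smf_comp A D G (H \<otimes>\<^bsub>A \<Rrightarrow> B\<^esub> K),
         ncmp = (\<lambda>a \<in> Obj A. ftwo G (fob H a) (fob K a)) \<rparr>) \<rparr>"

definition ihom_map_cell :: "('oa, 'ma) smc_data \<Rightarrow> ('ob, 'mb) smc_data \<Rightarrow> ('od, 'md) smc_data
    \<Rightarrow> ('ob, 'mb, 'od, 'md) mnt
    \<Rightarrow> (('oa, 'ma, 'ob, 'mb) smf, ('oa, 'ma, 'ob, 'mb) mnt,
        ('oa, 'ma, 'od, 'md) smf, ('oa, 'ma, 'od, 'md) mnt) mnt" where
  "ihom_map_cell A B D \<sigma> = \<lparr>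
     nsrc = ihom_map A B D (nsrc \<sigma>),
     ntrg = ihom_map A B D (ntrg \<sigma>),
     ncmp = (\<lambda>H \<in> Obj (A \<Rrightarrow> B). whisker_right A D \<sigma> H) \<rparr>"

text \<open>$[\mathcal A,-] : [\mathcal B,\mathcal D] \to [[\mathcal A,\mathcal B],[\mathcal A,\mathcal D]]$\<close>

definition ihom_fun :: "('oa, 'ma) smc_data \<Rightarrow> ('ob, 'mb) smc_data \<Rightarrow> ('od, 'md) smc_data
    \<Rightarrow> (('ob, 'mb, 'od, 'md) smf, ('ob, 'mb, 'od, 'md) mnt,
        (('oa, 'ma, 'ob, 'mb) smf, ('oa, 'ma, 'ob, 'mb) mnt,
         ('oa, 'ma, 'od, 'md) smf, ('oa, 'ma, 'od, 'md) mnt) smf,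
        (('oa, 'ma, 'ob, 'mb) smf, ('oa, 'ma, 'ob, 'mb) mnt,
         ('oa, 'ma, 'od, 'md) smf, ('oa, 'ma, 'od, 'md) mnt) mnt) smf" where
  "ihom_fun A B D =
     strict_smf (B \<Rrightarrow> D) ((A \<Rrightarrow> B) \<Rrightarrow> (A \<Rrightarrow> D)) (ihom_map A B D) (ihom_map_cell A B D)"

text \<open>$[K,1] : [\mathcal Y,\mathcal Z] \to [\mathcal X,\mathcal Z]$ for $K : \mathcal X \to \mathcal Y$\<close>

definition precomp :: "('ox, 'mx) smc_data \<Rightarrow> ('oy, 'my) smc_data \<Rightarrow> ('oz, 'mz) smc_data
    \<Rightarrow> ('ox, 'mx, 'oy, 'my) smf
    \<Rightarrow> (('oy, 'my, 'oz, 'mz) smf, ('oy, 'my, 'oz, 'mz) mnt,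
        ('ox, 'mx, 'oz, 'mz) smf, ('ox, 'mx, 'oz, 'mz) mnt) smf" where
  "precomp X Y Z K =
     strict_smf (Y \<Rrightarrow> Z) (X \<Rrightarrow> Z) (\<lambda>H. smf_comp X Z H K) (\<lambda>\<theta>. whisker_right X Z \<theta> K)"


section \<open>Duality\<close>

text \<open>\<open>dual_at A F b\<close> is the functor $F^*(b) : \mathcal A \to \mathcal C$, for $F : \mathcal A \to [\mathcal B,\mathcal C]$.\<close>

definition dual_at :: "('oa, 'ma) smc_data
    \<Rightarrow> ('oa, 'ma, ('ob, 'mb, 'oc, 'mc) smf, ('ob, 'mb, 'oc, 'mc) mnt) smf
    \<Rightarrow> 'ob \<Rightarrow> ('oa, 'ma, 'oc, 'mc) smf" where
  "dual_at A F b = \<lparr>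
     fob = (\<lambda>a \<in> Obj A. fob (fob F a) b),
     far = (\<lambda>f \<in> Arr A. ncmp (far F f) b),
     fzero = ncmp (fzero F) b,
     ftwo = (\<lambda>a \<in> Obj A. \<lambda>a' \<in> Obj A. ncmp (ftwo F a a') b) \<rparr>"

definition dual :: "('oa, 'ma) smc_data \<Rightarrow> ('ob, 'mb) smc_data \<Rightarrow> ('oc, 'mc) smc_data
    \<Rightarrow> ('oa, 'ma, ('ob, 'mb, 'oc, 'mc) smf, ('ob, 'mb, 'oc, 'mc) mnt) smf
    \<Rightarrow> ('ob, 'mb, ('oa, 'ma, 'oc, 'mc) smf, ('oa, 'ma, 'oc, 'mc) mnt) smf" where
  "dual A B C F = \<lparr>
     fob = (\<lambda>b \<in> Obj B. dual_at A F b),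
     far = (\<lambda>g \<in> Arr B. \<lparr> nsrc = dual_at A F (Dom B g), ntrg = dual_at A F (Cod B g),
       ncmp = (\<lambda>a \<in> Obj A. far (fob F a) g) \<rparr>),
     fzero = \<lparr> nsrc = Unit (A \<Rrightarrow> C), ntrg = dual_at A F (Unit B),
       ncmp = (\<lambda>a \<in> Obj A. fzero (fob F a)) \<rparr>,
     ftwo = (\<lambda>b \<in> Obj B. \<lambda>b' \<in> Obj B.
       \<lparr> nsrc = dual_at A F b \<otimes>\<^bsub>A \<Rrightarrow> C\<^esub> dual_at A F b', ntrg = dual_at A F (b \<otimes>\<^bsub>B\<^esub> b'),
         ncmp = (\<lambda>a \<in> Obj A. ftwo (fob F a) b b') \<rparr>) \<rparr>"

definition dual_cell :: "('oa, 'ma) smc_data \<Rightarrow> ('ob, 'mb) smc_data \<Rightarrow> ('oc, 'mc) smc_data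
    \<Rightarrow> ('oa, 'ma, ('ob, 'mb, 'oc, 'mc) smf, ('ob, 'mb, 'oc, 'mc) mnt) mnt
    \<Rightarrow> ('ob, 'mb, ('oa, 'ma, 'oc, 'mc) smf, ('oa, 'ma, 'oc, 'mc) mnt) mnt" where
  "dual_cell A B C \<theta> = \<lparr>
     nsrc = dual A B C (nsrc \<theta>),
     ntrg = dual A B C (ntrg \<theta>),
     ncmp = (\<lambda>b \<in> Obj B. \<lparr> nsrc = dual_at A (nsrc \<theta>) b, ntrg = dual_at A (ntrg \<theta>) b,
       ncmp = (\<lambda>a \<in> Obj A. ncmp (ncmp \<theta> a) b) \<rparr>) \<rparr>"

text \<open>$D : [\mathcal A,[\mathcal B,\mathcal C]] \to [\mathcal B,[\mathcal A,\mathcal C]]$\<close>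

definition duality :: "('oa, 'ma) smc_data \<Rightarrow> ('ob, 'mb) smc_data \<Rightarrow> ('oc, 'mc) smc_data
    \<Rightarrow> (('oa, 'ma, ('ob, 'mb, 'oc, 'mc) smf, ('ob, 'mb, 'oc, 'mc) mnt) smf,
        ('oa, 'ma, ('ob, 'mb, 'oc, 'mc) smf, ('ob, 'mb, 'oc, 'mc) mnt) mnt,
        ('ob, 'mb, ('oa, 'ma, 'oc, 'mc) smf, ('oa, 'ma, 'oc, 'mc) mnt) smf,
        ('ob, 'mb, ('oa, 'ma, 'oc, 'mc) smf, ('oa, 'ma, 'oc, 'mc) mnt) mnt) smf" where
  "duality A B C =
     strict_smf (A \<Rrightarrow> B \<Rrightarrow> C) (B \<Rrightarrow> A \<Rrightarrow> C) (dual A B C) (dual_cell A B C)"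

end

theory Submission
  imports Defs
begin

text \<open>Both composites send a functor \<open>G\<close> from \<open>B\<close> to \<open>D\<close> to the functor of two variables \<open>a, c \<mapsto> G (F a c)\<close>: the
first one curries \<open>F\<close> the other way round, applies \<open>G\<close>, and curries back. All data of the two results,
including the structure arrows, are computed at a pair of objects \<open>a, c\<close> by the same expression in \<open>D\<close>
(\<open>dual_ihom_map\<close>, and \<open>dual_cell_ihom_map_cell\<close> for 2-cells). Since precomposition and duality are
strict, both composites have identity structure arrows (\<open>smf_comp_strict\<close>), so agreement on objects and
arrows is all that is left to check.

Functors and transformations are undefined outside the carriers, so the calculation is meaningful only
after the intermediate data are shown to be 1-cells and 2-cells: \<open>[A,B]\<close> is a symmetric monoidal
category (\<open>ihom_smc\<close>), \<open>[A,G]\<close> is a symmetric monoidal functor (\<open>ihom_map_smf\<close>), and so is the dual of \<open>F\<close>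
(\<open>dual_smf\<close>). These statements all come down to properties of the interchange
\<open>(a \<otimes> b) \<otimes> (c \<otimes> d) \<rightarrow> (a \<otimes> c) \<otimes> (b \<otimes> d)\<close>: it is natural, self-inverse, compatible with associativity,
units and symmetries, and preserved by lax functors.

The properties of the interchange are proved by a form of Cayley's theorem. A formal tensor product
acts on objects by tensoring its letters successively from the left, and an arrow between formal
tensor products is determined by the family of arrows that it induces between the actions
(\<open>represents_faithful\<close>). Associativity and unit isomorphisms induce identities, and the symmetry of two
letters induces an exchange of neighbouring factors, to which the hexagon reduces all other symmetries.
A coherence diagram thereby turns into an equation between composites of exchanges, which follows
because exchanges are natural and self-inverse.\<close>

section \<open>Calculating in a symmetric monoidal category\<close>

context category begin

lemma hom_iff: "f \<in> Hom C a b \<longleftrightarrow> f \<in> Arr C \<and> Dom C f = a \<and> Cod C f = b"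
  by (simp add: Hom_def)

lemma arr_hom: "f \<in> Arr C \<Longrightarrow> f \<in> Hom C (Dom C f) (Cod C f)"
  by (simp add: Hom_def)

declare dom_obj [simp] cod_obj [simp]

lemma idt_simps [simp]:
  assumes "a \<in> Obj C"
  shows "Idt C a \<in> Arr C" "Dom C (Idt C a) = a" "Cod C (Idt C a) = a"
  using idt_hom [OF assms] by (auto simp: hom_iff)

lemma comp_simps [simp]:
  assumes "f \<in> Arr C" "g \<in> Arr C" "Dom C g = Cod C f"
  shows "g \<cdot> f \<in> Arr C" "Dom C (g \<cdot> f) = Dom C f" "Cod C (g \<cdot> f) = Cod C g"
  using comp_hom [of f "Dom C f" "Cod C f" g "Cod C g"] assms by (auto simp: hom_iff)

lemma comp_idt_arr [simp]: "f \<in> Arr C \<Longrightarrow> Dom C f = a \<Longrightarrow> f \<cdot> Idt C a = f"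
  using comp_idt [of f "Dom C f" "Cod C f"] by (auto simp: hom_iff)

lemma idt_comp_arr [simp]: "f \<in> Arr C \<Longrightarrow> Cod C f = a \<Longrightarrow> Idt C a \<cdot> f = f"
  using idt_comp [of f "Dom C f" "Cod C f"] by (auto simp: hom_iff)

text \<open>Associativity in this direction makes right-nested composites the normal form of the simplifier. The
side conditions on domains and codomains are in the form \<open>f \<in> Arr C\<close>, \<open>Dom C f = \<dots>\<close>, which rewriting
can discharge without guessing the objects in between.\<close>

lemma comp_assoc_arr [simp]:
  "\<lbrakk>f \<in> Arr C; g \<in> Arr C; h \<in> Arr C; Dom C g = Cod C f; Dom C h = Cod C g\<rbrakk>
    \<Longrightarrow> (h \<cdot> g) \<cdot> f = h \<cdot> (g \<cdot> f)"
  using comp_assoc [of f "Dom C f" "Cod C f" g "Cod C g" h "Cod C h"] by (auto simp: hom_iff)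

text \<open>Only in this extended form does an equation apply inside a right-nested composite.\<close>

lemma comp_extend:
  "\<lbrakk>g \<cdot> f = k; f \<in> Arr C; g \<in> Arr C; x \<in> Arr C; Dom C g = Cod C f; Dom C f = Cod C x\<rbrakk>
    \<Longrightarrow> g \<cdot> (f \<cdot> x) = k \<cdot> x"
  by (metis comp_assoc_arr)

lemma comp_extend2:
  "\<lbrakk>g \<cdot> f = k \<cdot> h; f \<in> Arr C; g \<in> Arr C; x \<in> Arr C; Dom C g = Cod C f; Dom C f = Cod C x;
    h \<in> Arr C; k \<in> Arr C; Dom C k = Cod C h; Dom C h = Cod C x\<rbrakk>
    \<Longrightarrow> g \<cdot> (f \<cdot> x) = k \<cdot> (h \<cdot> x)"
  by (metis comp_assoc_arr)

lemma inverse_of_unique: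
  assumes "inverse_of C f g" "inverse_of C f h"
  shows "g = h"
proof -
  have "g = (h \<cdot> f) \<cdot> g"
    using assms by (simp add: inverse_of_def Hom_def)
  also have "\<dots> = h \<cdot> (f \<cdot> g)"
    using assms by (intro comp_assoc_arr) (auto simp: inverse_of_def Hom_def)
  also have "\<dots> = h"
    using assms by (simp add: inverse_of_def Hom_def)
  finally show ?thesis .
qed

lemma inv_arr_eqI: "inverse_of C f g \<Longrightarrow> inv_arr C f = g"
  unfolding inv_arr_def by (blast intro: inverse_of_unique)

lemma inverse_of_inv_arr: "iso_arr C f \<Longrightarrow> inverse_of C f (inv_arr C f)"
  unfolding iso_arr_def using inv_arr_eqI by blast

lemma inv_arr_simps [simp]:
  assumes "iso_arr C f"
  shows "inv_arr C f \<in> Arr C" "Dom C (inv_arr C f) = Cod C f" "Cod C (inv_arr C f) = Dom C f"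
    "inv_arr C f \<cdot> f = Idt C (Dom C f)" "f \<cdot> inv_arr C f = Idt C (Cod C f)"
  using inverse_of_inv_arr [OF assms] by (auto simp: inverse_of_def hom_iff)

lemma iso_arr_arr: "iso_arr C f \<Longrightarrow> f \<in> Arr C"
  by (auto simp: iso_arr_def inverse_of_def)

lemma inv_arr_comp_simps [simp]:
  assumes "iso_arr C f" "x \<in> Arr C"
  shows "Cod C x = Dom C f \<Longrightarrow> inv_arr C f \<cdot> (f \<cdot> x) = x"
    "Cod C x = Cod C f \<Longrightarrow> f \<cdot> (inv_arr C f \<cdot> x) = x"
  using assms iso_arr_arr [OF assms(1)] by (simp_all flip: comp_assoc_arr)

lemma iso_arrI:
  "\<lbrakk>f \<in> Arr C; g \<in> Arr C; Dom C g = Cod C f; Cod C g = Dom C f;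
    g \<cdot> f = Idt C (Dom C f); f \<cdot> g = Idt C (Cod C f)\<rbrakk> \<Longrightarrow> iso_arr C f"
  by (auto simp: iso_arr_def inverse_of_def hom_iff)

lemma inv_arr_eqI':
  "\<lbrakk>f \<in> Arr C; g \<in> Arr C; Dom C g = Cod C f; Cod C g = Dom C f;
    g \<cdot> f = Idt C (Dom C f); f \<cdot> g = Idt C (Cod C f)\<rbrakk> \<Longrightarrow> inv_arr C f = g"
  by (rule inv_arr_eqI) (auto simp: inverse_of_def hom_iff)

lemma iso_idt [simp]: "a \<in> Obj C \<Longrightarrow> iso_arr C (Idt C a)"
  by (rule iso_arrI [where g = "Idt C a"]) auto

lemma iso_comp [simp]:
  assumes "iso_arr C f" "iso_arr C g" "Dom C g = Cod C f"
  shows "iso_arr C (g \<cdot> f)"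
  using assms iso_arr_arr [OF assms(1)] iso_arr_arr [OF assms(2)]
  by (intro iso_arrI [where g = "inv_arr C f \<cdot> inv_arr C g"]) auto

lemma iso_inv [simp]: "iso_arr C f \<Longrightarrow> iso_arr C (inv_arr C f)"
  using iso_arr_arr by (intro iso_arrI [where g = f]) auto

lemma iso_cancel_left:
  assumes "iso_arr C g" "g \<cdot> f = g \<cdot> f'" "f \<in> Arr C" "f' \<in> Arr C" "Cod C f = Dom C g" "Cod C f' = Dom C g"
  shows "f = f'"
  using assms inv_arr_comp_simps(1) by metis

lemma iso_cancel_right:
  assumes "iso_arr C g" "f \<cdot> g = f' \<cdot> g" "f \<in> Arr C" "f' \<in> Arr C" "Dom C f = Cod C g" "Dom C f' = Cod C g"
  shows "f = f'"
proof -
  have "(f \<cdot> g) \<cdot> inv_arr C g = (f' \<cdot> g) \<cdot> inv_arr C g"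
    using assms(2) by simp
  then show ?thesis
    using assms(1,3-) iso_arr_arr [OF assms(1)] by simp
qed

lemma iso_move_left:
  assumes "iso_arr C g" "g \<cdot> f = h" "f \<in> Arr C" "Cod C f = Dom C g"
  shows "f = inv_arr C g \<cdot> h"
  using assms inv_arr_comp_simps(1) by metis

end

context symmetric_monoidal_category begin

declare tens_obj [simp] unit_obj [simp]

lemma tens_simps [simp]:
  assumes "f \<in> Arr C" "g \<in> Arr C"
  shows "f \<boxtimes> g \<in> Arr C" "Dom C (f \<boxtimes> g) = Dom C f \<otimes> Dom C g" "Cod C (f \<boxtimes> g) = Cod C f \<otimes> Cod C g"
  using tens_hom [OF arr_hom arr_hom, OF assms] by (auto simp: hom_iff)

declare tens_idt [simp]

text \<open>Fusing tensors of arrows decides most equations between composites that differ only in how they are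
cut into tensor factors. It is not a default rule because naturality is applied to the factors.\<close>

lemma tens_comp_arr:
  "\<lbrakk>f \<in> Arr C; g \<in> Arr C; f' \<in> Arr C; g' \<in> Arr C; Dom C g = Cod C f; Dom C g' = Cod C f'\<rbrakk>
    \<Longrightarrow> (g \<boxtimes> g') \<cdot> (f \<boxtimes> f') = (g \<cdot> f) \<boxtimes> (g' \<cdot> f')"
  using tens_comp [of f "Dom C f" "Cod C f" g "Cod C g" f' "Dom C f'" "Cod C f'" g' "Cod C g'"]
  by (auto simp: hom_iff)

lemma tens_comp_arr':
  "\<lbrakk>f \<in> Arr C; g \<in> Arr C; f' \<in> Arr C; g' \<in> Arr C; Dom C g = Cod C f; Dom C g' = Cod C f';
    x \<in> Arr C; Cod C x = Dom C f \<otimes> Dom C f'\<rbrakk>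
    \<Longrightarrow> (g \<boxtimes> g') \<cdot> ((f \<boxtimes> f') \<cdot> x) = ((g \<cdot> f) \<boxtimes> (g' \<cdot> f')) \<cdot> x"
  by (rule comp_extend) (auto simp: tens_comp_arr)

lemmas tens_merge = tens_comp_arr tens_comp_arr'

lemma iso_tens [simp]:
  assumes "iso_arr C f" "iso_arr C g"
  shows "iso_arr C (f \<boxtimes> g)"
  using assms iso_arr_arr [OF assms(1)] iso_arr_arr [OF assms(2)]
  by (intro iso_arrI [where g = "inv_arr C f \<boxtimes> inv_arr C g"]) (auto simp: tens_merge)

lemma assoc_simps [simp]:
  assumes "a \<in> Obj C" "b \<in> Obj C" "c \<in> Obj C"
  shows "Assoc C a b c \<in> Arr C" "Dom C (Assoc C a b c) = a \<otimes> (b \<otimes> c)"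
    "Cod C (Assoc C a b c) = (a \<otimes> b) \<otimes> c" "iso_arr C (Assoc C a b c)"
  using assoc_hom [OF assms] assoc_iso [OF assms] by (auto simp: hom_iff)

lemma runit_simps [simp]:
  assumes "a \<in> Obj C"
  shows "RUnit C a \<in> Arr C" "Dom C (RUnit C a) = a \<otimes> Unit C" "Cod C (RUnit C a) = a"
    "iso_arr C (RUnit C a)"
  using runit_hom [OF assms] runit_iso [OF assms] by (auto simp: hom_iff)

lemma lunit_simps [simp]:
  assumes "a \<in> Obj C"
  shows "LUnit C a \<in> Arr C" "Dom C (LUnit C a) = Unit C \<otimes> a" "Cod C (LUnit C a) = a"
    "iso_arr C (LUnit C a)"
  using lunit_hom [OF assms] lunit_iso [OF assms] by (auto simp: hom_iff)

lemma symm_simps [simp]: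
  assumes "a \<in> Obj C" "b \<in> Obj C"
  shows "Symm C a b \<in> Arr C" "Dom C (Symm C a b) = a \<otimes> b" "Cod C (Symm C a b) = b \<otimes> a"
    "Symm C b a \<cdot> Symm C a b = Idt C (a \<otimes> b)"
  using symm_hom [OF assms] symm_symm [OF assms] by (auto simp: hom_iff)

lemma assoc_nat_arr:
  "\<lbrakk>f \<in> Arr C; g \<in> Arr C; h \<in> Arr C\<rbrakk> \<Longrightarrow>
    Assoc C (Cod C f) (Cod C g) (Cod C h) \<cdot> (f \<boxtimes> (g \<boxtimes> h))
      = ((f \<boxtimes> g) \<boxtimes> h) \<cdot> Assoc C (Dom C f) (Dom C g) (Dom C h)"
  using assoc_nat [OF arr_hom arr_hom arr_hom] by auto

lemma symm_nat_arr:
  "\<lbrakk>f \<in> Arr C; g \<in> Arr C\<rbrakk> \<Longrightarrow>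
    Symm C (Cod C f) (Cod C g) \<cdot> (f \<boxtimes> g) = (g \<boxtimes> f) \<cdot> Symm C (Dom C f) (Dom C g)"
  using symm_nat [OF arr_hom arr_hom] by auto

lemma runit_nat_arr:
  "f \<in> Arr C \<Longrightarrow> RUnit C (Cod C f) \<cdot> (f \<boxtimes> Idt C (Unit C)) = f \<cdot> RUnit C (Dom C f)"
  using runit_nat [OF arr_hom] by auto

lemma lunit_nat_arr:
  "f \<in> Arr C \<Longrightarrow> LUnit C (Cod C f) \<cdot> (Idt C (Unit C) \<boxtimes> f) = f \<cdot> LUnit C (Dom C f)"
  using lunit_nat [OF arr_hom] by auto

text \<open>Tensoring with the unit is isomorphic to the identity functor, by naturality of the unitors.\<close>

lemma tens_unit_faithful:
  assumes "f \<in> Arr C" "g \<in> Arr C" "Dom C f = Dom C g" "Cod C f = Cod C g"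
    "f \<boxtimes> Idt C (Unit C) = g \<boxtimes> Idt C (Unit C)"
  shows "f = g"
proof -
  have "f \<cdot> RUnit C (Dom C f) = g \<cdot> RUnit C (Dom C f)"
    using runit_nat_arr [of f] runit_nat_arr [of g] assms by metis
  then show ?thesis
    by (rule iso_cancel_right [rotated]) (use assms in auto)
qed

lemma unit_tens_faithful:
  assumes "f \<in> Arr C" "g \<in> Arr C" "Dom C f = Dom C g" "Cod C f = Cod C g"
    "Idt C (Unit C) \<boxtimes> f = Idt C (Unit C) \<boxtimes> g"
  shows "f = g"
proof -
  have "f \<cdot> LUnit C (Dom C f) = g \<cdot> LUnit C (Dom C f)"
    using lunit_nat_arr [of f] lunit_nat_arr [of g] assms by metis
  then show ?thesis
    by (rule iso_cancel_right [rotated]) (use assms in auto)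
qed

text \<open>Kelly's derivation of the triangle for \<open>l\<close>: since \<open>I \<otimes> -\<close> is faithful, it is enough to compare the two
arrows after tensoring with \<open>I\<close>, and there the pentagon for \<open>I, I, x, z\<close> reduces the claim to two
instances of the triangle axiom.\<close>

lemma lunit_tens:
  assumes x: "x \<in> Obj C" and z: "z \<in> Obj C"
  shows "(LUnit C x \<boxtimes> Idt C z) \<cdot> Assoc C (Unit C) x z = LUnit C (x \<otimes> z)"
proof (rule unit_tens_faithful)
  let ?I = "Unit C" and ?i = "Idt C (Unit C)"
  have 1: "(?i \<boxtimes> ((LUnit C x \<boxtimes> Idt C z) \<cdot> Assoc C ?I x z))
      = (?i \<boxtimes> (LUnit C x \<boxtimes> Idt C z)) \<cdot> (?i \<boxtimes> Assoc C ?I x z)"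
    using x z by (simp add: tens_merge)
  have "Assoc C ?I x z \<cdot> (?i \<boxtimes> ((LUnit C x \<boxtimes> Idt C z) \<cdot> Assoc C ?I x z))
     = (Assoc C ?I x z \<cdot> (?i \<boxtimes> (LUnit C x \<boxtimes> Idt C z))) \<cdot> (?i \<boxtimes> Assoc C ?I x z)"
    using x z by (simp add: 1)
  also have "\<dots> = ((?i \<boxtimes> LUnit C x) \<boxtimes> Idt C z) \<cdot> Assoc C ?I (?I \<otimes> x) z \<cdot> (?i \<boxtimes> Assoc C ?I x z)"
    using x z assoc_nat_arr [of ?i "LUnit C x" "Idt C z"] by simp
  also have "(?i \<boxtimes> LUnit C x) \<boxtimes> Idt C z = ((RUnit C ?I \<boxtimes> Idt C x) \<boxtimes> Idt C z) \<cdot> (Assoc C ?I ?I x \<boxtimes> Idt C z)"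
    using x z by (simp add: tens_merge triangle)
  also have "(\<dots>) \<cdot> Assoc C ?I (?I \<otimes> x) z \<cdot> (?i \<boxtimes> Assoc C ?I x z)
     = ((RUnit C ?I \<boxtimes> Idt C x) \<boxtimes> Idt C z) \<cdot> Assoc C (?I \<otimes> ?I) x z \<cdot> Assoc C ?I ?I (x \<otimes> z)"
    using x z by (simp add: pentagon)
  also have "\<dots> = (((RUnit C ?I \<boxtimes> Idt C x) \<boxtimes> Idt C z) \<cdot> Assoc C (?I \<otimes> ?I) x z) \<cdot> Assoc C ?I ?I (x \<otimes> z)"
    using x z by simp
  also have "\<dots> = Assoc C ?I x z \<cdot> (RUnit C ?I \<boxtimes> Idt C (x \<otimes> z)) \<cdot> Assoc C ?I ?I (x \<otimes> z)"
    using x z assoc_nat_arr [of "RUnit C ?I" "Idt C x" "Idt C z", symmetric] by simp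
  also have "\<dots> = Assoc C ?I x z \<cdot> (?i \<boxtimes> LUnit C (x \<otimes> z))"
    using x z by (simp add: triangle)
  finally show "?i \<boxtimes> ((LUnit C x \<boxtimes> Idt C z) \<cdot> Assoc C ?I x z) = ?i \<boxtimes> LUnit C (x \<otimes> z)"
    by (rule iso_cancel_left [rotated]) (use x z in auto)
qed (use x z in auto)

text \<open>Naturality of a composite of structural arrows follows by pasting naturality squares: \<open>square x p q y\<close>
has \<open>x\<close> on top, \<open>y\<close> at the bottom, \<open>p\<close> on the left and \<open>q\<close> on the right.\<close>

definition square :: "'b \<Rightarrow> 'b \<Rightarrow> 'b \<Rightarrow> 'b \<Rightarrow> bool" where
  "square x p q y \<longleftrightarrow> x \<in> Arr C \<and> p \<in> Arr C \<and> q \<in> Arr C \<and> y \<in> Arr C \<and>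
     Dom C p = Dom C x \<and> Dom C q = Cod C x \<and> Dom C y = Cod C p \<and> Cod C q = Cod C y \<and>
     q \<cdot> x = y \<cdot> p"

lemma square_idt: "x \<in> Arr C \<Longrightarrow> a = Dom C x \<Longrightarrow> b = Cod C x \<Longrightarrow> square x (Idt C a) (Idt C b) x"
  by (simp add: square_def)

lemma square_comp:
  assumes "square x p q y" "square y p' q' w"
  shows "square x (p' \<cdot> p) (q' \<cdot> q) w"
proof -
  have "(q' \<cdot> q) \<cdot> x = q' \<cdot> (y \<cdot> p)"
    using assms by (auto simp: square_def)
  also have "\<dots> = (q' \<cdot> y) \<cdot> p"
    using assms by (subst comp_assoc_arr) (auto simp: square_def)
  also have "\<dots> = w \<cdot> (p' \<cdot> p)"
    using assms by (auto simp: square_def)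
  finally show ?thesis
    using assms by (auto simp: square_def)
qed

lemma square_inv:
  assumes sq: "square x p q y" and iso: "iso_arr C p" "iso_arr C q"
  shows "square y (inv_arr C p) (inv_arr C q) x"
proof -
  have arr: "x \<in> Arr C" "p \<in> Arr C" "q \<in> Arr C" "y \<in> Arr C" "Dom C p = Dom C x" "Dom C q = Cod C x"
      "Dom C y = Cod C p" "Cod C q = Cod C y" and eq: "q \<cdot> x = y \<cdot> p"
    using sq by (auto simp: square_def)
  have "inv_arr C q \<cdot> y = inv_arr C q \<cdot> (y \<cdot> p) \<cdot> inv_arr C p"
    using iso arr by simp
  also have "\<dots> = inv_arr C q \<cdot> (q \<cdot> x) \<cdot> inv_arr C p"
    by (simp only: eq)
  also have "\<dots> = x \<cdot> inv_arr C p"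
    using iso arr by simp
  finally show ?thesis
    using iso arr by (simp add: square_def)
qed

lemma square_stack:
  assumes "square x p q y" "square x' q q' y'"
  shows "square (x' \<cdot> x) p q' (y' \<cdot> y)"
proof -
  have "q' \<cdot> (x' \<cdot> x) = (q' \<cdot> x') \<cdot> x"
    using assms by (subst comp_assoc_arr) (auto simp: square_def)
  also have "\<dots> = y' \<cdot> (q \<cdot> x)"
    using assms by (auto simp: square_def)
  also have "\<dots> = (y' \<cdot> y) \<cdot> p"
    using assms by (auto simp: square_def)
  finally show ?thesis
    using assms by (auto simp: square_def)
qed

lemma square_tens:
  "square x p q y \<Longrightarrow> square x' p' q' y' \<Longrightarrow> square (x \<boxtimes> x') (p \<boxtimes> p') (q \<boxtimes> q') (y \<boxtimes> y')"
  by (simp add: square_def tens_merge)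

lemma square_assoc:
  "\<lbrakk>f \<in> Arr C; g \<in> Arr C; h \<in> Arr C\<rbrakk> \<Longrightarrow>
    square (f \<boxtimes> (g \<boxtimes> h)) (Assoc C (Dom C f) (Dom C g) (Dom C h)) (Assoc C (Cod C f) (Cod C g) (Cod C h))
      ((f \<boxtimes> g) \<boxtimes> h)"
  by (simp add: square_def assoc_nat_arr)

lemma square_symm:
  "\<lbrakk>f \<in> Arr C; g \<in> Arr C\<rbrakk> \<Longrightarrow>
    square (f \<boxtimes> g) (Symm C (Dom C f) (Dom C g)) (Symm C (Cod C f) (Cod C g)) (g \<boxtimes> f)"
  by (simp add: square_def symm_nat_arr)

end

section \<open>The action of formal tensor products\<close>

datatype (letters: 'o) word = Letter 'o | Empty | Node "'o word" "'o word"

context symmetric_monoidal_category begin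

definition wf_word :: "'a word \<Rightarrow> bool" where
  "wf_word t \<longleftrightarrow> letters t \<subseteq> Obj C"

lemma wf_word_simps [simp]:
  "wf_word (Letter a) \<longleftrightarrow> a \<in> Obj C" "wf_word Empty"
  "wf_word (Node t u) \<longleftrightarrow> wf_word t \<and> wf_word u"
  by (auto simp: wf_word_def)

fun obj_of :: "'a word \<Rightarrow> 'a" where
  "obj_of (Letter a) = a"
| "obj_of Empty = Unit C"
| "obj_of (Node t u) = obj_of t \<otimes> obj_of u"

text \<open>A word acts on an object by tensoring its letters one after the other from the left, so that the
result is always right-nested and brackets and units of the word leave no trace. The arrow \<open>gather t z\<close>
is the canonical isomorphism from \<open>act t z\<close> to \<open>obj_of t \<otimes> z\<close>.\<close>

fun act :: "'a word \<Rightarrow> 'a \<Rightarrow> 'a" where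
  "act (Letter a) z = a \<otimes> z"
| "act Empty z = z"
| "act (Node t u) z = act t (act u z)"

fun act_arr :: "'a word \<Rightarrow> 'b \<Rightarrow> 'b" where
  "act_arr (Letter a) f = Idt C a \<boxtimes> f"
| "act_arr Empty f = f"
| "act_arr (Node t u) f = act_arr t (act_arr u f)"

fun gather :: "'a word \<Rightarrow> 'a \<Rightarrow> 'b" where
  "gather (Letter a) z = Idt C (a \<otimes> z)"
| "gather Empty z = inv_arr C (LUnit C z)"
| "gather (Node t u) z =
    Assoc C (obj_of t) (obj_of u) z \<cdot> (Idt C (obj_of t) \<boxtimes> gather u z) \<cdot> gather t (act u z)"

lemma obj_of_obj [simp]: "wf_word t \<Longrightarrow> obj_of t \<in> Obj C"
  by (induction t) auto

lemma act_obj [simp]: "wf_word t \<Longrightarrow> z \<in> Obj C \<Longrightarrow> act t z \<in> Obj C"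
  by (induction t arbitrary: z) auto

lemma act_arr_simps [simp]:
  assumes "wf_word t" "f \<in> Arr C"
  shows "act_arr t f \<in> Arr C" "Dom C (act_arr t f) = act t (Dom C f)"
    "Cod C (act_arr t f) = act t (Cod C f)"
  using assms by (induction t arbitrary: f) auto

lemma act_arr_idt [simp]:
  "wf_word t \<Longrightarrow> z \<in> Obj C \<Longrightarrow> act_arr t (Idt C z) = Idt C (act t z)"
  by (induction t arbitrary: z) auto

lemma gather_simps [simp]:
  assumes "wf_word t" "z \<in> Obj C"
  shows "gather t z \<in> Arr C" "Dom C (gather t z) = act t z" "Cod C (gather t z) = obj_of t \<otimes> z"
    "iso_arr C (gather t z)"
  using assms by (induction t arbitrary: z) auto

lemma gather_nat:
  "wf_word t \<Longrightarrow> f \<in> Arr C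
    \<Longrightarrow> gather t (Cod C f) \<cdot> act_arr t f = (Idt C (obj_of t) \<boxtimes> f) \<cdot> gather t (Dom C f)"
proof (induction t arbitrary: f)
  case Empty
  then have f [simp]: "f \<in> Arr C" by simp
  have "LUnit C (Cod C f) \<cdot> (Idt C (Unit C) \<boxtimes> f) \<cdot> inv_arr C (LUnit C (Dom C f))
    = (LUnit C (Cod C f) \<cdot> (Idt C (Unit C) \<boxtimes> f)) \<cdot> inv_arr C (LUnit C (Dom C f))"
    by simp
  also have "\<dots> = f"
    by (simp add: lunit_nat_arr)
  finally show ?case
    using iso_move_left [of "LUnit C (Cod C f)" "(Idt C (Unit C) \<boxtimes> f) \<cdot> inv_arr C (LUnit C (Dom C f))" f] by simp
next
  case (Node t u)
  let ?t = "Idt C (obj_of t)" and ?u = "Idt C (obj_of u)"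
  let ?A = "Assoc C (obj_of t) (obj_of u)"
  have wf [simp]: "wf_word t" "wf_word u" and f [simp]: "f \<in> Arr C"
    using Node.prems by auto
  have "gather (Node t u) (Cod C f) \<cdot> act_arr (Node t u) f
    = ?A (Cod C f) \<cdot> (?t \<boxtimes> gather u (Cod C f)) \<cdot> gather t (act u (Cod C f)) \<cdot> act_arr t (act_arr u f)"
    by simp
  also have "gather t (act u (Cod C f)) \<cdot> act_arr t (act_arr u f)
      = (?t \<boxtimes> act_arr u f) \<cdot> gather t (act u (Dom C f))"
    using Node.IH(1) [of "act_arr u f"] by simp
  also have "(?t \<boxtimes> gather u (Cod C f)) \<cdot> \<dots>
    = (?t \<boxtimes> (gather u (Cod C f) \<cdot> act_arr u f)) \<cdot> gather t (act u (Dom C f))"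
    by (simp add: tens_merge)
  also have "gather u (Cod C f) \<cdot> act_arr u f = (?u \<boxtimes> f) \<cdot> gather u (Dom C f)"
    using Node.IH(2) [of f] by simp
  also have "(?t \<boxtimes> (\<dots>)) = (?t \<boxtimes> (?u \<boxtimes> f)) \<cdot> (?t \<boxtimes> gather u (Dom C f))"
    by (simp add: tens_merge)
  also have "?A (Cod C f) \<cdot> (\<dots>) \<cdot> gather t (act u (Dom C f))
    = (?A (Cod C f) \<cdot> (?t \<boxtimes> (?u \<boxtimes> f))) \<cdot> (?t \<boxtimes> gather u (Dom C f)) \<cdot> gather t (act u (Dom C f))"
    by simp
  also have "\<dots> = (Idt C (obj_of (Node t u)) \<boxtimes> f) \<cdot> gather (Node t u) (Dom C f)"
    using assoc_nat_arr [of ?t ?u f] by simp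
  finally show ?case .
qed auto

text \<open>The analogue of Cayley's theorem: \<open>f\<close> is represented by the family that \<open>f \<boxtimes> Idt C z\<close> becomes when it is
transported along \<open>gather\<close> at both ends. Because the unit may be put for \<open>z\<close>, the family determines \<open>f\<close>,
and the unit and associativity isomorphisms are all represented by identities. Hence an equation
between structural arrows need only be checked on the families, where bracketing has disappeared.\<close>

definition represents :: "'b \<Rightarrow> 'a word \<Rightarrow> 'a word \<Rightarrow> ('a \<Rightarrow> 'b) \<Rightarrow> bool" where
  "represents f t u \<alpha> \<longleftrightarrow> wf_word t \<and> wf_word u \<and> f \<in> Hom C (obj_of t) (obj_of u) \<and>
     (\<forall>z \<in> Obj C. \<alpha> z \<in> Hom C (act t z) (act u z) \<and>
        (f \<boxtimes> Idt C z) \<cdot> gather t z = gather u z \<cdot> \<alpha> z)"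

lemma represents_simps:
  assumes "represents f t u \<alpha>"
  shows "wf_word t" "wf_word u" "f \<in> Arr C" "Dom C f = obj_of t" "Cod C f = obj_of u"
    "z \<in> Obj C \<Longrightarrow> \<alpha> z \<in> Arr C" "z \<in> Obj C \<Longrightarrow> Dom C (\<alpha> z) = act t z"
    "z \<in> Obj C \<Longrightarrow> Cod C (\<alpha> z) = act u z"
    "z \<in> Obj C \<Longrightarrow> (f \<boxtimes> Idt C z) \<cdot> gather t z = gather u z \<cdot> \<alpha> z"
  using assms by (auto simp: represents_def hom_iff)

lemma representsI:
  assumes "wf_word t" "wf_word u" "f \<in> Arr C" "Dom C f = obj_of t" "Cod C f = obj_of u"
    "\<And>z. z \<in> Obj C \<Longrightarrow> \<alpha> z \<in> Arr C" "\<And>z. z \<in> Obj C \<Longrightarrow> Dom C (\<alpha> z) = act t z"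
    "\<And>z. z \<in> Obj C \<Longrightarrow> Cod C (\<alpha> z) = act u z"
    "\<And>z. z \<in> Obj C \<Longrightarrow> (f \<boxtimes> Idt C z) \<cdot> gather t z = gather u z \<cdot> \<alpha> z"
  shows "represents f t u \<alpha>"
  using assms by (auto simp: represents_def hom_iff)

lemma represents_cong:
  "represents f t u \<alpha> \<Longrightarrow> (\<And>z. z \<in> Obj C \<Longrightarrow> \<alpha> z = \<beta> z) \<Longrightarrow> represents f t u \<beta>"
  by (auto simp: represents_def)

lemma represents_faithful:
  assumes f: "represents f t u \<alpha>" and g: "represents g t u \<alpha>"
  shows "f = g"
proof (rule tens_unit_faithful)
  note [simp] = represents_simps [OF f] represents_simps [OF g]
  show "f \<boxtimes> Idt C (Unit C) = g \<boxtimes> Idt C (Unit C)"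
    by (rule iso_cancel_right [where g = "gather t (Unit C)"]) auto
qed (use represents_simps [OF f] represents_simps [OF g] in auto)

lemma represents_idt:
  "wf_word t \<Longrightarrow> a = obj_of t \<Longrightarrow> represents (Idt C a) t t (\<lambda>z. Idt C (act t z))"
  by (rule representsI) auto

lemma represents_comp:
  assumes f: "represents f t u \<alpha>" and g: "represents g u v \<beta>"
  shows "represents (g \<cdot> f) t v (\<lambda>z. \<beta> z \<cdot> \<alpha> z)"
proof (rule representsI)
  note [simp] = represents_simps(1-8) [OF f] represents_simps(1-8) [OF g]
  fix z assume z [simp]: "z \<in> Obj C"
  have "((g \<cdot> f) \<boxtimes> Idt C z) \<cdot> gather t z = (g \<boxtimes> Idt C z) \<cdot> (f \<boxtimes> Idt C z) \<cdot> gather t z"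
    by (simp add: tens_merge)
  also have "\<dots> = ((g \<boxtimes> Idt C z) \<cdot> gather u z) \<cdot> \<alpha> z"
    by (simp add: represents_simps(9) [OF f])
  also have "\<dots> = gather v z \<cdot> \<beta> z \<cdot> \<alpha> z"
    by (simp only: represents_simps(9) [OF g] z) simp
  finally show "((g \<cdot> f) \<boxtimes> Idt C z) \<cdot> gather t z = gather v z \<cdot> (\<beta> z \<cdot> \<alpha> z)" .
qed (use represents_simps [OF f] represents_simps [OF g] in auto)

lemma represents_inv:
  assumes f: "represents f t u \<alpha>" and g: "inverse_of C f g"
    and \<beta>: "\<And>z. z \<in> Obj C \<Longrightarrow> inverse_of C (\<alpha> z) (\<beta> z)"
  shows "represents g u t \<beta>"
proof (rule representsI)
  note [simp] = represents_simps(1-8) [OF f]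
  have [simp]: "g \<in> Arr C" "Dom C g = obj_of u" "Cod C g = obj_of t" and gf: "g \<cdot> f = Idt C (obj_of t)"
    using g by (auto simp: inverse_of_def hom_iff)
  fix z assume z [simp]: "z \<in> Obj C"
  have [simp]: "\<beta> z \<in> Arr C" "Dom C (\<beta> z) = act u z" "Cod C (\<beta> z) = act t z"
    "\<alpha> z \<cdot> \<beta> z = Idt C (act u z)"
    using \<beta> [OF z] by (auto simp: inverse_of_def hom_iff)
  have "(g \<boxtimes> Idt C z) \<cdot> gather u z = (g \<boxtimes> Idt C z) \<cdot> (gather u z \<cdot> \<alpha> z) \<cdot> \<beta> z"
    by simp
  also have "\<dots> = (g \<boxtimes> Idt C z) \<cdot> ((f \<boxtimes> Idt C z) \<cdot> gather t z) \<cdot> \<beta> z"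
    by (simp only: represents_simps(9) [OF f] z)
  also have "\<dots> = gather t z \<cdot> \<beta> z"
    by (simp add: tens_merge gf)
  finally show "(g \<boxtimes> Idt C z) \<cdot> gather u z = gather t z \<cdot> \<beta> z" .
  show "\<beta> z \<in> Arr C" "Dom C (\<beta> z) = act u z" "Cod C (\<beta> z) = act t z" by simp_all
qed (use represents_simps [OF f] g in \<open>auto simp: inverse_of_def hom_iff\<close>)

text \<open>The representing family of a tensor is the horizontal composite: first \<open>f\<close> acts on what the second
word produces, then \<open>g\<close> acts underneath the new first word. Naturality of \<open>gather\<close> allows the two steps
to be separated.\<close>

lemma represents_tens:
  assumes f: "represents f t u \<alpha>" and g: "represents g t' u' \<beta>"
  shows "represents (f \<boxtimes> g) (Node t t') (Node u u') (\<lambda>z. act_arr u (\<beta> z) \<cdot> \<alpha> (act t' z))"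
proof (rule representsI)
  note [simp] = represents_simps(1-8) [OF f] represents_simps(1-8) [OF g]
  fix z assume z [simp]: "z \<in> Obj C"
  let ?t = "Idt C (obj_of t)" and ?u = "Idt C (obj_of u)"
  have "((f \<boxtimes> g) \<boxtimes> Idt C z) \<cdot> gather (Node t t') z
    = (((f \<boxtimes> g) \<boxtimes> Idt C z) \<cdot> Assoc C (obj_of t) (obj_of t') z)
       \<cdot> (?t \<boxtimes> gather t' z) \<cdot> gather t (act t' z)"
    by simp
  also have "\<dots> = Assoc C (obj_of u) (obj_of u') z \<cdot> (f \<boxtimes> (g \<boxtimes> Idt C z))
       \<cdot> (?t \<boxtimes> gather t' z) \<cdot> gather t (act t' z)"
    using assoc_nat_arr [of f g "Idt C z", symmetric] by simp
  also have "(f \<boxtimes> (g \<boxtimes> Idt C z)) \<cdot> (?t \<boxtimes> gather t' z) \<cdot> gather t (act t' z)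
    = (f \<boxtimes> (gather u' z \<cdot> \<beta> z)) \<cdot> gather t (act t' z)"
    by (simp add: tens_merge represents_simps(9) [OF g])
  also have "\<dots> = (?u \<boxtimes> gather u' z) \<cdot> (?u \<boxtimes> \<beta> z) \<cdot> (f \<boxtimes> Idt C (act t' z)) \<cdot> gather t (act t' z)"
    by (simp add: tens_merge)
  also have "\<dots> = (?u \<boxtimes> gather u' z) \<cdot> ((?u \<boxtimes> \<beta> z) \<cdot> gather u (act t' z)) \<cdot> \<alpha> (act t' z)"
    by (simp add: represents_simps(9) [OF f])
  also have "(?u \<boxtimes> \<beta> z) \<cdot> gather u (act t' z) = gather u (act u' z) \<cdot> act_arr u (\<beta> z)"
    using gather_nat [of u "\<beta> z"] by simp
  finally show "((f \<boxtimes> g) \<boxtimes> Idt C z) \<cdot> gather (Node t t') z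
    = gather (Node u u') z \<cdot> (act_arr u (\<beta> z) \<cdot> \<alpha> (act t' z))"
    by simp
qed (use represents_simps [OF f] represents_simps [OF g] in auto)

text \<open>This is the pentagon, with \<open>z\<close> as the fourth object.\<close>

lemma represents_assoc:
  assumes [simp]: "wf_word t" "wf_word u" "wf_word v"
  shows "represents (Assoc C (obj_of t) (obj_of u) (obj_of v)) (Node t (Node u v)) (Node (Node t u) v)
    (\<lambda>z. Idt C (act t (act u (act v z))))"
proof (rule representsI)
  fix z assume z [simp]: "z \<in> Obj C"
  let ?t = "obj_of t" and ?u = "obj_of u" and ?v = "obj_of v"
  let ?i = "Idt C ?t" and ?j = "Idt C ?u"
  let ?rest = "(?i \<boxtimes> (?j \<boxtimes> gather v z)) \<cdot> (?i \<boxtimes> gather u (act v z)) \<cdot> gather t (act u (act v z))"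
  have "(Assoc C ?t ?u ?v \<boxtimes> Idt C z) \<cdot> gather (Node t (Node u v)) z
    = ((Assoc C ?t ?u ?v \<boxtimes> Idt C z) \<cdot> Assoc C ?t (?u \<otimes> ?v) z \<cdot> (?i \<boxtimes> Assoc C ?u ?v z)) \<cdot> ?rest"
    by (simp add: tens_merge)
  also have "\<dots> = Assoc C (?t \<otimes> ?u) ?v z \<cdot> (Assoc C ?t ?u (?v \<otimes> z) \<cdot> (?i \<boxtimes> (?j \<boxtimes> gather v z)))
      \<cdot> (?i \<boxtimes> gather u (act v z)) \<cdot> gather t (act u (act v z))"
    by (simp flip: pentagon)
  also have "Assoc C ?t ?u (?v \<otimes> z) \<cdot> (?i \<boxtimes> (?j \<boxtimes> gather v z))
    = (Idt C (?t \<otimes> ?u) \<boxtimes> gather v z) \<cdot> Assoc C ?t ?u (act v z)"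
    using assoc_nat_arr [of ?i ?j "gather v z"] by simp
  finally show "(Assoc C ?t ?u ?v \<boxtimes> Idt C z) \<cdot> gather (Node t (Node u v)) z
    = gather (Node (Node t u) v) z \<cdot> Idt C (act t (act u (act v z)))"
    by simp
qed auto

text \<open>This is the triangle axiom, and its counterpart for \<open>l\<close> below is the derived triangle \<open>lunit_tens\<close>.\<close>

lemma represents_runit:
  assumes [simp]: "wf_word t"
  shows "represents (RUnit C (obj_of t)) (Node t Empty) t (\<lambda>z. Idt C (act t z))"
proof (rule representsI)
  fix z assume z [simp]: "z \<in> Obj C"
  let ?t = "obj_of t"
  have "(RUnit C ?t \<boxtimes> Idt C z) \<cdot> gather (Node t Empty) z
    = ((RUnit C ?t \<boxtimes> Idt C z) \<cdot> Assoc C ?t (Unit C) z) \<cdot> (Idt C ?t \<boxtimes> inv_arr C (LUnit C z)) \<cdot> gather t z"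
    by simp
  also have "\<dots> = gather t z"
    by (simp only: triangle z obj_of_obj assms) (simp add: tens_merge)
  finally show "(RUnit C ?t \<boxtimes> Idt C z) \<cdot> gather (Node t Empty) z = gather t z \<cdot> Idt C (act t z)"
    by simp
qed auto

lemma represents_lunit:
  assumes [simp]: "wf_word t"
  shows "represents (LUnit C (obj_of t)) (Node Empty t) t (\<lambda>z. Idt C (act t z))"
proof (rule representsI)
  fix z assume z [simp]: "z \<in> Obj C"
  let ?t = "obj_of t"
  have "(LUnit C ?t \<boxtimes> Idt C z) \<cdot> gather (Node Empty t) z
    = ((LUnit C ?t \<boxtimes> Idt C z) \<cdot> Assoc C (Unit C) ?t z)
       \<cdot> ((Idt C (Unit C) \<boxtimes> gather t z) \<cdot> inv_arr C (LUnit C (act t z)))"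
    by simp
  also have "\<dots> = (LUnit C (?t \<otimes> z) \<cdot> (Idt C (Unit C) \<boxtimes> gather t z)) \<cdot> inv_arr C (LUnit C (act t z))"
    by (simp add: lunit_tens)
  also have "\<dots> = gather t z"
    using lunit_nat_arr [of "gather t z"] by simp
  finally show "(LUnit C ?t \<boxtimes> Idt C z) \<cdot> gather (Node Empty t) z = gather t z \<cdot> Idt C (act t z)"
    by simp
qed auto

end

section \<open>Coherence of the interchange\<close>

context symmetric_monoidal_category begin

lemma represents_inv_arr:
  assumes f: "represents f t u \<alpha>" and iso: "iso_arr C f"
    and \<beta>: "\<And>z. z \<in> Obj C \<Longrightarrow> inverse_of C (\<alpha> z) (\<beta> z)"
  shows "represents (inv_arr C f) u t \<beta>"
  using represents_inv [OF f inverse_of_inv_arr [OF iso] \<beta>] .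

lemma inverse_of_idt: "a \<in> Obj C \<Longrightarrow> inverse_of C (Idt C a) (Idt C a)"
  by (simp add: inverse_of_def hom_iff)

lemma represents_inv_assoc:
  assumes [simp]: "wf_word t" "wf_word u" "wf_word v"
  shows "represents (inv_arr C (Assoc C (obj_of t) (obj_of u) (obj_of v)))
    (Node (Node t u) v) (Node t (Node u v)) (\<lambda>z. Idt C (act t (act u (act v z))))"
  by (rule represents_inv_arr [OF represents_assoc]) (auto intro: inverse_of_idt)

lemma represents_inv_runit:
  assumes [simp]: "wf_word t"
  shows "represents (inv_arr C (RUnit C (obj_of t))) t (Node t Empty) (\<lambda>z. Idt C (act t z))"
  by (rule represents_inv_arr [OF represents_runit]) (auto intro: inverse_of_idt)

lemma represents_inv_lunit:
  assumes [simp]: "wf_word t"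
  shows "represents (inv_arr C (LUnit C (obj_of t))) t (Node Empty t) (\<lambda>z. Idt C (act t z))"
  by (rule represents_inv_arr [OF represents_lunit]) (auto intro: inverse_of_idt)

text \<open>The action of the symmetry of two letters exchanges the two outermost factors of a right-nested tensor.\<close>

definition swap :: "'a \<Rightarrow> 'a \<Rightarrow> 'a \<Rightarrow> 'b" where
  "swap a b z = inv_arr C (Assoc C b a z) \<cdot> (Symm C a b \<boxtimes> Idt C z) \<cdot> Assoc C a b z"

lemma swap_simps [simp]:
  assumes "a \<in> Obj C" "b \<in> Obj C" "z \<in> Obj C"
  shows "swap a b z \<in> Arr C" "Dom C (swap a b z) = a \<otimes> (b \<otimes> z)" "Cod C (swap a b z) = b \<otimes> (a \<otimes> z)"
    "swap b a z \<cdot> swap a b z = Idt C (a \<otimes> (b \<otimes> z))"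
    "x \<in> Arr C \<Longrightarrow> Cod C x = a \<otimes> (b \<otimes> z) \<Longrightarrow> swap b a z \<cdot> (swap a b z \<cdot> x) = x"
proof -
  show "swap a b z \<in> Arr C" "Dom C (swap a b z) = a \<otimes> (b \<otimes> z)" "Cod C (swap a b z) = b \<otimes> (a \<otimes> z)"
    using assms by (auto simp: swap_def)
  show 2: "swap b a z \<cdot> swap a b z = Idt C (a \<otimes> (b \<otimes> z))"
    using assms by (simp add: swap_def tens_merge)
  show "x \<in> Arr C \<Longrightarrow> Cod C x = a \<otimes> (b \<otimes> z) \<Longrightarrow> swap b a z \<cdot> (swap a b z \<cdot> x) = x"
    using assms by (subst comp_assoc_arr [symmetric]) (auto simp: 2, auto simp: swap_def)
qed

lemma swap_nat:
  assumes "a \<in> Obj C" "b \<in> Obj C" "f \<in> Arr C"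
  shows "swap a b (Cod C f) \<cdot> (Idt C a \<boxtimes> (Idt C b \<boxtimes> f))
    = (Idt C b \<boxtimes> (Idt C a \<boxtimes> f)) \<cdot> swap a b (Dom C f)"
proof -
  have "square (Idt C a \<boxtimes> (Idt C b \<boxtimes> f)) (swap a b (Dom C f)) (swap a b (Cod C f))
    (Idt C b \<boxtimes> (Idt C a \<boxtimes> f))"
  proof -
    have "square (Idt C a \<boxtimes> (Idt C b \<boxtimes> f)) (Assoc C a b (Dom C f)) (Assoc C a b (Cod C f))
        (Idt C (a \<otimes> b) \<boxtimes> f)"
      using assms square_assoc [of "Idt C a" "Idt C b" f] by simp
    moreover have "square (Idt C (a \<otimes> b) \<boxtimes> f) (Symm C a b \<boxtimes> Idt C (Dom C f))
        (Symm C a b \<boxtimes> Idt C (Cod C f)) (Idt C (b \<otimes> a) \<boxtimes> f)"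
      using assms square_tens [OF square_symm square_idt, of "Idt C a" "Idt C b" f] by simp
    moreover have "square (Idt C (b \<otimes> a) \<boxtimes> f) (inv_arr C (Assoc C b a (Dom C f)))
        (inv_arr C (Assoc C b a (Cod C f))) (Idt C b \<boxtimes> (Idt C a \<boxtimes> f))"
      using assms square_inv [OF square_assoc, of "Idt C b" "Idt C a" f] by simp
    ultimately show ?thesis
      unfolding swap_def by (blast intro: square_comp)
  qed
  then show ?thesis
    by (simp add: square_def)
qed

abbreviation symm_represents :: "'a word \<Rightarrow> 'a word \<Rightarrow> ('a \<Rightarrow> 'b) \<Rightarrow> bool" where
  "symm_represents t u \<equiv> represents (Symm C (obj_of t) (obj_of u)) (Node t u) (Node u t)"

lemma symm_represents_letters:
  "a \<in> Obj C \<Longrightarrow> b \<in> Obj C \<Longrightarrow> symm_represents (Letter a) (Letter b) (swap a b)"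
  by (rule representsI) (auto simp: swap_def)

lemma symm_represents_unit:
  assumes [simp]: "wf_word t"
  shows "symm_represents t Empty (\<lambda>z. Idt C (act t z))"
proof -
  let ?t = "obj_of t"
  have "Symm C ?t (Unit C) = inv_arr C (LUnit C ?t) \<cdot> RUnit C ?t"
    by (rule iso_move_left) (auto simp: symm_unit)
  then show ?thesis
    using represents_comp [OF represents_runit [of t] represents_inv_lunit [of t]]
    by (auto elim!: represents_cong)
qed

text \<open>By the hexagon, the symmetry that moves a word across a compound word is represented by moving it
across the two parts in turn; the brackets in the hexagon are represented by identities. The second
form is the inverse of the first with the roles of the two words exchanged.\<close>

lemma symm_represents_Node_left:
  assumes \<sigma>: "symm_represents t v \<sigma>" and \<tau>: "symm_represents u v \<tau>"
  shows "symm_represents (Node t u) v (\<lambda>z. \<sigma> (act u z) \<cdot> act_arr t (\<tau> z))"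
proof -
  note [simp] = represents_simps(1-8) [OF \<sigma>, simplified] represents_simps(1-8) [OF \<tau>, simplified]
  have wf: "wf_word t" "wf_word u" "wf_word v"
    by simp_all
  let ?t = "obj_of t" and ?u = "obj_of u" and ?v = "obj_of v"
  let ?r = "(Symm C ?t ?v \<boxtimes> Idt C ?u) \<cdot> Assoc C ?t ?v ?u \<cdot> (Idt C ?t \<boxtimes> Symm C ?u ?v)"
  let ?g = "inv_arr C (Assoc C ?v ?t ?u) \<cdot> ?r \<cdot> inv_arr C (Assoc C ?t ?u ?v)"
  have "?g = inv_arr C (Assoc C ?v ?t ?u) \<cdot> (Assoc C ?v ?t ?u \<cdot> Symm C (?t \<otimes> ?u) ?v \<cdot> Assoc C ?t ?u ?v) \<cdot> inv_arr C (Assoc C ?t ?u ?v)"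
    by (simp only: hexagon obj_of_obj wf)
  then have eq: "Symm C (?t \<otimes> ?u) ?v = ?g"
    by simp
  have "represents ?g (Node (Node t u) v) (Node v (Node t u)) (\<lambda>z. \<sigma> (act u z) \<cdot> act_arr t (\<tau> z))"
    \<comment> \<open>one rule for each arrow former; the last step collapses the identities representing brackets\<close>
    by (rule represents_cong,
        (rule represents_comp represents_tens represents_assoc represents_inv_assoc \<sigma> \<tau> represents_idt | simp)+)
  then show ?thesis
    by (simp add: eq)
qed

lemma symm_represents_Node_right:
  assumes \<sigma>: "symm_represents t u \<sigma>" and \<tau>: "symm_represents t v \<tau>"
  shows "symm_represents t (Node u v) (\<lambda>z. act_arr u (\<tau> z) \<cdot> \<sigma> (act v z))"
proof -
  note [simp] = represents_simps(1-8) [OF \<sigma>, simplified] represents_simps(1-8) [OF \<tau>, simplified]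
  have wf: "wf_word t" "wf_word u" "wf_word v"
    by simp_all
  let ?t = "obj_of t" and ?u = "obj_of u" and ?v = "obj_of v"
  let ?r = "(Symm C ?u ?t \<boxtimes> Idt C ?v) \<cdot> Assoc C ?u ?t ?v \<cdot> (Idt C ?u \<boxtimes> Symm C ?v ?t)"
  let ?r' = "(Idt C ?u \<boxtimes> Symm C ?t ?v) \<cdot> inv_arr C (Assoc C ?u ?t ?v) \<cdot> (Symm C ?t ?u \<boxtimes> Idt C ?v)"
  let ?g = "Assoc C ?u ?v ?t \<cdot> ?r' \<cdot> Assoc C ?t ?u ?v"
  have "Idt C (?t \<otimes> (?u \<otimes> ?v)) = (inv_arr C (Assoc C ?t ?u ?v) \<cdot> ?r \<cdot> inv_arr C (Assoc C ?u ?v ?t)) \<cdot> ?g"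
    by (simp add: tens_merge)
  also have "\<dots> = (inv_arr C (Assoc C ?t ?u ?v) \<cdot> (Assoc C ?t ?u ?v \<cdot> Symm C (?u \<otimes> ?v) ?t \<cdot> Assoc C ?u ?v ?t) \<cdot> inv_arr C (Assoc C ?u ?v ?t)) \<cdot> ?g"
    by (simp only: hexagon obj_of_obj wf)
  also have "\<dots> = Symm C (?u \<otimes> ?v) ?t \<cdot> ?g"
    by simp
  finally have "Symm C ?t (?u \<otimes> ?v) \<cdot> Idt C (?t \<otimes> (?u \<otimes> ?v)) = Symm C ?t (?u \<otimes> ?v) \<cdot> Symm C (?u \<otimes> ?v) ?t \<cdot> ?g"
    by simp
  also have "\<dots> = (Symm C ?t (?u \<otimes> ?v) \<cdot> Symm C (?u \<otimes> ?v) ?t) \<cdot> ?g"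
    by (subst comp_assoc_arr) auto
  also have "\<dots> = ?g"
    by simp
  finally have eq: "Symm C ?t (?u \<otimes> ?v) = ?g"
    by simp
  have "represents ?g (Node t (Node u v)) (Node (Node u v) t) (\<lambda>z. act_arr u (\<tau> z) \<cdot> \<sigma> (act v z))"
    \<comment> \<open>one rule for each arrow former; the last step collapses the identities representing brackets\<close>
    by (rule represents_cong,
        (rule represents_comp represents_tens represents_assoc represents_inv_assoc \<sigma> \<tau> represents_idt | simp)+)
  then show ?thesis
    by (simp add: eq)
qed

text \<open>Of the five factors of the interchange only the symmetry in the middle has a nontrivial
representation.\<close>

lemma represents_interchange:
  assumes \<sigma>: "symm_represents u v \<sigma>" and [simp]: "wf_word t" "wf_word w"
  shows "represents (interchange C (obj_of t) (obj_of u) (obj_of v) (obj_of w))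
    (Node (Node t u) (Node v w)) (Node (Node t v) (Node u w)) (\<lambda>z. act_arr t (\<sigma> (act w z)))"
proof -
  note [simp] = represents_simps(1-8) [OF \<sigma>, simplified]
  show ?thesis
    unfolding interchange_def
    \<comment> \<open>the associativity rules are repeated for compound words because \<open>obj_of\<close> has been simplified there\<close>
    by (rule represents_cong,
        (rule represents_comp represents_tens represents_assoc represents_inv_assoc
          represents_assoc [of _ "Node _ _", simplified] represents_assoc [of _ _ "Node _ _", simplified]
          represents_inv_assoc [of _ _ "Node _ _", simplified]
          \<sigma> represents_idt | simp)+)
qed

lemma interchange_nat:
  assumes "f \<in> Arr C" "g \<in> Arr C" "h \<in> Arr C" "k \<in> Arr C"
  shows "interchange C (Cod C f) (Cod C g) (Cod C h) (Cod C k) \<cdot> ((f \<boxtimes> g) \<boxtimes> (h \<boxtimes> k))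
    = ((f \<boxtimes> h) \<boxtimes> (g \<boxtimes> k)) \<cdot> interchange C (Dom C f) (Dom C g) (Dom C h) (Dom C k)"
proof -
  have "square ((f \<boxtimes> g) \<boxtimes> (h \<boxtimes> k)) (interchange C (Dom C f) (Dom C g) (Dom C h) (Dom C k))
    (interchange C (Cod C f) (Cod C g) (Cod C h) (Cod C k)) ((f \<boxtimes> h) \<boxtimes> (g \<boxtimes> k))"
  proof -
    let ?d = "Dom C" and ?c = "Cod C"
    have "square ((f \<boxtimes> g) \<boxtimes> (h \<boxtimes> k)) (inv_arr C (Assoc C (?d f) (?d g) (?d h \<otimes> ?d k)))
        (inv_arr C (Assoc C (?c f) (?c g) (?c h \<otimes> ?c k))) (f \<boxtimes> (g \<boxtimes> (h \<boxtimes> k)))"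
      using assms square_inv [OF square_assoc, of f g "h \<boxtimes> k"] by simp
    moreover have "square (f \<boxtimes> (g \<boxtimes> (h \<boxtimes> k))) (Idt C (?d f) \<boxtimes> Assoc C (?d g) (?d h) (?d k))
        (Idt C (?c f) \<boxtimes> Assoc C (?c g) (?c h) (?c k)) (f \<boxtimes> ((g \<boxtimes> h) \<boxtimes> k))"
      using assms square_tens [OF square_idt square_assoc, of f _ _ g h k] by simp
    moreover have "square (f \<boxtimes> ((g \<boxtimes> h) \<boxtimes> k)) (Idt C (?d f) \<boxtimes> (Symm C (?d g) (?d h) \<boxtimes> Idt C (?d k)))
        (Idt C (?c f) \<boxtimes> (Symm C (?c g) (?c h) \<boxtimes> Idt C (?c k))) (f \<boxtimes> ((h \<boxtimes> g) \<boxtimes> k))"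
      using assms square_tens [OF square_idt square_tens [OF square_symm square_idt], of f _ _ g h k] by simp
    moreover have "square (f \<boxtimes> ((h \<boxtimes> g) \<boxtimes> k)) (Idt C (?d f) \<boxtimes> inv_arr C (Assoc C (?d h) (?d g) (?d k)))
        (Idt C (?c f) \<boxtimes> inv_arr C (Assoc C (?c h) (?c g) (?c k))) (f \<boxtimes> (h \<boxtimes> (g \<boxtimes> k)))"
      using assms square_tens [OF square_idt square_inv [OF square_assoc], of f _ _ h g k] by simp
    moreover have "square (f \<boxtimes> (h \<boxtimes> (g \<boxtimes> k))) (Assoc C (?d f) (?d h) (?d g \<otimes> ?d k))
        (Assoc C (?c f) (?c h) (?c g \<otimes> ?c k)) ((f \<boxtimes> h) \<boxtimes> (g \<boxtimes> k))"
      using assms square_assoc [of f h "g \<boxtimes> k"] by simp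
    ultimately show ?thesis
      unfolding interchange_def by (blast intro: square_comp)
  qed
  then show ?thesis
    by (simp add: square_def)
qed

context
  fixes a b c d :: 'a
  assumes obj [simp]: "a \<in> Obj C" "b \<in> Obj C" "c \<in> Obj C" "d \<in> Obj C"
begin

lemma represents_interchange_letters:
  "represents (interchange C a b c d)
    (Node (Node (Letter a) (Letter b)) (Node (Letter c) (Letter d)))
    (Node (Node (Letter a) (Letter c)) (Node (Letter b) (Letter d)))
    (\<lambda>z. Idt C a \<boxtimes> swap b c (d \<otimes> z))"
  using represents_interchange [OF symm_represents_letters, of b c "Letter a" "Letter d"] by simp

lemma interchange_simps [simp]:
  "interchange C a b c d \<in> Arr C"
  "Dom C (interchange C a b c d) = (a \<otimes> b) \<otimes> (c \<otimes> d)"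
  "Cod C (interchange C a b c d) = (a \<otimes> c) \<otimes> (b \<otimes> d)"
  using represents_simps(3-5) [OF represents_interchange_letters] by simp_all

end

text \<open>The facts that follow say that \<open>\<otimes>\<close>, with the interchange as structure arrow, is a symmetric monoidal
functor of two variables. In each case both sides are represented by composites of \<open>swap\<close>s, and these
agree because \<open>swap\<close> is natural and self-inverse.\<close>

lemma interchange_interchange [simp]:
  assumes [simp]: "a \<in> Obj C" "b \<in> Obj C" "c \<in> Obj C" "d \<in> Obj C"
  shows "interchange C a c b d \<cdot> interchange C a b c d = Idt C ((a \<otimes> b) \<otimes> (c \<otimes> d))"
proof (rule represents_faithful)
  let ?w = "Node (Node (Letter a) (Letter b)) (Node (Letter c) (Letter d))"
  show "represents (interchange C a c b d \<cdot> interchange C a b c d) ?w ?w (\<lambda>z. Idt C (act ?w z))"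
    by (rule represents_cong, rule represents_comp, (rule represents_interchange_letters; simp)+)
      (simp add: tens_merge)
  show "represents (Idt C ((a \<otimes> b) \<otimes> (c \<otimes> d))) ?w ?w (\<lambda>z. Idt C (act ?w z))"
    by (rule represents_idt) simp_all
qed

lemma interchange_cancel [simp]:
  "\<lbrakk>a \<in> Obj C; b \<in> Obj C; c \<in> Obj C; d \<in> Obj C; x \<in> Arr C; Cod C x = (a \<otimes> b) \<otimes> (c \<otimes> d)\<rbrakk>
    \<Longrightarrow> interchange C a c b d \<cdot> (interchange C a b c d \<cdot> x) = x"
  by (subst comp_assoc_arr [symmetric]) simp_all

lemma interchange_assoc:
  assumes [simp]: "a \<in> Obj C" "b \<in> Obj C" "c \<in> Obj C" "a' \<in> Obj C" "b' \<in> Obj C" "c' \<in> Obj C"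
  shows "(Assoc C a b c \<boxtimes> Assoc C a' b' c') \<cdot> interchange C a a' (b \<otimes> c) (b' \<otimes> c')
      \<cdot> (Idt C (a \<otimes> a') \<boxtimes> interchange C b b' c c')
    = interchange C (a \<otimes> b) (a' \<otimes> b') c c' \<cdot> (interchange C a a' b b' \<boxtimes> Idt C (c \<otimes> c'))
      \<cdot> Assoc C (a \<otimes> a') (b \<otimes> b') (c \<otimes> c')"
proof (rule represents_faithful)
  let ?a = "Letter a" and ?b = "Letter b" and ?c = "Letter c"
  let ?a' = "Letter a'" and ?b' = "Letter b'" and ?c' = "Letter c'"
  let ?s = "Node (Node ?a ?a') (Node (Node ?b ?b') (Node ?c ?c'))"
  let ?t = "Node (Node (Node ?a ?b) ?c) (Node (Node ?a' ?b') ?c')"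
  let ?i = "Idt C"
  \<comment> \<open>three exchanges turn \<open>a, a', b, b', c, c'\<close> into \<open>a, b, c, a', b', c'\<close>\<close>
  let ?\<alpha> = "\<lambda>z. (?i a \<boxtimes> (?i b \<boxtimes> swap a' c (b' \<otimes> (c' \<otimes> z))))
    \<cdot> (?i a \<boxtimes> swap a' b (c \<otimes> (b' \<otimes> (c' \<otimes> z))))
    \<cdot> (?i a \<boxtimes> (?i a' \<boxtimes> (?i b \<boxtimes> swap b' c (c' \<otimes> z))))"
  have bc: "symm_represents ?a' (Node ?b ?c)
      (\<lambda>z. (?i b \<boxtimes> swap a' c z) \<cdot> swap a' b (c \<otimes> z))"
    using symm_represents_Node_right [OF symm_represents_letters symm_represents_letters, of a' b c] by simp
  have ab: "symm_represents (Node ?a' ?b') ?c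
      (\<lambda>z. swap a' c (b' \<otimes> z) \<cdot> (?i a' \<boxtimes> swap b' c z))"
    using symm_represents_Node_left [OF symm_represents_letters symm_represents_letters, of a' c b'] by simp
  have nat: "swap a' b (c \<otimes> (b' \<otimes> (c' \<otimes> z))) \<cdot> (?i a' \<boxtimes> (?i b \<boxtimes> swap b' c (c' \<otimes> z)))
    = (?i b \<boxtimes> (?i a' \<boxtimes> swap b' c (c' \<otimes> z))) \<cdot> swap a' b (b' \<otimes> (c \<otimes> (c' \<otimes> z)))"
    if "z \<in> Obj C" for z
    using swap_nat [of a' b "swap b' c (c' \<otimes> z)"] that by simp
  show "represents ((Assoc C a b c \<boxtimes> Assoc C a' b' c') \<cdot> interchange C a a' (b \<otimes> c) (b' \<otimes> c')
      \<cdot> (Idt C (a \<otimes> a') \<boxtimes> interchange C b b' c c')) ?s ?t ?\<alpha>"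
    apply (rule represents_cong)
     apply (rule represents_comp)
      apply (rule represents_comp)
       apply (rule represents_tens)
        apply (rule represents_idt; simp)
       apply (rule represents_interchange_letters; simp)
      apply (rule represents_interchange [OF bc, of ?a "Node ?b' ?c'", simplified])
     apply (rule represents_tens [OF represents_assoc [of ?a ?b ?c, simplified] represents_assoc [of ?a' ?b' ?c', simplified]])
    apply (simp add: tens_merge)
    done
  show "represents (interchange C (a \<otimes> b) (a' \<otimes> b') c c' \<cdot> (interchange C a a' b b' \<boxtimes> Idt C (c \<otimes> c'))
      \<cdot> Assoc C (a \<otimes> a') (b \<otimes> b') (c \<otimes> c')) ?s ?t ?\<alpha>"
    apply (rule represents_cong)
     apply (rule represents_comp)
      apply (rule represents_comp)
       apply (rule represents_assoc [of "Node ?a ?a'" "Node ?b ?b'" "Node ?c ?c'", simplified])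
      apply (rule represents_tens)
       apply (rule represents_interchange_letters; simp)
      apply (rule represents_idt; simp)
     apply (rule represents_interchange [OF ab, of "Node ?a ?b" ?c', simplified])
    apply (simp add: tens_merge nat)
    done
qed

lemma interchange_runit:
  assumes [simp]: "a \<in> Obj C" "b \<in> Obj C"
  shows "(RUnit C a \<boxtimes> RUnit C b) \<cdot> interchange C a b (Unit C) (Unit C)
      \<cdot> (Idt C (a \<otimes> b) \<boxtimes> inv_arr C (RUnit C (Unit C))) = RUnit C (a \<otimes> b)"
proof (rule represents_faithful)
  let ?a = "Letter a" and ?b = "Letter b"
  let ?\<alpha> = "\<lambda>z. Idt C (a \<otimes> (b \<otimes> z))"
  show "represents ((RUnit C a \<boxtimes> RUnit C b) \<cdot> interchange C a b (Unit C) (Unit C)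
      \<cdot> (Idt C (a \<otimes> b) \<boxtimes> inv_arr C (RUnit C (Unit C)))) (Node (Node ?a ?b) Empty) (Node ?a ?b) ?\<alpha>"
    apply (rule represents_cong)
     apply (rule represents_comp)
      apply (rule represents_comp)
       apply (rule represents_tens)
        apply (rule represents_idt; simp)
       apply (rule represents_inv_runit [of Empty, simplified])
      apply (rule represents_interchange [OF symm_represents_unit, of ?b ?a Empty, simplified])
     apply (rule represents_tens [OF represents_runit [of ?a, simplified] represents_runit [of ?b, simplified]])
    apply simp
    done
  show "represents (RUnit C (a \<otimes> b)) (Node (Node ?a ?b) Empty) (Node ?a ?b) ?\<alpha>"
    using represents_runit [of "Node ?a ?b"] by simp
qed

lemma interchange_lunit:
  assumes [simp]: "a \<in> Obj C" "b \<in> Obj C"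
  shows "(LUnit C a \<boxtimes> LUnit C b) \<cdot> interchange C (Unit C) (Unit C) a b
      \<cdot> (inv_arr C (RUnit C (Unit C)) \<boxtimes> Idt C (a \<otimes> b)) = LUnit C (a \<otimes> b)"
proof (rule represents_faithful)
  let ?a = "Letter a" and ?b = "Letter b"
  let ?\<alpha> = "\<lambda>z. Idt C (a \<otimes> (b \<otimes> z))"
  have Ia: "symm_represents Empty ?a (\<lambda>z. Idt C (a \<otimes> z))"
    by (rule represents_inv [OF symm_represents_unit]) (auto simp: inverse_of_def hom_iff)
  show "represents ((LUnit C a \<boxtimes> LUnit C b) \<cdot> interchange C (Unit C) (Unit C) a b
      \<cdot> (inv_arr C (RUnit C (Unit C)) \<boxtimes> Idt C (a \<otimes> b))) (Node Empty (Node ?a ?b)) (Node ?a ?b) ?\<alpha>"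
    apply (rule represents_cong)
     apply (rule represents_comp)
      apply (rule represents_comp)
       apply (rule represents_tens)
        apply (rule represents_inv_runit [of Empty, simplified])
       apply (rule represents_idt; simp)
      apply (rule represents_interchange [OF Ia, of Empty ?b, simplified])
     apply (rule represents_tens [OF represents_lunit [of ?a, simplified] represents_lunit [of ?b, simplified]])
    apply simp
    done
  show "represents (LUnit C (a \<otimes> b)) (Node Empty (Node ?a ?b)) (Node ?a ?b) ?\<alpha>"
    using represents_lunit [of "Node ?a ?b"] by simp
qed

lemma interchange_symm:
  assumes [simp]: "a \<in> Obj C" "b \<in> Obj C" "c \<in> Obj C" "d \<in> Obj C"
  shows "interchange C c d a b \<cdot> Symm C (a \<otimes> b) (c \<otimes> d)
    = (Symm C a c \<boxtimes> Symm C b d) \<cdot> interchange C a b c d"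
proof (rule represents_faithful)
  let ?a = "Letter a" and ?b = "Letter b" and ?c = "Letter c" and ?d = "Letter d"
  let ?s = "Node (Node ?a ?b) (Node ?c ?d)" and ?t = "Node (Node ?c ?a) (Node ?d ?b)"
  let ?i = "Idt C"
  \<comment> \<open>three exchanges turn \<open>a, b, c, d\<close> into \<open>c, a, d, b\<close>; the left-hand side also exchanges \<open>a, d\<close> and back\<close>
  let ?\<alpha> = "\<lambda>z. (?i c \<boxtimes> (?i a \<boxtimes> swap b d z)) \<cdot> swap a c (b \<otimes> (d \<otimes> z)) \<cdot> (?i a \<boxtimes> swap b c (d \<otimes> z))"
  have ab: "symm_represents (Node ?a ?b) x (\<lambda>z. swap a y (b \<otimes> z) \<cdot> (?i a \<boxtimes> swap b y z))"
    if "x = Letter y" "y \<in> Obj C" for x y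
    using symm_represents_Node_left [OF symm_represents_letters symm_represents_letters, of a y b] that by simp
  have abcd: "symm_represents (Node ?a ?b) (Node ?c ?d) (\<lambda>z.
      ((?i c \<boxtimes> swap a d (b \<otimes> z)) \<cdot> (?i c \<boxtimes> (?i a \<boxtimes> swap b d z)))
       \<cdot> (swap a c (b \<otimes> (d \<otimes> z)) \<cdot> (?i a \<boxtimes> swap b c (d \<otimes> z))))"
    by (rule represents_cong [OF symm_represents_Node_right [OF ab ab]]) (auto simp: tens_merge)
  show "represents (interchange C c d a b \<cdot> Symm C (a \<otimes> b) (c \<otimes> d)) ?s ?t ?\<alpha>"
    apply (rule represents_cong)
     apply (rule represents_comp [OF abcd [simplified] represents_interchange_letters]; simp)
    apply (simp add: tens_merge)
    done
  show "represents ((Symm C a c \<boxtimes> Symm C b d) \<cdot> interchange C a b c d) ?s ?t ?\<alpha>"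
    apply (rule represents_cong)
     apply (rule represents_comp)
      apply (rule represents_interchange_letters; simp)
     apply (rule represents_tens [OF symm_represents_letters [of a c, simplified] symm_represents_letters [of b d, simplified]])
    apply simp_all
    done
qed

lemma tens_idt_split:
  assumes "f \<in> Arr C" "g \<in> Arr C" "Dom C g = Cod C f" "c \<in> Obj C"
  shows "(g \<cdot> f) \<boxtimes> Idt C c = (g \<boxtimes> Idt C c) \<cdot> (f \<boxtimes> Idt C c)"
    "Idt C c \<boxtimes> (g \<cdot> f) = (Idt C c \<boxtimes> g) \<cdot> (Idt C c \<boxtimes> f)"
  using assms by (simp_all add: tens_merge)

text \<open>Naturality in the form used for rewriting: tensors of arrows move to the left past an interchange,
also when the pair of arrows on one side is an identity that has been simplified to a single one.\<close>

lemma interchange_past: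
  assumes "f \<in> Arr C" "g \<in> Arr C" "h \<in> Arr C" "k \<in> Arr C"
    "Cod C f = a" "Cod C g = b" "Cod C h = c" "Cod C k = d"
  shows "interchange C a b c d \<cdot> ((f \<boxtimes> g) \<boxtimes> (h \<boxtimes> k))
    = ((f \<boxtimes> h) \<boxtimes> (g \<boxtimes> k)) \<cdot> interchange C (Dom C f) (Dom C g) (Dom C h) (Dom C k)"
  using interchange_nat [of f g h k] assms by simp

lemma interchange_past':
  assumes "f \<in> Arr C" "g \<in> Arr C" "h \<in> Arr C" "k \<in> Arr C"
    "Cod C f = a" "Cod C g = b" "Cod C h = c" "Cod C k = d"
    "x \<in> Arr C" "Cod C x = (Dom C f \<otimes> Dom C g) \<otimes> (Dom C h \<otimes> Dom C k)"
  shows "interchange C a b c d \<cdot> (((f \<boxtimes> g) \<boxtimes> (h \<boxtimes> k)) \<cdot> x)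
    = ((f \<boxtimes> h) \<boxtimes> (g \<boxtimes> k)) \<cdot> (interchange C (Dom C f) (Dom C g) (Dom C h) (Dom C k) \<cdot> x)"
  by (rule comp_extend2 [OF interchange_past]) (use assms in auto)

lemma interchange_past_left:
  assumes "f \<in> Arr C" "g \<in> Arr C" "Cod C f = a" "Cod C g = b" "c \<in> Obj C" "d \<in> Obj C"
    "x \<in> Arr C" "Cod C x = (Dom C f \<otimes> Dom C g) \<otimes> (c \<otimes> d)"
  shows "interchange C a b c d \<cdot> (((f \<boxtimes> g) \<boxtimes> Idt C (c \<otimes> d)) \<cdot> x)
    = ((f \<boxtimes> Idt C c) \<boxtimes> (g \<boxtimes> Idt C d)) \<cdot> (interchange C (Dom C f) (Dom C g) c d \<cdot> x)"
  using interchange_past' [of f g "Idt C c" "Idt C d" a b c d x] assms by simp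

lemma interchange_past_right:
  assumes "f \<in> Arr C" "g \<in> Arr C" "Cod C f = c" "Cod C g = d" "a \<in> Obj C" "b \<in> Obj C"
    "x \<in> Arr C" "Cod C x = (a \<otimes> b) \<otimes> (Dom C f \<otimes> Dom C g)"
  shows "interchange C a b c d \<cdot> ((Idt C (a \<otimes> b) \<boxtimes> (f \<boxtimes> g)) \<cdot> x)
    = ((Idt C a \<boxtimes> f) \<boxtimes> (Idt C b \<boxtimes> g)) \<cdot> (interchange C a b (Dom C f) (Dom C g) \<cdot> x)"
  using interchange_past' [of "Idt C a" "Idt C b" f g a b c d x] assms by simp

text \<open>Exchanging the two middle objects in an interchange gives its inverse, so each compatibility has a
second form with the interchanges on the other side. The first form serves to show that the pointwise
tensor of two functors is a functor, the second that the pointwise structural arrows are monoidal.\<close>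

lemma interchange_assoc_dual:
  assumes [simp]: "a \<in> Obj C" "b \<in> Obj C" "c \<in> Obj C" "a' \<in> Obj C" "b' \<in> Obj C" "c' \<in> Obj C"
  shows "Assoc C (a \<otimes> a') (b \<otimes> b') (c \<otimes> c') \<cdot> (Idt C (a \<otimes> a') \<boxtimes> interchange C b c b' c')
      \<cdot> interchange C a (b \<otimes> c) a' (b' \<otimes> c')
    = (interchange C a b a' b' \<boxtimes> Idt C (c \<otimes> c')) \<cdot> interchange C (a \<otimes> b) c (a' \<otimes> b') c'
      \<cdot> (Assoc C a b c \<boxtimes> Assoc C a' b' c')" (is "?l = ?r")
proof -
  let ?m = "interchange C"
  let ?X = "?m a a' (b \<otimes> c) (b' \<otimes> c') \<cdot> (Idt C (a \<otimes> a') \<boxtimes> ?m b b' c c')"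
  let ?Y = "?m (a \<otimes> b) (a' \<otimes> b') c c' \<cdot> (?m a a' b b' \<boxtimes> Idt C (c \<otimes> c'))"
  let ?A = "Assoc C (a \<otimes> a') (b \<otimes> b') (c \<otimes> c')"
  let ?AA = "Assoc C a b c \<boxtimes> Assoc C a' b' c'"
  have eq: "?AA \<cdot> ?X = ?Y \<cdot> ?A"
    using interchange_assoc [of a b c a' b' c'] by simp
  let ?X' = "(Idt C (a \<otimes> a') \<boxtimes> ?m b c b' c') \<cdot> ?m a (b \<otimes> c) a' (b' \<otimes> c')"
  let ?Y' = "(?m a b a' b' \<boxtimes> Idt C (c \<otimes> c')) \<cdot> ?m (a \<otimes> b) c (a' \<otimes> b') c'"
  have "?Y' \<cdot> ?AA = ?Y' \<cdot> (?AA \<cdot> ?X) \<cdot> ?X'"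
    by (simp add: tens_merge)
  also have "\<dots> = ?Y' \<cdot> (?Y \<cdot> ?A) \<cdot> ?X'"
    by (simp only: eq)
  also have "\<dots> = ?A \<cdot> ?X'"
    by (simp add: tens_merge)
  finally show ?thesis
    by simp
qed

lemma interchange_runit_dual:
  assumes [simp]: "a \<in> Obj C" "b \<in> Obj C"
  shows "RUnit C (a \<otimes> b) \<cdot> (Idt C (a \<otimes> b) \<boxtimes> RUnit C (Unit C)) \<cdot> interchange C a (Unit C) b (Unit C)
    = RUnit C a \<boxtimes> RUnit C b"
  by (simp add: tens_merge flip: interchange_runit)

lemma interchange_lunit_dual:
  assumes [simp]: "a \<in> Obj C" "b \<in> Obj C"
  shows "LUnit C (a \<otimes> b) \<cdot> (RUnit C (Unit C) \<boxtimes> Idt C (a \<otimes> b)) \<cdot> interchange C (Unit C) a (Unit C) b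
    = LUnit C a \<boxtimes> LUnit C b"
  by (simp add: tens_merge flip: interchange_lunit)

lemma interchange_symm_dual:
  assumes [simp]: "a \<in> Obj C" "b \<in> Obj C" "c \<in> Obj C" "d \<in> Obj C"
  shows "Symm C (a \<otimes> c) (b \<otimes> d) \<cdot> interchange C a b c d = interchange C b a d c \<cdot> (Symm C a b \<boxtimes> Symm C c d)"
proof -
  have "Symm C (a \<otimes> c) (b \<otimes> d) \<cdot> interchange C a b c d
    = interchange C b a d c \<cdot> (interchange C b d a c \<cdot> Symm C (a \<otimes> c) (b \<otimes> d)) \<cdot> interchange C a b c d"
    by simp
  also have "\<dots> = interchange C b a d c \<cdot> (Symm C a b \<boxtimes> Symm C c d)"
    by (simp only: interchange_symm assms) simp
  finally show ?thesis .
qed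

lemma symm_unit_unit [simp]: "Symm C (Unit C) (Unit C) = Idt C (Unit C \<otimes> Unit C)"
proof (rule iso_cancel_left [where g = "LUnit C (Unit C)"])
  show "LUnit C (Unit C) \<cdot> Symm C (Unit C) (Unit C) = LUnit C (Unit C) \<cdot> Idt C (Unit C \<otimes> Unit C)"
    by (subst symm_unit) (simp_all add: unit_coh)
qed simp_all

lemma assoc_inv_runit:
  "Assoc C (Unit C) (Unit C) (Unit C) \<cdot> (Idt C (Unit C) \<boxtimes> inv_arr C (RUnit C (Unit C))) 
    = inv_arr C (RUnit C (Unit C)) \<boxtimes> Idt C (Unit C)"
proof -
  let ?I = "Unit C" and ?i = "Idt C (Unit C)" and ?r = "RUnit C (Unit C)"
  have "Assoc C ?I ?I ?I \<cdot> (?i \<boxtimes> inv_arr C ?r)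
    = (inv_arr C ?r \<boxtimes> ?i) \<cdot> ((?r \<boxtimes> ?i) \<cdot> Assoc C ?I ?I ?I) \<cdot> (?i \<boxtimes> inv_arr C ?r)"
    by (subst comp_assoc_arr) (simp_all add: tens_merge)
  also have "\<dots> = inv_arr C ?r \<boxtimes> ?i"
    by (simp only: triangle unit_obj) (simp add: tens_merge unit_coh)
  finally show ?thesis .
qed

end

section \<open>The internal hom is a symmetric monoidal category\<close>

lemma smf_eqI:
  "\<lbrakk>fob F = fob G; far F = far G; fzero F = fzero G; ftwo F = ftwo G\<rbrakk>
    \<Longrightarrow> F = (G :: ('o1, 'm1, 'o2, 'm2) smf)"
  by simp

lemma mnt_eqI:
  "\<lbrakk>nsrc \<sigma> = nsrc \<tau>; ntrg \<sigma> = ntrg \<tau>; ncmp \<sigma> = ncmp \<tau>\<rbrakk> \<Longrightarrow> \<sigma> = (\<tau> :: ('o1, 'm1, 'o2, 'm2) mnt)"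
  by simp

lemma ihom_Obj [simp]: "F \<in> Obj (A \<Rrightarrow> B) \<longleftrightarrow> symmetric_monoidal_functor A B F"
  and ihom_Arr [simp]: "\<theta> \<in> Arr (A \<Rrightarrow> B) \<longleftrightarrow> monoidal_transformation A B \<theta>"
  and ihom_Dom [simp]: "Dom (A \<Rrightarrow> B) = nsrc"
  and ihom_Cod [simp]: "Cod (A \<Rrightarrow> B) = ntrg"
  and ihom_Tens [simp]: "Tens (A \<Rrightarrow> B) = smf_tens A B"
  and ihom_Unit [simp]: "Unit (A \<Rrightarrow> B) = smf_unit A B"
  by (simp_all add: ihom_def)

lemma ihom_nsrc [simp]:
  "nsrc (Idt (A \<Rrightarrow> B) F) = F"
  "nsrc (\<tau> \<cdot>\<^bsub>A \<Rrightarrow> B\<^esub> \<sigma>) = nsrc \<sigma>"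
  "nsrc (\<sigma> \<boxtimes>\<^bsub>A \<Rrightarrow> B\<^esub> \<tau>) = smf_tens A B (nsrc \<sigma>) (nsrc \<tau>)"
  "nsrc (Assoc (A \<Rrightarrow> B) F G H) = smf_tens A B F (smf_tens A B G H)"
  "nsrc (RUnit (A \<Rrightarrow> B) F) = smf_tens A B F (smf_unit A B)"
  "nsrc (LUnit (A \<Rrightarrow> B) F) = smf_tens A B (smf_unit A B) F"
  "nsrc (Symm (A \<Rrightarrow> B) F G) = smf_tens A B F G"
  by (simp_all add: ihom_def)

lemma ihom_ntrg [simp]:
  "ntrg (Idt (A \<Rrightarrow> B) F) = F"
  "ntrg (\<tau> \<cdot>\<^bsub>A \<Rrightarrow> B\<^esub> \<sigma>) = ntrg \<tau>"
  "ntrg (\<sigma> \<boxtimes>\<^bsub>A \<Rrightarrow> B\<^esub> \<tau>) = smf_tens A B (ntrg \<sigma>) (ntrg \<tau>)"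
  "ntrg (Assoc (A \<Rrightarrow> B) F G H) = smf_tens A B (smf_tens A B F G) H"
  "ntrg (RUnit (A \<Rrightarrow> B) F) = F"
  "ntrg (LUnit (A \<Rrightarrow> B) F) = F"
  "ntrg (Symm (A \<Rrightarrow> B) F G) = smf_tens A B G F"
  by (simp_all add: ihom_def)

lemma ihom_ncmp:
  "ncmp (Idt (A \<Rrightarrow> B) F) = (\<lambda>a \<in> Obj A. Idt B (fob F a))"
  "ncmp (\<tau> \<cdot>\<^bsub>A \<Rrightarrow> B\<^esub> \<sigma>) = (\<lambda>a \<in> Obj A. ncmp \<tau> a \<cdot>\<^bsub>B\<^esub> ncmp \<sigma> a)"
  "ncmp (\<sigma> \<boxtimes>\<^bsub>A \<Rrightarrow> B\<^esub> \<tau>) = (\<lambda>a \<in> Obj A. ncmp \<sigma> a \<boxtimes>\<^bsub>B\<^esub> ncmp \<tau> a)"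
  "ncmp (Assoc (A \<Rrightarrow> B) F G H) = (\<lambda>a \<in> Obj A. Assoc B (fob F a) (fob G a) (fob H a))"
  "ncmp (RUnit (A \<Rrightarrow> B) F) = (\<lambda>a \<in> Obj A. RUnit B (fob F a))"
  "ncmp (LUnit (A \<Rrightarrow> B) F) = (\<lambda>a \<in> Obj A. LUnit B (fob F a))"
  "ncmp (Symm (A \<Rrightarrow> B) F G) = (\<lambda>a \<in> Obj A. Symm B (fob F a) (fob G a))"
  by (simp_all add: ihom_def)

lemma ihom_ncmp_apply [simp]:
  assumes "a \<in> Obj A"
  shows "ncmp (Idt (A \<Rrightarrow> B) F) a = Idt B (fob F a)"
    "ncmp (\<tau> \<cdot>\<^bsub>A \<Rrightarrow> B\<^esub> \<sigma>) a = ncmp \<tau> a \<cdot>\<^bsub>B\<^esub> ncmp \<sigma> a"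
    "ncmp (\<sigma> \<boxtimes>\<^bsub>A \<Rrightarrow> B\<^esub> \<tau>) a = ncmp \<sigma> a \<boxtimes>\<^bsub>B\<^esub> ncmp \<tau> a"
    "ncmp (Assoc (A \<Rrightarrow> B) F G H) a = Assoc B (fob F a) (fob G a) (fob H a)"
    "ncmp (RUnit (A \<Rrightarrow> B) F) a = RUnit B (fob F a)"
    "ncmp (LUnit (A \<Rrightarrow> B) F) a = LUnit B (fob F a)"
    "ncmp (Symm (A \<Rrightarrow> B) F G) a = Symm B (fob F a) (fob G a)"
  using assms by (simp_all add: ihom_ncmp)

lemma ihom_ncmp_extensional [simp]:
  "ncmp (Idt (A \<Rrightarrow> B) F) \<in> extensional (Obj A)"
  "ncmp (\<tau> \<cdot>\<^bsub>A \<Rrightarrow> B\<^esub> \<sigma>) \<in> extensional (Obj A)"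
  "ncmp (\<sigma> \<boxtimes>\<^bsub>A \<Rrightarrow> B\<^esub> \<tau>) \<in> extensional (Obj A)"
  "ncmp (Assoc (A \<Rrightarrow> B) F G H) \<in> extensional (Obj A)"
  "ncmp (RUnit (A \<Rrightarrow> B) F) \<in> extensional (Obj A)"
  "ncmp (LUnit (A \<Rrightarrow> B) F) \<in> extensional (Obj A)"
  "ncmp (Symm (A \<Rrightarrow> B) F G) \<in> extensional (Obj A)"
  by (simp_all add: ihom_ncmp)

lemma smf_tens_simps [simp]:
  "a \<in> Obj A \<Longrightarrow> fob (smf_tens A B F G) a = fob F a \<otimes>\<^bsub>B\<^esub> fob G a"
  "f \<in> Arr A \<Longrightarrow> far (smf_tens A B F G) f = far F f \<boxtimes>\<^bsub>B\<^esub> far G f"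
  "fzero (smf_tens A B F G) = (fzero F \<boxtimes>\<^bsub>B\<^esub> fzero G) \<cdot>\<^bsub>B\<^esub> inv_arr B (RUnit B (Unit B))"
  "a \<in> Obj A \<Longrightarrow> b \<in> Obj A \<Longrightarrow> ftwo (smf_tens A B F G) a b =
    (ftwo F a b \<boxtimes>\<^bsub>B\<^esub> ftwo G a b) \<cdot>\<^bsub>B\<^esub> interchange B (fob F a) (fob G a) (fob F b) (fob G b)"
  by (simp_all add: smf_tens_def)

lemma smf_unit_simps [simp]:
  "a \<in> Obj A \<Longrightarrow> fob (smf_unit A B) a = Unit B"
  "f \<in> Arr A \<Longrightarrow> far (smf_unit A B) f = Idt B (Unit B)"
  "fzero (smf_unit A B) = Idt B (Unit B)"
  "a \<in> Obj A \<Longrightarrow> b \<in> Obj A \<Longrightarrow> ftwo (smf_unit A B) a b = RUnit B (Unit B)"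
  by (simp_all add: smf_unit_def)

lemma smf_comp_simps [simp]:
  "x \<in> Obj X \<Longrightarrow> fob (smf_comp X Z G F) x = fob G (fob F x)"
  "f \<in> Arr X \<Longrightarrow> far (smf_comp X Z G F) f = far G (far F f)"
  "fzero (smf_comp X Z G F) = far G (fzero F) \<cdot>\<^bsub>Z\<^esub> fzero G"
  "x \<in> Obj X \<Longrightarrow> y \<in> Obj X \<Longrightarrow>
    ftwo (smf_comp X Z G F) x y = far G (ftwo F x y) \<cdot>\<^bsub>Z\<^esub> ftwo G (fob F x) (fob F y)"
  by (simp_all add: smf_comp_def)

text \<open>Since values outside the carriers are fixed, equality need only be checked on the carriers.\<close>

lemma smf_ext:
  assumes F: "symmetric_monoidal_functor A B F" and G: "symmetric_monoidal_functor A B G"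
    and "\<And>a. a \<in> Obj A \<Longrightarrow> fob F a = fob G a" "\<And>f. f \<in> Arr A \<Longrightarrow> far F f = far G f"
    "fzero F = fzero G" "\<And>a b. a \<in> Obj A \<Longrightarrow> b \<in> Obj A \<Longrightarrow> ftwo F a b = ftwo G a b"
  shows "F = G"
proof -
  interpret F: symmetric_monoidal_functor A B F by fact
  interpret G: symmetric_monoidal_functor A B G by fact
  have "ftwo F a = ftwo G a" if "a \<in> Obj A" for a
    using that assms(6) by (intro extensionalityI [OF F.ftwo_ext' G.ftwo_ext'])
  then show ?thesis
    using assms(3-5)
    by (intro smf_eqI extensionalityI [OF F.fob_ext G.fob_ext] extensionalityI [OF F.far_ext G.far_ext]
        extensionalityI [OF F.ftwo_ext G.ftwo_ext])
qed

lemma mnt_ext: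
  assumes "ncmp \<sigma> \<in> extensional (Obj A)" "ncmp \<tau> \<in> extensional (Obj A)"
    and "nsrc \<sigma> = nsrc \<tau>" "ntrg \<sigma> = ntrg \<tau>" "\<And>a. a \<in> Obj A \<Longrightarrow> ncmp \<sigma> a = ncmp \<tau> a"
  shows "\<sigma> = (\<tau> :: ('o1, 'm1, 'o2, 'm2) mnt)"
  using assms by (intro mnt_eqI extensionalityI)

text \<open>Two categories are fixed in order that facts about functors and transformations between them can
serve as conditional rewrite rules.\<close>

locale smc_pair = A: symmetric_monoidal_category A + B: symmetric_monoidal_category B
  for A :: "('o1, 'm1) smc_data" and B :: "('o2, 'm2) smc_data"
begin

abbreviation smf :: "('o1, 'm1, 'o2, 'm2) smf \<Rightarrow> bool" where
  "smf \<equiv> symmetric_monoidal_functor A B"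

abbreviation mnt :: "('o1, 'm1, 'o2, 'm2) mnt \<Rightarrow> bool" where
  "mnt \<equiv> monoidal_transformation A B"

lemma smf_simps [simp]:
  assumes "smf F"
  shows "x \<in> Obj A \<Longrightarrow> fob F x \<in> Obj B"
    "f \<in> Arr A \<Longrightarrow> far F f \<in> Arr B"
    "f \<in> Arr A \<Longrightarrow> Dom B (far F f) = fob F (Dom A f)"
    "f \<in> Arr A \<Longrightarrow> Cod B (far F f) = fob F (Cod A f)"
    "x \<in> Obj A \<Longrightarrow> far F (Idt A x) = Idt B (fob F x)"
    "fzero F \<in> Arr B" "Dom B (fzero F) = Unit B" "Cod B (fzero F) = fob F (Unit A)"
    "x \<in> Obj A \<Longrightarrow> y \<in> Obj A \<Longrightarrow> ftwo F x y \<in> Arr B"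
    "x \<in> Obj A \<Longrightarrow> y \<in> Obj A \<Longrightarrow> Dom B (ftwo F x y) = fob F x \<otimes>\<^bsub>B\<^esub> fob F y"
    "x \<in> Obj A \<Longrightarrow> y \<in> Obj A \<Longrightarrow> Cod B (ftwo F x y) = fob F (x \<otimes>\<^bsub>A\<^esub> y)"
proof -
  interpret symmetric_monoidal_functor A B F by fact
  show "x \<in> Obj A \<Longrightarrow> fob F x \<in> Obj B" "x \<in> Obj A \<Longrightarrow> far F (Idt A x) = Idt B (fob F x)"
    using fob_obj far_idt by auto
  show "f \<in> Arr A \<Longrightarrow> far F f \<in> Arr B"
    "f \<in> Arr A \<Longrightarrow> Dom B (far F f) = fob F (Dom A f)"
    "f \<in> Arr A \<Longrightarrow> Cod B (far F f) = fob F (Cod A f)"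
    using far_hom [OF A.arr_hom, of f] by (auto simp: B.hom_iff)
  show "fzero F \<in> Arr B" "Dom B (fzero F) = Unit B" "Cod B (fzero F) = fob F (Unit A)"
    using fzero_hom by (auto simp: B.hom_iff)
  show "x \<in> Obj A \<Longrightarrow> y \<in> Obj A \<Longrightarrow> ftwo F x y \<in> Arr B"
    "x \<in> Obj A \<Longrightarrow> y \<in> Obj A \<Longrightarrow> Dom B (ftwo F x y) = fob F x \<otimes>\<^bsub>B\<^esub> fob F y"
    "x \<in> Obj A \<Longrightarrow> y \<in> Obj A \<Longrightarrow> Cod B (ftwo F x y) = fob F (x \<otimes>\<^bsub>A\<^esub> y)"
    using ftwo_hom [of x y] by (auto simp: B.hom_iff)
qed

lemma far_comp_arr:
  "\<lbrakk>smf F; f \<in> Arr A; g \<in> Arr A; Dom A g = Cod A f\<rbrakk> \<Longrightarrow> far F (g \<cdot>\<^bsub>A\<^esub> f) = far F g \<cdot>\<^bsub>B\<^esub> far F f"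
  using symmetric_monoidal_functor.far_comp [of A B F f "Dom A f" "Cod A f" g "Cod A g"]
  by (auto simp: A.hom_iff)

lemma ftwo_nat_arr:
  "\<lbrakk>smf F; f \<in> Arr A; g \<in> Arr A\<rbrakk> \<Longrightarrow>
    ftwo F (Cod A f) (Cod A g) \<cdot>\<^bsub>B\<^esub> (far F f \<boxtimes>\<^bsub>B\<^esub> far F g)
      = far F (f \<boxtimes>\<^bsub>A\<^esub> g) \<cdot>\<^bsub>B\<^esub> ftwo F (Dom A f) (Dom A g)"
  using symmetric_monoidal_functor.ftwo_nat [of A B F f "Dom A f" "Cod A f" g "Dom A g" "Cod A g"]
  by (auto simp: A.hom_iff)

lemma smfI:
  assumes "fob F \<in> extensional (Obj A)" "far F \<in> extensional (Arr A)" "ftwo F \<in> extensional (Obj A)"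
    "\<And>x. x \<in> Obj A \<Longrightarrow> ftwo F x \<in> extensional (Obj A)"
    "\<And>x. x \<in> Obj A \<Longrightarrow> fob F x \<in> Obj B"
    "\<And>f. f \<in> Arr A \<Longrightarrow> far F f \<in> Arr B"
    "\<And>f. f \<in> Arr A \<Longrightarrow> Dom B (far F f) = fob F (Dom A f)"
    "\<And>f. f \<in> Arr A \<Longrightarrow> Cod B (far F f) = fob F (Cod A f)"
    "\<And>x. x \<in> Obj A \<Longrightarrow> far F (Idt A x) = Idt B (fob F x)"
    "\<And>f g. \<lbrakk>f \<in> Arr A; g \<in> Arr A; Dom A g = Cod A f\<rbrakk> \<Longrightarrow> far F (g \<cdot>\<^bsub>A\<^esub> f) = far F g \<cdot>\<^bsub>B\<^esub> far F f"
    "fzero F \<in> Arr B" "Dom B (fzero F) = Unit B" "Cod B (fzero F) = fob F (Unit A)"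
    "\<And>x y. x \<in> Obj A \<Longrightarrow> y \<in> Obj A \<Longrightarrow> ftwo F x y \<in> Arr B"
    "\<And>x y. x \<in> Obj A \<Longrightarrow> y \<in> Obj A \<Longrightarrow> Dom B (ftwo F x y) = fob F x \<otimes>\<^bsub>B\<^esub> fob F y"
    "\<And>x y. x \<in> Obj A \<Longrightarrow> y \<in> Obj A \<Longrightarrow> Cod B (ftwo F x y) = fob F (x \<otimes>\<^bsub>A\<^esub> y)"
    "\<And>f g. f \<in> Arr A \<Longrightarrow> g \<in> Arr A \<Longrightarrow>
      ftwo F (Cod A f) (Cod A g) \<cdot>\<^bsub>B\<^esub> (far F f \<boxtimes>\<^bsub>B\<^esub> far F g)
      = far F (f \<boxtimes>\<^bsub>A\<^esub> g) \<cdot>\<^bsub>B\<^esub> ftwo F (Dom A f) (Dom A g)"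
    "\<And>x y z. \<lbrakk>x \<in> Obj A; y \<in> Obj A; z \<in> Obj A\<rbrakk>
      \<Longrightarrow> ftwo F (x \<otimes>\<^bsub>A\<^esub> y) z \<cdot>\<^bsub>B\<^esub> (ftwo F x y \<boxtimes>\<^bsub>B\<^esub> Idt B (fob F z))
            \<cdot>\<^bsub>B\<^esub> Assoc B (fob F x) (fob F y) (fob F z)
        = far F (Assoc A x y z) \<cdot>\<^bsub>B\<^esub> ftwo F x (y \<otimes>\<^bsub>A\<^esub> z)
            \<cdot>\<^bsub>B\<^esub> (Idt B (fob F x) \<boxtimes>\<^bsub>B\<^esub> ftwo F y z)"
    "\<And>x. x \<in> Obj A
      \<Longrightarrow> far F (RUnit A x) \<cdot>\<^bsub>B\<^esub> ftwo F x (Unit A) \<cdot>\<^bsub>B\<^esub> (Idt B (fob F x) \<boxtimes>\<^bsub>B\<^esub> fzero F)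
        = RUnit B (fob F x)"
    "\<And>x. x \<in> Obj A
      \<Longrightarrow> far F (LUnit A x) \<cdot>\<^bsub>B\<^esub> ftwo F (Unit A) x \<cdot>\<^bsub>B\<^esub> (fzero F \<boxtimes>\<^bsub>B\<^esub> Idt B (fob F x))
        = LUnit B (fob F x)"
    "\<And>x y. \<lbrakk>x \<in> Obj A; y \<in> Obj A\<rbrakk>
      \<Longrightarrow> ftwo F y x \<cdot>\<^bsub>B\<^esub> Symm B (fob F x) (fob F y) = far F (Symm A x y) \<cdot>\<^bsub>B\<^esub> ftwo F x y"
  shows "smf F"
proof
  fix f x x' g y y'
  assume "f \<in> Hom A x x'" "g \<in> Hom A y y'"
  then show "ftwo F x' y' \<cdot>\<^bsub>B\<^esub> (far F f \<boxtimes>\<^bsub>B\<^esub> far F g) = far F (f \<boxtimes>\<^bsub>A\<^esub> g) \<cdot>\<^bsub>B\<^esub> ftwo F x y"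
    using assms(17) [of f g] by (auto simp: A.hom_iff)
qed (use assms in \<open>auto simp: A.hom_iff B.hom_iff\<close>)

lemma mnt_simps [simp]:
  assumes "mnt \<theta>"
  shows "smf (nsrc \<theta>)" "smf (ntrg \<theta>)"
    "x \<in> Obj A \<Longrightarrow> ncmp \<theta> x \<in> Arr B"
    "x \<in> Obj A \<Longrightarrow> Dom B (ncmp \<theta> x) = fob (nsrc \<theta>) x"
    "x \<in> Obj A \<Longrightarrow> Cod B (ncmp \<theta> x) = fob (ntrg \<theta>) x"
    "ncmp \<theta> \<in> extensional (Obj A)"
proof -
  interpret monoidal_transformation A B \<theta> by fact
  show "smf (nsrc \<theta>)" "smf (ntrg \<theta>)" "ncmp \<theta> \<in> extensional (Obj A)"
    by (fact src_functor trg_functor ncmp_ext)+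
  show "x \<in> Obj A \<Longrightarrow> ncmp \<theta> x \<in> Arr B"
    "x \<in> Obj A \<Longrightarrow> Dom B (ncmp \<theta> x) = fob (nsrc \<theta>) x"
    "x \<in> Obj A \<Longrightarrow> Cod B (ncmp \<theta> x) = fob (ntrg \<theta>) x"
    using ncmp_hom [of x] by (auto simp: B.hom_iff)
qed

lemma ncmp_nat_arr:
  "\<lbrakk>mnt \<theta>; f \<in> Arr A\<rbrakk> \<Longrightarrow>
    ncmp \<theta> (Cod A f) \<cdot>\<^bsub>B\<^esub> far (nsrc \<theta>) f = far (ntrg \<theta>) f \<cdot>\<^bsub>B\<^esub> ncmp \<theta> (Dom A f)"
  using monoidal_transformation.ncmp_nat [of A B \<theta> f "Dom A f" "Cod A f"] by (auto simp: A.hom_iff)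

lemma mntI:
  assumes "smf (nsrc \<theta>)" "smf (ntrg \<theta>)" "ncmp \<theta> \<in> extensional (Obj A)"
    "\<And>x. x \<in> Obj A \<Longrightarrow> ncmp \<theta> x \<in> Arr B"
    "\<And>x. x \<in> Obj A \<Longrightarrow> Dom B (ncmp \<theta> x) = fob (nsrc \<theta>) x"
    "\<And>x. x \<in> Obj A \<Longrightarrow> Cod B (ncmp \<theta> x) = fob (ntrg \<theta>) x"
    "\<And>f. f \<in> Arr A \<Longrightarrow>
      ncmp \<theta> (Cod A f) \<cdot>\<^bsub>B\<^esub> far (nsrc \<theta>) f = far (ntrg \<theta>) f \<cdot>\<^bsub>B\<^esub> ncmp \<theta> (Dom A f)"
    "ncmp \<theta> (Unit A) \<cdot>\<^bsub>B\<^esub> fzero (nsrc \<theta>) = fzero (ntrg \<theta>)"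
    "\<And>x y. x \<in> Obj A \<Longrightarrow> y \<in> Obj A \<Longrightarrow>
      ncmp \<theta> (x \<otimes>\<^bsub>A\<^esub> y) \<cdot>\<^bsub>B\<^esub> ftwo (nsrc \<theta>) x y
        = ftwo (ntrg \<theta>) x y \<cdot>\<^bsub>B\<^esub> (ncmp \<theta> x \<boxtimes>\<^bsub>B\<^esub> ncmp \<theta> y)"
  shows "mnt \<theta>"
proof (rule monoidal_transformation.intro)
  fix f x y
  assume "f \<in> Hom A x y"
  then show "ncmp \<theta> y \<cdot>\<^bsub>B\<^esub> far (nsrc \<theta>) f = far (ntrg \<theta>) f \<cdot>\<^bsub>B\<^esub> ncmp \<theta> x"
    using assms(7) [of f] by (auto simp: A.hom_iff)
qed (use assms in \<open>auto simp: B.hom_iff\<close>)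

lemmas smf_ftwo_assoc = symmetric_monoidal_functor.ftwo_assoc [of A B]
  and smf_ftwo_runit = symmetric_monoidal_functor.ftwo_runit [of A B]
  and smf_ftwo_lunit = symmetric_monoidal_functor.ftwo_lunit [of A B]
  and smf_ftwo_symm = symmetric_monoidal_functor.ftwo_symm [of A B]
  and mnt_unit = monoidal_transformation.ncmp_unit [of A B]
  and mnt_tens = monoidal_transformation.ncmp_tens [of A B]

lemma smf_unit_smf [simp]: "smf (smf_unit A B)"
proof (rule smfI)
  fix x y z assume [simp]: "x \<in> Obj A" "y \<in> Obj A" "z \<in> Obj A"
  show "ftwo (smf_unit A B) (x \<otimes>\<^bsub>A\<^esub> y) z
        \<cdot>\<^bsub>B\<^esub> (ftwo (smf_unit A B) x y \<boxtimes>\<^bsub>B\<^esub> Idt B (fob (smf_unit A B) z))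
        \<cdot>\<^bsub>B\<^esub> Assoc B (fob (smf_unit A B) x) (fob (smf_unit A B) y) (fob (smf_unit A B) z)
      = far (smf_unit A B) (Assoc A x y z) \<cdot>\<^bsub>B\<^esub> ftwo (smf_unit A B) x (y \<otimes>\<^bsub>A\<^esub> z)
        \<cdot>\<^bsub>B\<^esub> (Idt B (fob (smf_unit A B) x) \<boxtimes>\<^bsub>B\<^esub> ftwo (smf_unit A B) y z)"
    by (simp add: B.triangle B.unit_coh)
qed (auto simp: smf_unit_def B.unit_coh)

text \<open>In each axiom the naturality of the interchange collects the structure arrows of \<open>F\<close> on one side of the
tensor and those of \<open>G\<close> on the other; what remains is the axiom for \<open>F\<close> and for \<open>G\<close> and the
corresponding compatibility of the interchange.\<close>

lemma smf_tens_smf [simp]: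
  assumes [simp]: "smf F" "smf G"
  shows "smf (smf_tens A B F G)"
proof (rule smfI)
  let ?T = "smf_tens A B F G" and ?m = "interchange B"
  show "fob ?T \<in> extensional (Obj A)" "far ?T \<in> extensional (Arr A)" "ftwo ?T \<in> extensional (Obj A)"
    by (simp_all add: smf_tens_def)
  show "ftwo ?T x \<in> extensional (Obj A)" if "x \<in> Obj A" for x
    using that by (simp add: smf_tens_def)
  show "far ?T (g \<cdot>\<^bsub>A\<^esub> f) = far ?T g \<cdot>\<^bsub>B\<^esub> far ?T f" if "f \<in> Arr A" "g \<in> Arr A" "Dom A g = Cod A f" for f g
    using that by (simp add: far_comp_arr B.tens_comp_arr)
  show "ftwo ?T (Cod A f) (Cod A g) \<cdot>\<^bsub>B\<^esub> (far ?T f \<boxtimes>\<^bsub>B\<^esub> far ?T g)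
    = far ?T (f \<boxtimes>\<^bsub>A\<^esub> g) \<cdot>\<^bsub>B\<^esub> ftwo ?T (Dom A f) (Dom A g)" if "f \<in> Arr A" "g \<in> Arr A" for f g
    using that by (simp add: B.interchange_past B.tens_merge ftwo_nat_arr)
  show "far ?T (RUnit A x) \<cdot>\<^bsub>B\<^esub> ftwo ?T x (Unit A) \<cdot>\<^bsub>B\<^esub> (Idt B (fob ?T x) \<boxtimes>\<^bsub>B\<^esub> fzero ?T) = RUnit B (fob ?T x)"
    if [simp]: "x \<in> Obj A" for x
    by (simp add: B.tens_idt_split B.interchange_past_right)
      (simp add: B.tens_merge smf_ftwo_runit B.interchange_runit)
  show "far ?T (LUnit A x) \<cdot>\<^bsub>B\<^esub> ftwo ?T (Unit A) x \<cdot>\<^bsub>B\<^esub> (fzero ?T \<boxtimes>\<^bsub>B\<^esub> Idt B (fob ?T x)) = LUnit B (fob ?T x)"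
    if [simp]: "x \<in> Obj A" for x
    by (simp add: B.tens_idt_split B.interchange_past_left)
      (simp add: B.tens_merge smf_ftwo_lunit B.interchange_lunit)
  show "ftwo ?T y x \<cdot>\<^bsub>B\<^esub> Symm B (fob ?T x) (fob ?T y) = far ?T (Symm A x y) \<cdot>\<^bsub>B\<^esub> ftwo ?T x y"
    if [simp]: "x \<in> Obj A" "y \<in> Obj A" for x y
    by (simp add: B.interchange_symm B.tens_merge smf_ftwo_symm)
  show "ftwo ?T (x \<otimes>\<^bsub>A\<^esub> y) z \<cdot>\<^bsub>B\<^esub> (ftwo ?T x y \<boxtimes>\<^bsub>B\<^esub> Idt B (fob ?T z)) \<cdot>\<^bsub>B\<^esub> Assoc B (fob ?T x) (fob ?T y) (fob ?T z)
    = far ?T (Assoc A x y z) \<cdot>\<^bsub>B\<^esub> ftwo ?T x (y \<otimes>\<^bsub>A\<^esub> z) \<cdot>\<^bsub>B\<^esub> (Idt B (fob ?T x) \<boxtimes>\<^bsub>B\<^esub> ftwo ?T y z)"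
    if [simp]: "x \<in> Obj A" "y \<in> Obj A" "z \<in> Obj A" for x y z
    by (simp add: B.tens_idt_split B.interchange_past_left B.interchange_past_right flip: B.interchange_assoc)
      (simp add: B.tens_merge smf_ftwo_assoc)
qed auto

lemma idt_mnt [simp]: "smf F \<Longrightarrow> mnt (Idt (A \<Rrightarrow> B) F)"
  by (rule mntI) simp_all

lemma comp_mnt [simp]:
  assumes [simp]: "mnt \<sigma>" "mnt \<tau>" and eq: "nsrc \<tau> = ntrg \<sigma>"
  shows "mnt (\<tau> \<cdot>\<^bsub>A \<Rrightarrow> B\<^esub> \<sigma>)"
proof (rule mntI)
  show "ncmp (\<tau> \<cdot>\<^bsub>A \<Rrightarrow> B\<^esub> \<sigma>) (Cod A f) \<cdot>\<^bsub>B\<^esub> far (nsrc (\<tau> \<cdot>\<^bsub>A \<Rrightarrow> B\<^esub> \<sigma>)) f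
    = far (ntrg (\<tau> \<cdot>\<^bsub>A \<Rrightarrow> B\<^esub> \<sigma>)) f \<cdot>\<^bsub>B\<^esub> ncmp (\<tau> \<cdot>\<^bsub>A \<Rrightarrow> B\<^esub> \<sigma>) (Dom A f)" if [simp]: "f \<in> Arr A" for f
    using ncmp_nat_arr [of \<sigma> f] B.comp_extend2 [OF ncmp_nat_arr [of \<tau> f], of "ncmp \<sigma> (Dom A f)"]
    by (simp add: eq)
  show "ncmp (\<tau> \<cdot>\<^bsub>A \<Rrightarrow> B\<^esub> \<sigma>) (Unit A) \<cdot>\<^bsub>B\<^esub> fzero (nsrc (\<tau> \<cdot>\<^bsub>A \<Rrightarrow> B\<^esub> \<sigma>)) = fzero (ntrg (\<tau> \<cdot>\<^bsub>A \<Rrightarrow> B\<^esub> \<sigma>))"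
    using mnt_unit [of \<sigma>] mnt_unit [of \<tau>] by (simp add: eq)
  show "ncmp (\<tau> \<cdot>\<^bsub>A \<Rrightarrow> B\<^esub> \<sigma>) (x \<otimes>\<^bsub>A\<^esub> y) \<cdot>\<^bsub>B\<^esub> ftwo (nsrc (\<tau> \<cdot>\<^bsub>A \<Rrightarrow> B\<^esub> \<sigma>)) x y
    = ftwo (ntrg (\<tau> \<cdot>\<^bsub>A \<Rrightarrow> B\<^esub> \<sigma>)) x y
      \<cdot>\<^bsub>B\<^esub> (ncmp (\<tau> \<cdot>\<^bsub>A \<Rrightarrow> B\<^esub> \<sigma>) x \<boxtimes>\<^bsub>B\<^esub> ncmp (\<tau> \<cdot>\<^bsub>A \<Rrightarrow> B\<^esub> \<sigma>) y)"
    if [simp]: "x \<in> Obj A" "y \<in> Obj A" for x y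
    using mnt_tens [of \<sigma> x y]
      B.comp_extend2 [OF mnt_tens [of \<tau> x y], of "ncmp \<sigma> x \<boxtimes>\<^bsub>B\<^esub> ncmp \<sigma> y"]
    by (simp add: eq B.tens_merge)
qed (simp_all add: eq)

lemma tens_mnt [simp]:
  assumes [simp]: "mnt \<sigma>" "mnt \<tau>"
  shows "mnt (\<sigma> \<boxtimes>\<^bsub>A \<Rrightarrow> B\<^esub> \<tau>)"
proof (rule mntI)
  let ?t = "\<sigma> \<boxtimes>\<^bsub>A \<Rrightarrow> B\<^esub> \<tau>"
  show "ncmp ?t (Cod A f) \<cdot>\<^bsub>B\<^esub> far (nsrc ?t) f = far (ntrg ?t) f \<cdot>\<^bsub>B\<^esub> ncmp ?t (Dom A f)"
    if [simp]: "f \<in> Arr A" for f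
    by (simp add: B.tens_merge ncmp_nat_arr)
  show "ncmp ?t (Unit A) \<cdot>\<^bsub>B\<^esub> fzero (nsrc ?t) = fzero (ntrg ?t)"
    by (simp add: B.tens_merge mnt_unit)
  show "ncmp ?t (x \<otimes>\<^bsub>A\<^esub> y) \<cdot>\<^bsub>B\<^esub> ftwo (nsrc ?t) x y = ftwo (ntrg ?t) x y \<cdot>\<^bsub>B\<^esub> (ncmp ?t x \<boxtimes>\<^bsub>B\<^esub> ncmp ?t y)"
    if [simp]: "x \<in> Obj A" "y \<in> Obj A" for x y
    by (simp add: B.tens_merge B.interchange_past mnt_tens)
qed simp_all

lemma assoc_mnt [simp]:
  assumes [simp]: "smf F" "smf G" "smf H"
  shows "mnt (Assoc (A \<Rrightarrow> B) F G H)"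
proof (rule mntI)
  let ?t = "Assoc (A \<Rrightarrow> B) F G H"
  show "ncmp ?t (Cod A f) \<cdot>\<^bsub>B\<^esub> far (nsrc ?t) f = far (ntrg ?t) f \<cdot>\<^bsub>B\<^esub> ncmp ?t (Dom A f)"
    if [simp]: "f \<in> Arr A" for f
    using B.assoc_nat_arr [of "far F f" "far G f" "far H f"] by simp
  show "ncmp ?t (Unit A) \<cdot>\<^bsub>B\<^esub> fzero (nsrc ?t) = fzero (ntrg ?t)"
  proof -
    let ?I = "Unit B" let ?i = "Idt B ?I" and ?r = "inv_arr B (RUnit B ?I)"
    let ?A = "Assoc B (fob F (Unit A)) (fob G (Unit A)) (fob H (Unit A))"
    have "?A \<cdot>\<^bsub>B\<^esub> (fzero F \<boxtimes>\<^bsub>B\<^esub> ((fzero G \<boxtimes>\<^bsub>B\<^esub> fzero H) \<cdot>\<^bsub>B\<^esub> ?r)) \<cdot>\<^bsub>B\<^esub> ?r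
      = (?A \<cdot>\<^bsub>B\<^esub> (fzero F \<boxtimes>\<^bsub>B\<^esub> (fzero G \<boxtimes>\<^bsub>B\<^esub> fzero H))) \<cdot>\<^bsub>B\<^esub> (?i \<boxtimes>\<^bsub>B\<^esub> ?r) \<cdot>\<^bsub>B\<^esub> ?r"
      by (simp add: B.tens_merge)
    also have "?A \<cdot>\<^bsub>B\<^esub> (fzero F \<boxtimes>\<^bsub>B\<^esub> (fzero G \<boxtimes>\<^bsub>B\<^esub> fzero H))
      = ((fzero F \<boxtimes>\<^bsub>B\<^esub> fzero G) \<boxtimes>\<^bsub>B\<^esub> fzero H) \<cdot>\<^bsub>B\<^esub> Assoc B ?I ?I ?I"
      using B.assoc_nat_arr [of "fzero F" "fzero G" "fzero H"] by simp
    also have "(\<dots>) \<cdot>\<^bsub>B\<^esub> (?i \<boxtimes>\<^bsub>B\<^esub> ?r) \<cdot>\<^bsub>B\<^esub> ?r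
      = ((fzero F \<boxtimes>\<^bsub>B\<^esub> fzero G) \<boxtimes>\<^bsub>B\<^esub> fzero H) \<cdot>\<^bsub>B\<^esub> (Assoc B ?I ?I ?I \<cdot>\<^bsub>B\<^esub> (?i \<boxtimes>\<^bsub>B\<^esub> ?r)) \<cdot>\<^bsub>B\<^esub> ?r"
      by simp
    also have "\<dots> = (((fzero F \<boxtimes>\<^bsub>B\<^esub> fzero G) \<cdot>\<^bsub>B\<^esub> ?r) \<boxtimes>\<^bsub>B\<^esub> fzero H) \<cdot>\<^bsub>B\<^esub> ?r"
      by (simp only: B.assoc_inv_runit) (simp add: B.tens_merge)
    finally show ?thesis
      by simp
  qed
  show "ncmp ?t (x \<otimes>\<^bsub>A\<^esub> y) \<cdot>\<^bsub>B\<^esub> ftwo (nsrc ?t) x y = ftwo (ntrg ?t) x y \<cdot>\<^bsub>B\<^esub> (ncmp ?t x \<boxtimes>\<^bsub>B\<^esub> ncmp ?t y)"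
    if [simp]: "x \<in> Obj A" "y \<in> Obj A" for x y
  proof -
    let ?m = "interchange B"
    let ?F = "ftwo F x y" and ?G = "ftwo G x y" and ?H = "ftwo H x y"
    let ?A = "Assoc B (fob F (x \<otimes>\<^bsub>A\<^esub> y)) (fob G (x \<otimes>\<^bsub>A\<^esub> y)) (fob H (x \<otimes>\<^bsub>A\<^esub> y))"
    let ?A' = "Assoc B (fob F x \<otimes>\<^bsub>B\<^esub> fob F y) (fob G x \<otimes>\<^bsub>B\<^esub> fob G y) (fob H x \<otimes>\<^bsub>B\<^esub> fob H y)"
    let ?m1 = "Idt B (fob F x \<otimes>\<^bsub>B\<^esub> fob F y) \<boxtimes>\<^bsub>B\<^esub> ?m (fob G x) (fob H x) (fob G y) (fob H y)"
    let ?m2 = "?m (fob F x) (fob G x \<otimes>\<^bsub>B\<^esub> fob H x) (fob F y) (fob G y \<otimes>\<^bsub>B\<^esub> fob H y)"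
    have "ncmp ?t (x \<otimes>\<^bsub>A\<^esub> y) \<cdot>\<^bsub>B\<^esub> ftwo (nsrc ?t) x y = (?A \<cdot>\<^bsub>B\<^esub> (?F \<boxtimes>\<^bsub>B\<^esub> (?G \<boxtimes>\<^bsub>B\<^esub> ?H))) \<cdot>\<^bsub>B\<^esub> ?m1 \<cdot>\<^bsub>B\<^esub> ?m2"
      by (simp add: B.tens_merge)
    also have "?A \<cdot>\<^bsub>B\<^esub> (?F \<boxtimes>\<^bsub>B\<^esub> (?G \<boxtimes>\<^bsub>B\<^esub> ?H)) = ((?F \<boxtimes>\<^bsub>B\<^esub> ?G) \<boxtimes>\<^bsub>B\<^esub> ?H) \<cdot>\<^bsub>B\<^esub> ?A'"
      using B.assoc_nat_arr [of ?F ?G ?H] by simp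
    also have "(\<dots>) \<cdot>\<^bsub>B\<^esub> ?m1 \<cdot>\<^bsub>B\<^esub> ?m2 = ((?F \<boxtimes>\<^bsub>B\<^esub> ?G) \<boxtimes>\<^bsub>B\<^esub> ?H) \<cdot>\<^bsub>B\<^esub> (?A' \<cdot>\<^bsub>B\<^esub> ?m1 \<cdot>\<^bsub>B\<^esub> ?m2)"
      by simp
    also have "\<dots> = ftwo (ntrg ?t) x y \<cdot>\<^bsub>B\<^esub> (ncmp ?t x \<boxtimes>\<^bsub>B\<^esub> ncmp ?t y)"
      by (subst B.interchange_assoc_dual) (simp_all add: B.tens_merge)
    finally show ?thesis .
  qed
qed simp_all

lemma runit_mnt [simp]:
  assumes [simp]: "smf F"
  shows "mnt (RUnit (A \<Rrightarrow> B) F)"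
proof (rule mntI)
  let ?t = "RUnit (A \<Rrightarrow> B) F"
  show "ncmp ?t (Cod A f) \<cdot>\<^bsub>B\<^esub> far (nsrc ?t) f = far (ntrg ?t) f \<cdot>\<^bsub>B\<^esub> ncmp ?t (Dom A f)"
    if [simp]: "f \<in> Arr A" for f
    using B.runit_nat_arr [of "far F f"] by simp
  show "ncmp ?t (Unit A) \<cdot>\<^bsub>B\<^esub> fzero (nsrc ?t) = fzero (ntrg ?t)"
    using B.comp_extend2 [OF B.runit_nat_arr [of "fzero F"], of "inv_arr B (RUnit B (Unit B))"] by simp
  show "ncmp ?t (x \<otimes>\<^bsub>A\<^esub> y) \<cdot>\<^bsub>B\<^esub> ftwo (nsrc ?t) x y = ftwo (ntrg ?t) x y \<cdot>\<^bsub>B\<^esub> (ncmp ?t x \<boxtimes>\<^bsub>B\<^esub> ncmp ?t y)"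
    if [simp]: "x \<in> Obj A" "y \<in> Obj A" for x y
  proof -
    let ?F = "ftwo F x y" and ?i = "Idt B (Unit B)" and ?m = "interchange B (fob F x) (Unit B) (fob F y) (Unit B)"
    let ?a = "fob F x \<otimes>\<^bsub>B\<^esub> fob F y"
    have "ncmp ?t (x \<otimes>\<^bsub>A\<^esub> y) \<cdot>\<^bsub>B\<^esub> ftwo (nsrc ?t) x y
      = (RUnit B (fob F (x \<otimes>\<^bsub>A\<^esub> y)) \<cdot>\<^bsub>B\<^esub> (?F \<boxtimes>\<^bsub>B\<^esub> ?i)) \<cdot>\<^bsub>B\<^esub> (Idt B ?a \<boxtimes>\<^bsub>B\<^esub> RUnit B (Unit B)) \<cdot>\<^bsub>B\<^esub> ?m"
      by (simp add: B.tens_merge)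
    also have "RUnit B (fob F (x \<otimes>\<^bsub>A\<^esub> y)) \<cdot>\<^bsub>B\<^esub> (?F \<boxtimes>\<^bsub>B\<^esub> ?i) = ?F \<cdot>\<^bsub>B\<^esub> RUnit B ?a"
      using B.runit_nat_arr [of ?F] by simp
    also have "(?F \<cdot>\<^bsub>B\<^esub> RUnit B ?a) \<cdot>\<^bsub>B\<^esub> (Idt B ?a \<boxtimes>\<^bsub>B\<^esub> RUnit B (Unit B)) \<cdot>\<^bsub>B\<^esub> ?m
      = ?F \<cdot>\<^bsub>B\<^esub> (RUnit B (fob F x) \<boxtimes>\<^bsub>B\<^esub> RUnit B (fob F y))"
      by (simp add: B.interchange_runit_dual)
    finally show ?thesis
      by simp
  qed
qed simp_all

lemma lunit_mnt [simp]:
  assumes [simp]: "smf F"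
  shows "mnt (LUnit (A \<Rrightarrow> B) F)"
proof (rule mntI)
  let ?t = "LUnit (A \<Rrightarrow> B) F"
  show "ncmp ?t (Cod A f) \<cdot>\<^bsub>B\<^esub> far (nsrc ?t) f = far (ntrg ?t) f \<cdot>\<^bsub>B\<^esub> ncmp ?t (Dom A f)"
    if [simp]: "f \<in> Arr A" for f
    using B.lunit_nat_arr [of "far F f"] by simp
  show "ncmp ?t (Unit A) \<cdot>\<^bsub>B\<^esub> fzero (nsrc ?t) = fzero (ntrg ?t)"
    using B.comp_extend2 [OF B.lunit_nat_arr [of "fzero F"], of "inv_arr B (RUnit B (Unit B))"]
    by (simp add: B.unit_coh)
  show "ncmp ?t (x \<otimes>\<^bsub>A\<^esub> y) \<cdot>\<^bsub>B\<^esub> ftwo (nsrc ?t) x y = ftwo (ntrg ?t) x y \<cdot>\<^bsub>B\<^esub> (ncmp ?t x \<boxtimes>\<^bsub>B\<^esub> ncmp ?t y)"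
    if [simp]: "x \<in> Obj A" "y \<in> Obj A" for x y
  proof -
    let ?F = "ftwo F x y" and ?i = "Idt B (Unit B)" and ?m = "interchange B (Unit B) (fob F x) (Unit B) (fob F y)"
    let ?a = "fob F x \<otimes>\<^bsub>B\<^esub> fob F y"
    have "ncmp ?t (x \<otimes>\<^bsub>A\<^esub> y) \<cdot>\<^bsub>B\<^esub> ftwo (nsrc ?t) x y
      = (LUnit B (fob F (x \<otimes>\<^bsub>A\<^esub> y)) \<cdot>\<^bsub>B\<^esub> (?i \<boxtimes>\<^bsub>B\<^esub> ?F)) \<cdot>\<^bsub>B\<^esub> (RUnit B (Unit B) \<boxtimes>\<^bsub>B\<^esub> Idt B ?a) \<cdot>\<^bsub>B\<^esub> ?m"
      by (simp add: B.tens_merge)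
    also have "LUnit B (fob F (x \<otimes>\<^bsub>A\<^esub> y)) \<cdot>\<^bsub>B\<^esub> (?i \<boxtimes>\<^bsub>B\<^esub> ?F) = ?F \<cdot>\<^bsub>B\<^esub> LUnit B ?a"
      using B.lunit_nat_arr [of ?F] by simp
    also have "(?F \<cdot>\<^bsub>B\<^esub> LUnit B ?a) \<cdot>\<^bsub>B\<^esub> (RUnit B (Unit B) \<boxtimes>\<^bsub>B\<^esub> Idt B ?a) \<cdot>\<^bsub>B\<^esub> ?m
      = ?F \<cdot>\<^bsub>B\<^esub> (LUnit B (fob F x) \<boxtimes>\<^bsub>B\<^esub> LUnit B (fob F y))"
      by (simp add: B.interchange_lunit_dual)
    finally show ?thesis
      by simp
  qed
qed simp_all

lemma symm_mnt [simp]: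
  assumes [simp]: "smf F" "smf G"
  shows "mnt (Symm (A \<Rrightarrow> B) F G)"
proof (rule mntI)
  let ?t = "Symm (A \<Rrightarrow> B) F G"
  show "ncmp ?t (Cod A f) \<cdot>\<^bsub>B\<^esub> far (nsrc ?t) f = far (ntrg ?t) f \<cdot>\<^bsub>B\<^esub> ncmp ?t (Dom A f)"
    if [simp]: "f \<in> Arr A" for f
    using B.symm_nat_arr [of "far F f" "far G f"] by simp
  show "ncmp ?t (Unit A) \<cdot>\<^bsub>B\<^esub> fzero (nsrc ?t) = fzero (ntrg ?t)"
    using B.comp_extend2 [OF B.symm_nat_arr [of "fzero F" "fzero G"], of "inv_arr B (RUnit B (Unit B))"]
    by simp
  show "ncmp ?t (x \<otimes>\<^bsub>A\<^esub> y) \<cdot>\<^bsub>B\<^esub> ftwo (nsrc ?t) x y = ftwo (ntrg ?t) x y \<cdot>\<^bsub>B\<^esub> (ncmp ?t x \<boxtimes>\<^bsub>B\<^esub> ncmp ?t y)"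
    if [simp]: "x \<in> Obj A" "y \<in> Obj A" for x y
    using B.comp_extend2 [OF B.symm_nat_arr [of "ftwo F x y" "ftwo G x y"],
        of "interchange B (fob F x) (fob G x) (fob F y) (fob G y)"]
    by (simp add: B.interchange_symm_dual)
qed simp_all

text \<open>Pointwise inverses of a monoidal transformation are again natural and monoidal.\<close>

lemma ihom_isoI:
  assumes [simp]: "mnt \<theta>" and iso: "\<And>a. a \<in> Obj A \<Longrightarrow> iso_arr B (ncmp \<theta> a)"
  shows "iso_arr (A \<Rrightarrow> B) \<theta>"
proof -
  define \<psi> where "\<psi> = \<lparr> nsrc = ntrg \<theta>, ntrg = nsrc \<theta>, ncmp = (\<lambda>a \<in> Obj A. inv_arr B (ncmp \<theta> a)) \<rparr>"
  have \<psi> [simp]: "nsrc \<psi> = ntrg \<theta>" "ntrg \<psi> = nsrc \<theta>" "ncmp \<psi> \<in> extensional (Obj A)"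
    "\<And>a. a \<in> Obj A \<Longrightarrow> ncmp \<psi> a = inv_arr B (ncmp \<theta> a)"
    by (simp_all add: \<psi>_def)
  note [simp] = iso
  have "mnt \<psi>"
  proof (rule mntI)
    fix f assume [simp]: "f \<in> Arr A"
    have "B.square (far (nsrc \<theta>) f) (ncmp \<theta> (Dom A f)) (ncmp \<theta> (Cod A f)) (far (ntrg \<theta>) f)"
      by (simp add: B.square_def ncmp_nat_arr)
    from B.square_inv [OF this]
    show "ncmp \<psi> (Cod A f) \<cdot>\<^bsub>B\<^esub> far (nsrc \<psi>) f = far (ntrg \<psi>) f \<cdot>\<^bsub>B\<^esub> ncmp \<psi> (Dom A f)"
      by (simp add: B.square_def)
  next
    show "ncmp \<psi> (Unit A) \<cdot>\<^bsub>B\<^esub> fzero (nsrc \<psi>) = fzero (ntrg \<psi>)"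
      by (simp flip: mnt_unit [of \<theta>])
  next
    fix x y assume [simp]: "x \<in> Obj A" "y \<in> Obj A"
    have "inv_arr B (ncmp \<theta> (x \<otimes>\<^bsub>A\<^esub> y)) \<cdot>\<^bsub>B\<^esub> ftwo (ntrg \<theta>) x y
      = inv_arr B (ncmp \<theta> (x \<otimes>\<^bsub>A\<^esub> y)) \<cdot>\<^bsub>B\<^esub> (ftwo (ntrg \<theta>) x y \<cdot>\<^bsub>B\<^esub> (ncmp \<theta> x \<boxtimes>\<^bsub>B\<^esub> ncmp \<theta> y))
          \<cdot>\<^bsub>B\<^esub> (inv_arr B (ncmp \<theta> x) \<boxtimes>\<^bsub>B\<^esub> inv_arr B (ncmp \<theta> y))"
      by (simp add: B.tens_merge)
    also have "\<dots> = ftwo (nsrc \<theta>) x y \<cdot>\<^bsub>B\<^esub> (inv_arr B (ncmp \<theta> x) \<boxtimes>\<^bsub>B\<^esub> inv_arr B (ncmp \<theta> y))"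
      by (simp flip: mnt_tens [of \<theta> x y])
    finally show "ncmp \<psi> (x \<otimes>\<^bsub>A\<^esub> y) \<cdot>\<^bsub>B\<^esub> ftwo (nsrc \<psi>) x y = ftwo (ntrg \<psi>) x y \<cdot>\<^bsub>B\<^esub> (ncmp \<psi> x \<boxtimes>\<^bsub>B\<^esub> ncmp \<psi> y)"
      by simp
  qed simp_all
  then have "inverse_of (A \<Rrightarrow> B) \<theta> \<psi>"
    by (auto simp: inverse_of_def Hom_def intro!: mnt_ext [where A = A])
  then show ?thesis
    by (auto simp: iso_arr_def)
qed

text \<open>The equations hold because they hold at each object of \<open>A\<close>. That the arrows occurring in them are
monoidal transformations has been shown above.\<close>

theorem ihom_smc: "symmetric_monoidal_category (A \<Rrightarrow> B)"
proof (rule symmetric_monoidal_category.intro)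
  show "category (A \<Rrightarrow> B)"
    by (rule category.intro) (auto simp: Hom_def intro!: mnt_ext [where A = A])
  show "symmetric_monoidal_category_axioms (A \<Rrightarrow> B)"
  proof (rule symmetric_monoidal_category_axioms.intro)
    fix F G H assume "F \<in> Obj (A \<Rrightarrow> B)" "G \<in> Obj (A \<Rrightarrow> B)" "H \<in> Obj (A \<Rrightarrow> B)"
    then have [simp]: "smf F" "smf G" "smf H" by simp_all
    show "iso_arr (A \<Rrightarrow> B) (Assoc (A \<Rrightarrow> B) F G H)"
      "iso_arr (A \<Rrightarrow> B) (RUnit (A \<Rrightarrow> B) F)" "iso_arr (A \<Rrightarrow> B) (LUnit (A \<Rrightarrow> B) F)"
      by (rule ihom_isoI; simp)+
    fix K assume "K \<in> Obj (A \<Rrightarrow> B)"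
    then have [simp]: "smf K" by simp
    show "Assoc (A \<Rrightarrow> B) (F \<otimes>\<^bsub>A \<Rrightarrow> B\<^esub> G) H K \<cdot>\<^bsub>A \<Rrightarrow> B\<^esub> Assoc (A \<Rrightarrow> B) F G (H \<otimes>\<^bsub>A \<Rrightarrow> B\<^esub> K)
      = (Assoc (A \<Rrightarrow> B) F G H \<boxtimes>\<^bsub>A \<Rrightarrow> B\<^esub> Idt (A \<Rrightarrow> B) K) \<cdot>\<^bsub>A \<Rrightarrow> B\<^esub> Assoc (A \<Rrightarrow> B) F (G \<otimes>\<^bsub>A \<Rrightarrow> B\<^esub> H) K
        \<cdot>\<^bsub>A \<Rrightarrow> B\<^esub> (Idt (A \<Rrightarrow> B) F \<boxtimes>\<^bsub>A \<Rrightarrow> B\<^esub> Assoc (A \<Rrightarrow> B) G H K)"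
      by (rule mnt_ext [where A = A]) (simp_all add: B.pentagon)
    show "Assoc (A \<Rrightarrow> B) H F G \<cdot>\<^bsub>A \<Rrightarrow> B\<^esub> Symm (A \<Rrightarrow> B) (F \<otimes>\<^bsub>A \<Rrightarrow> B\<^esub> G) H \<cdot>\<^bsub>A \<Rrightarrow> B\<^esub> Assoc (A \<Rrightarrow> B) F G H
        = (Symm (A \<Rrightarrow> B) F H \<boxtimes>\<^bsub>A \<Rrightarrow> B\<^esub> Idt (A \<Rrightarrow> B) G) \<cdot>\<^bsub>A \<Rrightarrow> B\<^esub> Assoc (A \<Rrightarrow> B) F H G
          \<cdot>\<^bsub>A \<Rrightarrow> B\<^esub> (Idt (A \<Rrightarrow> B) F \<boxtimes>\<^bsub>A \<Rrightarrow> B\<^esub> Symm (A \<Rrightarrow> B) G H)"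
      by (rule mnt_ext [where A = A]) (simp_all add: B.hexagon)
  next
    fix f a a' g b b' h c c'
    assume "f \<in> Hom (A \<Rrightarrow> B) a a'" "g \<in> Hom (A \<Rrightarrow> B) b b'" "h \<in> Hom (A \<Rrightarrow> B) c c'"
    then have [simp]: "mnt f" "mnt g" "mnt h" and [symmetric, simp]: "nsrc f = a" "ntrg f = a'"
      "nsrc g = b" "ntrg g = b'" "nsrc h = c" "ntrg h = c'"
      by (auto simp: Hom_def)
    show "Assoc (A \<Rrightarrow> B) a' b' c' \<cdot>\<^bsub>A \<Rrightarrow> B\<^esub> (f \<boxtimes>\<^bsub>A \<Rrightarrow> B\<^esub> (g \<boxtimes>\<^bsub>A \<Rrightarrow> B\<^esub> h))
      = ((f \<boxtimes>\<^bsub>A \<Rrightarrow> B\<^esub> g) \<boxtimes>\<^bsub>A \<Rrightarrow> B\<^esub> h) \<cdot>\<^bsub>A \<Rrightarrow> B\<^esub> Assoc (A \<Rrightarrow> B) a b c"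
    proof (rule mnt_ext [where A = A])
      fix x assume [simp]: "x \<in> Obj A"
      show "ncmp (Assoc (A \<Rrightarrow> B) a' b' c' \<cdot>\<^bsub>A \<Rrightarrow> B\<^esub> (f \<boxtimes>\<^bsub>A \<Rrightarrow> B\<^esub> (g \<boxtimes>\<^bsub>A \<Rrightarrow> B\<^esub> h))) x
        = ncmp (((f \<boxtimes>\<^bsub>A \<Rrightarrow> B\<^esub> g) \<boxtimes>\<^bsub>A \<Rrightarrow> B\<^esub> h) \<cdot>\<^bsub>A \<Rrightarrow> B\<^esub> Assoc (A \<Rrightarrow> B) a b c) x"
        using B.assoc_nat_arr [of "ncmp f x" "ncmp g x" "ncmp h x"] by simp
    qed simp_all
    show "Symm (A \<Rrightarrow> B) a' b' \<cdot>\<^bsub>A \<Rrightarrow> B\<^esub> (f \<boxtimes>\<^bsub>A \<Rrightarrow> B\<^esub> g) = (g \<boxtimes>\<^bsub>A \<Rrightarrow> B\<^esub> f) \<cdot>\<^bsub>A \<Rrightarrow> B\<^esub> Symm (A \<Rrightarrow> B) a b"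
    proof (rule mnt_ext [where A = A])
      fix x assume [simp]: "x \<in> Obj A"
      show "ncmp (Symm (A \<Rrightarrow> B) a' b' \<cdot>\<^bsub>A \<Rrightarrow> B\<^esub> (f \<boxtimes>\<^bsub>A \<Rrightarrow> B\<^esub> g)) x
        = ncmp ((g \<boxtimes>\<^bsub>A \<Rrightarrow> B\<^esub> f) \<cdot>\<^bsub>A \<Rrightarrow> B\<^esub> Symm (A \<Rrightarrow> B) a b) x"
        using B.symm_nat_arr [of "ncmp f x" "ncmp g x"] by simp
    qed simp_all
  next
    fix f a b assume "f \<in> Hom (A \<Rrightarrow> B) a b"
    then have [simp]: "mnt f" and [symmetric, simp]: "nsrc f = a" "ntrg f = b"
      by (auto simp: Hom_def)
    show "RUnit (A \<Rrightarrow> B) b \<cdot>\<^bsub>A \<Rrightarrow> B\<^esub> (f \<boxtimes>\<^bsub>A \<Rrightarrow> B\<^esub> Idt (A \<Rrightarrow> B) (Unit (A \<Rrightarrow> B)))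
      = f \<cdot>\<^bsub>A \<Rrightarrow> B\<^esub> RUnit (A \<Rrightarrow> B) a"
    proof (rule mnt_ext [where A = A])
      fix x assume [simp]: "x \<in> Obj A"
      show "ncmp (RUnit (A \<Rrightarrow> B) b \<cdot>\<^bsub>A \<Rrightarrow> B\<^esub> (f \<boxtimes>\<^bsub>A \<Rrightarrow> B\<^esub> Idt (A \<Rrightarrow> B) (Unit (A \<Rrightarrow> B)))) x
        = ncmp (f \<cdot>\<^bsub>A \<Rrightarrow> B\<^esub> RUnit (A \<Rrightarrow> B) a) x"
        using B.runit_nat_arr [of "ncmp f x"] by simp
    qed simp_all
    show "LUnit (A \<Rrightarrow> B) b \<cdot>\<^bsub>A \<Rrightarrow> B\<^esub> (Idt (A \<Rrightarrow> B) (Unit (A \<Rrightarrow> B)) \<boxtimes>\<^bsub>A \<Rrightarrow> B\<^esub> f)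
      = f \<cdot>\<^bsub>A \<Rrightarrow> B\<^esub> LUnit (A \<Rrightarrow> B) a"
    proof (rule mnt_ext [where A = A])
      fix x assume [simp]: "x \<in> Obj A"
      show "ncmp (LUnit (A \<Rrightarrow> B) b \<cdot>\<^bsub>A \<Rrightarrow> B\<^esub> (Idt (A \<Rrightarrow> B) (Unit (A \<Rrightarrow> B)) \<boxtimes>\<^bsub>A \<Rrightarrow> B\<^esub> f)) x
        = ncmp (f \<cdot>\<^bsub>A \<Rrightarrow> B\<^esub> LUnit (A \<Rrightarrow> B) a) x"
        using B.lunit_nat_arr [of "ncmp f x"] by simp
    qed simp_all
  qed (auto simp: Hom_def B.tens_comp_arr B.triangle B.unit_coh B.symm_unit intro!: mnt_ext [where A = A])
qed

end

section \<open>Composition of functors and whiskering\<close>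

context smc_pair begin

lemma far_iso:
  assumes [simp]: "smf F" and iso: "iso_arr A f"
  shows "iso_arr B (far F f)" "far F (inv_arr A f) = inv_arr B (far F f)"
proof -
  have [simp]: "f \<in> Arr A" by (rule A.iso_arr_arr [OF iso])
  have "far F (inv_arr A f) \<cdot>\<^bsub>B\<^esub> far F f = Idt B (fob F (Dom A f))"
    "far F f \<cdot>\<^bsub>B\<^esub> far F (inv_arr A f) = Idt B (fob F (Cod A f))"
    using iso by (simp_all flip: far_comp_arr)
  then show "iso_arr B (far F f)" "far F (inv_arr A f) = inv_arr B (far F f)"
    using iso by (auto intro!: B.iso_arrI [where g = "far F (inv_arr A f)"] B.inv_arr_eqI' [symmetric])
qed

lemma ftwo_square:
  "\<lbrakk>smf F; f \<in> Arr A; g \<in> Arr A; x = Dom A f; y = Dom A g; x' = Cod A f; y' = Cod A g\<rbrakk> \<Longrightarrow>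
    B.square (ftwo F x y) (far F f \<boxtimes>\<^bsub>B\<^esub> far F g) (far F (f \<boxtimes>\<^bsub>A\<^esub> g)) (ftwo F x' y')"
  by (simp add: B.square_def ftwo_nat_arr)

lemma ftwo_assoc_square:
  "\<lbrakk>smf F; x \<in> Obj A; y \<in> Obj A; z \<in> Obj A\<rbrakk> \<Longrightarrow>
    B.square (ftwo F x (y \<otimes>\<^bsub>A\<^esub> z) \<cdot>\<^bsub>B\<^esub> (Idt B (fob F x) \<boxtimes>\<^bsub>B\<^esub> ftwo F y z))
      (Assoc B (fob F x) (fob F y) (fob F z)) (far F (Assoc A x y z))
      (ftwo F (x \<otimes>\<^bsub>A\<^esub> y) z \<cdot>\<^bsub>B\<^esub> (ftwo F x y \<boxtimes>\<^bsub>B\<^esub> Idt B (fob F z)))"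
  by (simp add: B.square_def smf_ftwo_assoc)

lemma ftwo_symm_square:
  "\<lbrakk>smf F; x \<in> Obj A; y \<in> Obj A\<rbrakk> \<Longrightarrow>
    B.square (ftwo F x y) (Symm B (fob F x) (fob F y)) (far F (Symm A x y)) (ftwo F y x)"
  by (simp add: B.square_def smf_ftwo_symm)

text \<open>Each of the five factors of the interchange gives a square whose horizontal sides are built from
\<open>ftwo F\<close> for the respective bracketing, and the five squares are pasted. The result is what makes
postcomposition with \<open>F\<close> compatible with pointwise tensors.\<close>

lemma ftwo_interchange:
  assumes F [simp]: "smf F" and [simp]: "a \<in> Obj A" "b \<in> Obj A" "c \<in> Obj A" "d \<in> Obj A"
  shows "far F (interchange A a b c d) \<cdot>\<^bsub>B\<^esub> ftwo F (a \<otimes>\<^bsub>A\<^esub> b) (c \<otimes>\<^bsub>A\<^esub> d) \<cdot>\<^bsub>B\<^esub> (ftwo F a b \<boxtimes>\<^bsub>B\<^esub> ftwo F c d)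
    = ftwo F (a \<otimes>\<^bsub>A\<^esub> c) (b \<otimes>\<^bsub>A\<^esub> d) \<cdot>\<^bsub>B\<^esub> (ftwo F a c \<boxtimes>\<^bsub>B\<^esub> ftwo F b d)
      \<cdot>\<^bsub>B\<^esub> interchange B (fob F a) (fob F b) (fob F c) (fob F d)"
proof -
  let ?o = "fob F" and ?\<mu> = "ftwo F"
  let ?pair = "\<lambda>a b c d. ?\<mu> (a \<otimes>\<^bsub>A\<^esub> b) (c \<otimes>\<^bsub>A\<^esub> d) \<cdot>\<^bsub>B\<^esub> (?\<mu> a b \<boxtimes>\<^bsub>B\<^esub> ?\<mu> c d)"
  let ?right = "\<lambda>b c d. ?\<mu> b (c \<otimes>\<^bsub>A\<^esub> d) \<cdot>\<^bsub>B\<^esub> (Idt B (?o b) \<boxtimes>\<^bsub>B\<^esub> ?\<mu> c d)"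
  let ?left = "\<lambda>b c d. ?\<mu> (b \<otimes>\<^bsub>A\<^esub> c) d \<cdot>\<^bsub>B\<^esub> (?\<mu> b c \<boxtimes>\<^bsub>B\<^esub> Idt B (?o d))"
  let ?under = "\<lambda>x w. ?\<mu> a x \<cdot>\<^bsub>B\<^esub> (Idt B (?o a) \<boxtimes>\<^bsub>B\<^esub> w)"
  have assoc: "B.square (?under (b \<otimes>\<^bsub>A\<^esub> (c \<otimes>\<^bsub>A\<^esub> d)) (?right b c d))
      (Assoc B (?o a) (?o b) (?o c \<otimes>\<^bsub>B\<^esub> ?o d)) (far F (Assoc A a b (c \<otimes>\<^bsub>A\<^esub> d))) (?pair a b c d)"
    if [simp]: "b \<in> Obj A" "c \<in> Obj A" "d \<in> Obj A" for b c d
  proof -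
    have "B.square (Idt B (?o a) \<boxtimes>\<^bsub>B\<^esub> (Idt B (?o b) \<boxtimes>\<^bsub>B\<^esub> ?\<mu> c d)) (Assoc B (?o a) (?o b) (?o c \<otimes>\<^bsub>B\<^esub> ?o d))
      (Assoc B (?o a) (?o b) (?o (c \<otimes>\<^bsub>A\<^esub> d))) ((Idt B (?o a) \<boxtimes>\<^bsub>B\<^esub> Idt B (?o b)) \<boxtimes>\<^bsub>B\<^esub> ?\<mu> c d)"
      using B.square_assoc [of "Idt B (?o a)" "Idt B (?o b)" "?\<mu> c d"] by simp
    from B.square_stack [OF this ftwo_assoc_square [OF F, of a b "c \<otimes>\<^bsub>A\<^esub> d"]]
    show ?thesis
      by (simp add: B.tens_merge)
  qed
  have under: "B.square (?under x w) (Idt B (?o a) \<boxtimes>\<^bsub>B\<^esub> p) (far F (Idt A a \<boxtimes>\<^bsub>A\<^esub> q)) (?under x' w')"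
    if w: "B.square w p (far F q) w'" and [simp]: "q \<in> Arr A" "Dom A q = x" "Cod A q = x'" for w p q w' x x'
  proof -
    have "B.square (Idt B (?o a) \<boxtimes>\<^bsub>B\<^esub> w) (Idt B (?o a) \<boxtimes>\<^bsub>B\<^esub> p) (Idt B (?o a) \<boxtimes>\<^bsub>B\<^esub> far F q) (Idt B (?o a) \<boxtimes>\<^bsub>B\<^esub> w')"
      by (rule B.square_tens [OF _ w]) (simp add: B.square_idt)
    moreover have "B.square (?\<mu> a x) (Idt B (?o a) \<boxtimes>\<^bsub>B\<^esub> far F q) (far F (Idt A a \<boxtimes>\<^bsub>A\<^esub> q)) (?\<mu> a x')"
      using ftwo_square [OF F, of "Idt A a" q a x a x'] by simp
    ultimately show ?thesis
      by (rule B.square_stack)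
  qed
  have swap: "B.square (?left b c d) (Symm B (?o b) (?o c) \<boxtimes>\<^bsub>B\<^esub> Idt B (?o d)) (far F (Symm A b c \<boxtimes>\<^bsub>A\<^esub> Idt A d)) (?left c b d)"
  proof -
    have "B.square (?\<mu> b c \<boxtimes>\<^bsub>B\<^esub> Idt B (?o d)) (Symm B (?o b) (?o c) \<boxtimes>\<^bsub>B\<^esub> Idt B (?o d))
        (far F (Symm A b c) \<boxtimes>\<^bsub>B\<^esub> Idt B (?o d)) (?\<mu> c b \<boxtimes>\<^bsub>B\<^esub> Idt B (?o d))"
      by (rule B.square_tens [OF ftwo_symm_square]) (simp_all add: B.square_idt)
    moreover have "B.square (?\<mu> (b \<otimes>\<^bsub>A\<^esub> c) d) (far F (Symm A b c) \<boxtimes>\<^bsub>B\<^esub> Idt B (?o d))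
        (far F (Symm A b c \<boxtimes>\<^bsub>A\<^esub> Idt A d)) (?\<mu> (c \<otimes>\<^bsub>A\<^esub> b) d)"
      using ftwo_square [OF F, of "Symm A b c" "Idt A d" "b \<otimes>\<^bsub>A\<^esub> c" d "c \<otimes>\<^bsub>A\<^esub> b" d] by simp
    ultimately show ?thesis
      by (rule B.square_stack)
  qed
  have inv: "B.square y (inv_arr B p) (far F (inv_arr A q)) x"
    if "B.square x p (far F q) y" "iso_arr B p" "iso_arr A q" for x p q y
    using B.square_inv [OF that(1,2) far_iso(1) [OF F that(3)]] far_iso(2) [OF F that(3)] by simp
  have "B.square (?pair a b c d) (interchange B (?o a) (?o b) (?o c) (?o d)) (far F (interchange A a b c d)) (?pair a c b d)"
  proof -
    have "B.square (?pair a b c d) (inv_arr B (Assoc B (?o a) (?o b) (?o c \<otimes>\<^bsub>B\<^esub> ?o d)))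
      (far F (inv_arr A (Assoc A a b (c \<otimes>\<^bsub>A\<^esub> d)))) (?under (b \<otimes>\<^bsub>A\<^esub> (c \<otimes>\<^bsub>A\<^esub> d)) (?right b c d))"
      by (rule inv [OF assoc]) simp_all
    moreover have "B.square (?under (b \<otimes>\<^bsub>A\<^esub> (c \<otimes>\<^bsub>A\<^esub> d)) (?right b c d))
        (Idt B (?o a) \<boxtimes>\<^bsub>B\<^esub> Assoc B (?o b) (?o c) (?o d)) (far F (Idt A a \<boxtimes>\<^bsub>A\<^esub> Assoc A b c d))
        (?under ((b \<otimes>\<^bsub>A\<^esub> c) \<otimes>\<^bsub>A\<^esub> d) (?left b c d))"
      by (rule under [OF ftwo_assoc_square]) simp_all
    moreover have "B.square (?under ((b \<otimes>\<^bsub>A\<^esub> c) \<otimes>\<^bsub>A\<^esub> d) (?left b c d))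
        (Idt B (?o a) \<boxtimes>\<^bsub>B\<^esub> (Symm B (?o b) (?o c) \<boxtimes>\<^bsub>B\<^esub> Idt B (?o d))) (far F (Idt A a \<boxtimes>\<^bsub>A\<^esub> (Symm A b c \<boxtimes>\<^bsub>A\<^esub> Idt A d)))
        (?under ((c \<otimes>\<^bsub>A\<^esub> b) \<otimes>\<^bsub>A\<^esub> d) (?left c b d))"
      by (rule under [OF swap]) simp_all
    moreover have "B.square (?under ((c \<otimes>\<^bsub>A\<^esub> b) \<otimes>\<^bsub>A\<^esub> d) (?left c b d))
        (Idt B (?o a) \<boxtimes>\<^bsub>B\<^esub> inv_arr B (Assoc B (?o c) (?o b) (?o d))) (far F (Idt A a \<boxtimes>\<^bsub>A\<^esub> inv_arr A (Assoc A c b d)))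
        (?under (c \<otimes>\<^bsub>A\<^esub> (b \<otimes>\<^bsub>A\<^esub> d)) (?right c b d))"
      by (rule under [OF inv [OF ftwo_assoc_square]]) simp_all
    moreover have "B.square (?under (c \<otimes>\<^bsub>A\<^esub> (b \<otimes>\<^bsub>A\<^esub> d)) (?right c b d))
        (Assoc B (?o a) (?o c) (?o b \<otimes>\<^bsub>B\<^esub> ?o d)) (far F (Assoc A a c (b \<otimes>\<^bsub>A\<^esub> d))) (?pair a c b d)"
      by (rule assoc) simp_all
    ultimately show ?thesis
      unfolding interchange_def
      by (simp add: far_comp_arr) (blast intro: B.square_comp)
  qed
  then show ?thesis
    by (simp add: B.square_def)
qed

lemma ftwo_unit_unit:
  assumes [simp]: "smf F"
  shows "far F (RUnit A (Unit A)) \<cdot>\<^bsub>B\<^esub> ftwo F (Unit A) (Unit A) \<cdot>\<^bsub>B\<^esub> (fzero F \<boxtimes>\<^bsub>B\<^esub> fzero F)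
    = fzero F \<cdot>\<^bsub>B\<^esub> RUnit B (Unit B)"
    (is "?l = _")
proof -
  let ?I = "Unit A"
  have "?l = (far F (RUnit A ?I) \<cdot>\<^bsub>B\<^esub> ftwo F ?I ?I \<cdot>\<^bsub>B\<^esub> (Idt B (fob F ?I) \<boxtimes>\<^bsub>B\<^esub> fzero F))
      \<cdot>\<^bsub>B\<^esub> (fzero F \<boxtimes>\<^bsub>B\<^esub> Idt B (Unit B))"
    by (simp add: B.tens_merge)
  also have "\<dots> = RUnit B (fob F ?I) \<cdot>\<^bsub>B\<^esub> (fzero F \<boxtimes>\<^bsub>B\<^esub> Idt B (Unit B))"
    by (subst smf_ftwo_runit) simp_all
  also have "\<dots> = fzero F \<cdot>\<^bsub>B\<^esub> RUnit B (Unit B)"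
    using B.runit_nat_arr [of "fzero F"] by simp
  finally show ?thesis .
qed

lemma ftwo_unit_unit_inv:
  assumes [simp]: "smf F"
  shows "ftwo F (Unit A) (Unit A) \<cdot>\<^bsub>B\<^esub> (fzero F \<boxtimes>\<^bsub>B\<^esub> fzero F) \<cdot>\<^bsub>B\<^esub> inv_arr B (RUnit B (Unit B))
    = far F (inv_arr A (RUnit A (Unit A))) \<cdot>\<^bsub>B\<^esub> fzero F"
    (is "?l = _")
proof -
  let ?I = "Unit A"
  let ?r = "RUnit B (Unit B)"
  have [simp]: "iso_arr B (far F (RUnit A ?I))" by (rule far_iso) simp_all
  have "?l = far F (inv_arr A (RUnit A ?I)) \<cdot>\<^bsub>B\<^esub>
    (far F (RUnit A ?I) \<cdot>\<^bsub>B\<^esub> ftwo F ?I ?I \<cdot>\<^bsub>B\<^esub> (fzero F \<boxtimes>\<^bsub>B\<^esub> fzero F)) \<cdot>\<^bsub>B\<^esub> inv_arr B ?r"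
    by (simp add: far_iso)
  also have "\<dots> = far F (inv_arr A (RUnit A ?I)) \<cdot>\<^bsub>B\<^esub> fzero F"
    by (subst ftwo_unit_unit) simp_all
  finally show ?thesis .
qed

end

lemma whisker_left_simps [simp]:
  "nsrc (whisker_left X Z G \<theta>) = smf_comp X Z G (nsrc \<theta>)"
  "ntrg (whisker_left X Z G \<theta>) = smf_comp X Z G (ntrg \<theta>)"
  "ncmp (whisker_left X Z G \<theta>) \<in> extensional (Obj X)"
  "x \<in> Obj X \<Longrightarrow> ncmp (whisker_left X Z G \<theta>) x = far G (ncmp \<theta> x)"
  by (simp_all add: whisker_left_def)

lemma whisker_right_simps [simp]:
  "nsrc (whisker_right X Z \<sigma> H) = smf_comp X Z (nsrc \<sigma>) H"
  "ntrg (whisker_right X Z \<sigma> H) = smf_comp X Z (ntrg \<sigma>) H"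
  "ncmp (whisker_right X Z \<sigma> H) \<in> extensional (Obj X)"
  "x \<in> Obj X \<Longrightarrow> ncmp (whisker_right X Z \<sigma> H) x = ncmp \<sigma> (fob H x)"
  by (simp_all add: whisker_right_def)

locale smc_triple = X: symmetric_monoidal_category X + Y: symmetric_monoidal_category Y
  + Z: symmetric_monoidal_category Z
  for X :: "('o1, 'm1) smc_data" and Y :: "('o2, 'm2) smc_data" and Z :: "('o3, 'm3) smc_data"
begin

sublocale XY: smc_pair X Y ..
sublocale YZ: smc_pair Y Z ..
sublocale XZ: smc_pair X Z ..

lemma far_ftwo_past:
  assumes [simp]: "YZ.smf G" "f \<in> Arr Y" "g \<in> Arr Y" and "x = Cod Y f" "y = Cod Y g"
  shows "ftwo G x y \<cdot>\<^bsub>Z\<^esub> (far G f \<boxtimes>\<^bsub>Z\<^esub> far G g) = far G (f \<boxtimes>\<^bsub>Y\<^esub> g) \<cdot>\<^bsub>Z\<^esub> ftwo G (Dom Y f) (Dom Y g)"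
  using assms(4,5) by (simp add: YZ.ftwo_nat_arr)

lemma smf_comp_smf [simp]:
  assumes F [simp]: "XY.smf F" and G [simp]: "YZ.smf G"
  shows "XZ.smf (smf_comp X Z G F)"
proof (rule XZ.smfI)
  let ?H = "smf_comp X Z G F"
  show "fob ?H \<in> extensional (Obj X)" "far ?H \<in> extensional (Arr X)" "ftwo ?H \<in> extensional (Obj X)"
    by (simp_all add: smf_comp_def)
  show "ftwo ?H x \<in> extensional (Obj X)" if "x \<in> Obj X" for x
    using that by (simp add: smf_comp_def)
  show "far ?H (g \<cdot>\<^bsub>X\<^esub> f) = far ?H g \<cdot>\<^bsub>Z\<^esub> far ?H f" if "f \<in> Arr X" "g \<in> Arr X" "Dom X g = Cod X f" for f g
    using that by (simp add: XY.far_comp_arr YZ.far_comp_arr)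
  show "ftwo ?H (Cod X f) (Cod X g) \<cdot>\<^bsub>Z\<^esub> (far ?H f \<boxtimes>\<^bsub>Z\<^esub> far ?H g)
      = far ?H (f \<boxtimes>\<^bsub>X\<^esub> g) \<cdot>\<^bsub>Z\<^esub> ftwo ?H (Dom X f) (Dom X g)"
    if [simp]: "f \<in> Arr X" "g \<in> Arr X" for f g
  proof -
    have "ftwo ?H (Cod X f) (Cod X g) \<cdot>\<^bsub>Z\<^esub> (far ?H f \<boxtimes>\<^bsub>Z\<^esub> far ?H g)
      = far G (ftwo F (Cod X f) (Cod X g)) \<cdot>\<^bsub>Z\<^esub> ftwo G (fob F (Cod X f)) (fob F (Cod X g))
        \<cdot>\<^bsub>Z\<^esub> (far G (far F f) \<boxtimes>\<^bsub>Z\<^esub> far G (far F g))"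
      by simp
    also have "\<dots> = far G (ftwo F (Cod X f) (Cod X g) \<cdot>\<^bsub>Y\<^esub> (far F f \<boxtimes>\<^bsub>Y\<^esub> far F g))
        \<cdot>\<^bsub>Z\<^esub> ftwo G (fob F (Dom X f)) (fob F (Dom X g))"
      by (simp add: far_ftwo_past YZ.far_comp_arr)
    also have "\<dots> = far ?H (f \<boxtimes>\<^bsub>X\<^esub> g) \<cdot>\<^bsub>Z\<^esub> ftwo ?H (Dom X f) (Dom X g)"
      by (simp add: XY.ftwo_nat_arr YZ.far_comp_arr)
    finally show ?thesis .
  qed
  fix x assume x [simp]: "x \<in> Obj X"
  show "far ?H (RUnit X x) \<cdot>\<^bsub>Z\<^esub> ftwo ?H x (Unit X) \<cdot>\<^bsub>Z\<^esub> (Idt Z (fob ?H x) \<boxtimes>\<^bsub>Z\<^esub> fzero ?H) = RUnit Z (fob ?H x)"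
  proof -
    let ?x = "fob F x" and ?I = "fob F (Unit X)"
    have "far ?H (RUnit X x) \<cdot>\<^bsub>Z\<^esub> ftwo ?H x (Unit X) \<cdot>\<^bsub>Z\<^esub> (Idt Z (fob ?H x) \<boxtimes>\<^bsub>Z\<^esub> fzero ?H)
      = far G (far F (RUnit X x)) \<cdot>\<^bsub>Z\<^esub> far G (ftwo F x (Unit X))
        \<cdot>\<^bsub>Z\<^esub> (ftwo G ?x ?I \<cdot>\<^bsub>Z\<^esub> (far G (Idt Y ?x) \<boxtimes>\<^bsub>Z\<^esub> far G (fzero F)))
        \<cdot>\<^bsub>Z\<^esub> (Idt Z (fob G ?x) \<boxtimes>\<^bsub>Z\<^esub> fzero G)"
      by (simp add: Z.tens_merge)
    also have "ftwo G ?x ?I \<cdot>\<^bsub>Z\<^esub> (far G (Idt Y ?x) \<boxtimes>\<^bsub>Z\<^esub> far G (fzero F))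
      = far G (Idt Y ?x \<boxtimes>\<^bsub>Y\<^esub> fzero F) \<cdot>\<^bsub>Z\<^esub> ftwo G ?x (Unit Y)"
      by (subst far_ftwo_past) simp_all
    also have "far G (far F (RUnit X x)) \<cdot>\<^bsub>Z\<^esub> far G (ftwo F x (Unit X)) \<cdot>\<^bsub>Z\<^esub> (\<dots>)
        \<cdot>\<^bsub>Z\<^esub> (Idt Z (fob G ?x) \<boxtimes>\<^bsub>Z\<^esub> fzero G)
      = far G (far F (RUnit X x) \<cdot>\<^bsub>Y\<^esub> ftwo F x (Unit X) \<cdot>\<^bsub>Y\<^esub> (Idt Y ?x \<boxtimes>\<^bsub>Y\<^esub> fzero F))
        \<cdot>\<^bsub>Z\<^esub> ftwo G ?x (Unit Y) \<cdot>\<^bsub>Z\<^esub> (Idt Z (fob G ?x) \<boxtimes>\<^bsub>Z\<^esub> fzero G)"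
      by (simp add: YZ.far_comp_arr)
    also have "\<dots> = RUnit Z (fob ?H x)"
      by (simp add: XY.smf_ftwo_runit YZ.smf_ftwo_runit)
    finally show ?thesis .
  qed
  show "far ?H (LUnit X x) \<cdot>\<^bsub>Z\<^esub> ftwo ?H (Unit X) x \<cdot>\<^bsub>Z\<^esub> (fzero ?H \<boxtimes>\<^bsub>Z\<^esub> Idt Z (fob ?H x)) = LUnit Z (fob ?H x)"
  proof -
    let ?x = "fob F x" and ?I = "fob F (Unit X)"
    have "far ?H (LUnit X x) \<cdot>\<^bsub>Z\<^esub> ftwo ?H (Unit X) x \<cdot>\<^bsub>Z\<^esub> (fzero ?H \<boxtimes>\<^bsub>Z\<^esub> Idt Z (fob ?H x))
      = far G (far F (LUnit X x)) \<cdot>\<^bsub>Z\<^esub> far G (ftwo F (Unit X) x)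
        \<cdot>\<^bsub>Z\<^esub> (ftwo G ?I ?x \<cdot>\<^bsub>Z\<^esub> (far G (fzero F) \<boxtimes>\<^bsub>Z\<^esub> far G (Idt Y ?x)))
        \<cdot>\<^bsub>Z\<^esub> (fzero G \<boxtimes>\<^bsub>Z\<^esub> Idt Z (fob G ?x))"
      by (simp add: Z.tens_merge)
    also have "ftwo G ?I ?x \<cdot>\<^bsub>Z\<^esub> (far G (fzero F) \<boxtimes>\<^bsub>Z\<^esub> far G (Idt Y ?x))
      = far G (fzero F \<boxtimes>\<^bsub>Y\<^esub> Idt Y ?x) \<cdot>\<^bsub>Z\<^esub> ftwo G (Unit Y) ?x"
      by (subst far_ftwo_past) simp_all
    also have "far G (far F (LUnit X x)) \<cdot>\<^bsub>Z\<^esub> far G (ftwo F (Unit X) x) \<cdot>\<^bsub>Z\<^esub> (\<dots>)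
        \<cdot>\<^bsub>Z\<^esub> (fzero G \<boxtimes>\<^bsub>Z\<^esub> Idt Z (fob G ?x))
      = far G (far F (LUnit X x) \<cdot>\<^bsub>Y\<^esub> ftwo F (Unit X) x \<cdot>\<^bsub>Y\<^esub> (fzero F \<boxtimes>\<^bsub>Y\<^esub> Idt Y ?x))
        \<cdot>\<^bsub>Z\<^esub> ftwo G (Unit Y) ?x \<cdot>\<^bsub>Z\<^esub> (fzero G \<boxtimes>\<^bsub>Z\<^esub> Idt Z (fob G ?x))"
      by (simp add: YZ.far_comp_arr)
    also have "\<dots> = LUnit Z (fob ?H x)"
      by (simp add: XY.smf_ftwo_lunit YZ.smf_ftwo_lunit)
    finally show ?thesis .
  qed
  fix y assume y [simp]: "y \<in> Obj X"
  show "ftwo ?H y x \<cdot>\<^bsub>Z\<^esub> Symm Z (fob ?H x) (fob ?H y) = far ?H (Symm X x y) \<cdot>\<^bsub>Z\<^esub> ftwo ?H x y"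
  proof -
    have "ftwo ?H y x \<cdot>\<^bsub>Z\<^esub> Symm Z (fob ?H x) (fob ?H y)
      = far G (ftwo F y x \<cdot>\<^bsub>Y\<^esub> Symm Y (fob F x) (fob F y)) \<cdot>\<^bsub>Z\<^esub> ftwo G (fob F x) (fob F y)"
      by (simp add: YZ.smf_ftwo_symm YZ.far_comp_arr)
    also have "\<dots> = far ?H (Symm X x y) \<cdot>\<^bsub>Z\<^esub> ftwo ?H x y"
      by (simp add: XY.smf_ftwo_symm YZ.far_comp_arr)
    finally show ?thesis .
  qed
  fix z assume z [simp]: "z \<in> Obj X"
  show "ftwo ?H (x \<otimes>\<^bsub>X\<^esub> y) z \<cdot>\<^bsub>Z\<^esub> (ftwo ?H x y \<boxtimes>\<^bsub>Z\<^esub> Idt Z (fob ?H z)) \<cdot>\<^bsub>Z\<^esub> Assoc Z (fob ?H x) (fob ?H y) (fob ?H z)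
    = far ?H (Assoc X x y z) \<cdot>\<^bsub>Z\<^esub> ftwo ?H x (y \<otimes>\<^bsub>X\<^esub> z) \<cdot>\<^bsub>Z\<^esub> (Idt Z (fob ?H x) \<boxtimes>\<^bsub>Z\<^esub> ftwo ?H y z)"
  proof -
    let ?x = "fob F x" and ?y = "fob F y" and ?z = "fob F z"
    let ?G = "ftwo G" and ?F = "ftwo F"
    have "ftwo ?H (x \<otimes>\<^bsub>X\<^esub> y) z \<cdot>\<^bsub>Z\<^esub> (ftwo ?H x y \<boxtimes>\<^bsub>Z\<^esub> Idt Z (fob ?H z)) \<cdot>\<^bsub>Z\<^esub> Assoc Z (fob ?H x) (fob ?H y) (fob ?H z)
      = far G (?F (x \<otimes>\<^bsub>X\<^esub> y) z) \<cdot>\<^bsub>Z\<^esub>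
         (?G (fob F (x \<otimes>\<^bsub>X\<^esub> y)) ?z \<cdot>\<^bsub>Z\<^esub> (far G (?F x y) \<boxtimes>\<^bsub>Z\<^esub> far G (Idt Y ?z)))
         \<cdot>\<^bsub>Z\<^esub> (?G ?x ?y \<boxtimes>\<^bsub>Z\<^esub> Idt Z (fob G ?z)) \<cdot>\<^bsub>Z\<^esub> Assoc Z (fob G ?x) (fob G ?y) (fob G ?z)"
      by (simp add: Z.tens_merge)
    also have "?G (fob F (x \<otimes>\<^bsub>X\<^esub> y)) ?z \<cdot>\<^bsub>Z\<^esub> (far G (?F x y) \<boxtimes>\<^bsub>Z\<^esub> far G (Idt Y ?z))
      = far G (?F x y \<boxtimes>\<^bsub>Y\<^esub> Idt Y ?z) \<cdot>\<^bsub>Z\<^esub> ?G (?x \<otimes>\<^bsub>Y\<^esub> ?y) ?z"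
      by (subst far_ftwo_past) simp_all
    also have "far G (?F (x \<otimes>\<^bsub>X\<^esub> y) z) \<cdot>\<^bsub>Z\<^esub> (\<dots>)
         \<cdot>\<^bsub>Z\<^esub> (?G ?x ?y \<boxtimes>\<^bsub>Z\<^esub> Idt Z (fob G ?z)) \<cdot>\<^bsub>Z\<^esub> Assoc Z (fob G ?x) (fob G ?y) (fob G ?z)
      = far G (?F (x \<otimes>\<^bsub>X\<^esub> y) z \<cdot>\<^bsub>Y\<^esub> (?F x y \<boxtimes>\<^bsub>Y\<^esub> Idt Y ?z) \<cdot>\<^bsub>Y\<^esub> Assoc Y ?x ?y ?z)
        \<cdot>\<^bsub>Z\<^esub> ?G ?x (?y \<otimes>\<^bsub>Y\<^esub> ?z) \<cdot>\<^bsub>Z\<^esub> (Idt Z (fob G ?x) \<boxtimes>\<^bsub>Z\<^esub> ?G ?y ?z)"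
      by (simp add: YZ.far_comp_arr YZ.smf_ftwo_assoc)
    also have "?F (x \<otimes>\<^bsub>X\<^esub> y) z \<cdot>\<^bsub>Y\<^esub> (?F x y \<boxtimes>\<^bsub>Y\<^esub> Idt Y ?z) \<cdot>\<^bsub>Y\<^esub> Assoc Y ?x ?y ?z
      = far F (Assoc X x y z) \<cdot>\<^bsub>Y\<^esub> ?F x (y \<otimes>\<^bsub>X\<^esub> z) \<cdot>\<^bsub>Y\<^esub> (Idt Y ?x \<boxtimes>\<^bsub>Y\<^esub> ?F y z)"
      by (rule XY.smf_ftwo_assoc) simp_all
    also have "far G (\<dots>) \<cdot>\<^bsub>Z\<^esub> ?G ?x (?y \<otimes>\<^bsub>Y\<^esub> ?z) \<cdot>\<^bsub>Z\<^esub> (Idt Z (fob G ?x) \<boxtimes>\<^bsub>Z\<^esub> ?G ?y ?z)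
      = far G (far F (Assoc X x y z)) \<cdot>\<^bsub>Z\<^esub> far G (?F x (y \<otimes>\<^bsub>X\<^esub> z))
        \<cdot>\<^bsub>Z\<^esub> (far G (Idt Y ?x \<boxtimes>\<^bsub>Y\<^esub> ?F y z) \<cdot>\<^bsub>Z\<^esub> ?G ?x (?y \<otimes>\<^bsub>Y\<^esub> ?z)) \<cdot>\<^bsub>Z\<^esub> (Idt Z (fob G ?x) \<boxtimes>\<^bsub>Z\<^esub> ?G ?y ?z)"
      by (simp add: YZ.far_comp_arr)
    also have "far G (Idt Y ?x \<boxtimes>\<^bsub>Y\<^esub> ?F y z) \<cdot>\<^bsub>Z\<^esub> ?G ?x (?y \<otimes>\<^bsub>Y\<^esub> ?z)
      = ?G ?x (fob F (y \<otimes>\<^bsub>X\<^esub> z)) \<cdot>\<^bsub>Z\<^esub> (far G (Idt Y ?x) \<boxtimes>\<^bsub>Z\<^esub> far G (?F y z))"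
      by (subst far_ftwo_past) simp_all
    finally show ?thesis
      by (simp add: Z.tens_merge)
  qed
qed simp_all

lemma whisker_left_mnt [simp]:
  assumes [simp]: "YZ.smf G" "XY.mnt \<theta>"
  shows "XZ.mnt (whisker_left X Z G \<theta>)"
proof (rule XZ.mntI)
  let ?t = "whisker_left X Z G \<theta>"
  show "ncmp ?t (Cod X f) \<cdot>\<^bsub>Z\<^esub> far (nsrc ?t) f = far (ntrg ?t) f \<cdot>\<^bsub>Z\<^esub> ncmp ?t (Dom X f)"
    if [simp]: "f \<in> Arr X" for f
    by (simp add: XY.ncmp_nat_arr flip: YZ.far_comp_arr)
  show "ncmp ?t (Unit X) \<cdot>\<^bsub>Z\<^esub> fzero (nsrc ?t) = fzero (ntrg ?t)"
    using Z.comp_extend [of "far G (ncmp \<theta> (Unit X))" "far G (fzero (nsrc \<theta>))" "far G (fzero (ntrg \<theta>))" "fzero G"]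
    by (simp add: XY.mnt_unit flip: YZ.far_comp_arr)
  show "ncmp ?t (x \<otimes>\<^bsub>X\<^esub> y) \<cdot>\<^bsub>Z\<^esub> ftwo (nsrc ?t) x y = ftwo (ntrg ?t) x y \<cdot>\<^bsub>Z\<^esub> (ncmp ?t x \<boxtimes>\<^bsub>Z\<^esub> ncmp ?t y)"
    if [simp]: "x \<in> Obj X" "y \<in> Obj X" for x y
  proof -
    let ?S = "nsrc \<theta>" and ?T = "ntrg \<theta>"
    have "ncmp ?t (x \<otimes>\<^bsub>X\<^esub> y) \<cdot>\<^bsub>Z\<^esub> ftwo (nsrc ?t) x y
      = far G (ncmp \<theta> (x \<otimes>\<^bsub>X\<^esub> y) \<cdot>\<^bsub>Y\<^esub> ftwo ?S x y) \<cdot>\<^bsub>Z\<^esub> ftwo G (fob ?S x) (fob ?S y)"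
      by (simp add: YZ.far_comp_arr)
    also have "\<dots> = far G (ftwo ?T x y \<cdot>\<^bsub>Y\<^esub> (ncmp \<theta> x \<boxtimes>\<^bsub>Y\<^esub> ncmp \<theta> y)) \<cdot>\<^bsub>Z\<^esub> ftwo G (fob ?S x) (fob ?S y)"
      by (simp add: XY.mnt_tens)
    also have "\<dots> = ftwo (ntrg ?t) x y \<cdot>\<^bsub>Z\<^esub> (ncmp ?t x \<boxtimes>\<^bsub>Z\<^esub> ncmp ?t y)"
      by (simp add: YZ.far_comp_arr far_ftwo_past)
    finally show ?thesis .
  qed
qed simp_all

lemma whisker_right_mnt [simp]:
  assumes [simp]: "YZ.mnt \<sigma>" "XY.smf H"
  shows "XZ.mnt (whisker_right X Z \<sigma> H)"
proof (rule XZ.mntI)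
  let ?t = "whisker_right X Z \<sigma> H" and ?S = "nsrc \<sigma>" and ?T = "ntrg \<sigma>"
  have nat: "ncmp \<sigma> (Cod Y g) \<cdot>\<^bsub>Z\<^esub> far ?S g \<cdot>\<^bsub>Z\<^esub> w = far ?T g \<cdot>\<^bsub>Z\<^esub> ncmp \<sigma> (Dom Y g) \<cdot>\<^bsub>Z\<^esub> w"
    if "g \<in> Arr Y" "w \<in> Arr Z" "Cod Z w = fob ?S (Dom Y g)" for g w
    by (rule Z.comp_extend2 [OF YZ.ncmp_nat_arr]) (use that in simp_all)
  show "ncmp ?t (Cod X f) \<cdot>\<^bsub>Z\<^esub> far (nsrc ?t) f = far (ntrg ?t) f \<cdot>\<^bsub>Z\<^esub> ncmp ?t (Dom X f)"
    if [simp]: "f \<in> Arr X" for f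
    using YZ.ncmp_nat_arr [of \<sigma> "far H f"] by simp
  show "ncmp ?t (Unit X) \<cdot>\<^bsub>Z\<^esub> fzero (nsrc ?t) = fzero (ntrg ?t)"
    using nat [of "fzero H" "fzero ?S"] by (simp add: YZ.mnt_unit)
  show "ncmp ?t (x \<otimes>\<^bsub>X\<^esub> y) \<cdot>\<^bsub>Z\<^esub> ftwo (nsrc ?t) x y = ftwo (ntrg ?t) x y \<cdot>\<^bsub>Z\<^esub> (ncmp ?t x \<boxtimes>\<^bsub>Z\<^esub> ncmp ?t y)"
    if [simp]: "x \<in> Obj X" "y \<in> Obj X" for x y
    using nat [of "ftwo H x y" "ftwo ?S (fob H x) (fob H y)"] by (simp add: YZ.mnt_tens)
qed simp_all

end

section \<open>Precomposition and postcomposition\<close>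

lemma ihom_map_simps [simp]:
  "symmetric_monoidal_functor A B H \<Longrightarrow> fob (ihom_map A B D G) H = smf_comp A D G H"
  "monoidal_transformation A B \<theta> \<Longrightarrow> far (ihom_map A B D G) \<theta> = whisker_left A D G \<theta>"
  "nsrc (fzero (ihom_map A B D G)) = smf_unit A D"
  "ntrg (fzero (ihom_map A B D G)) = smf_comp A D G (smf_unit A B)"
  "ncmp (fzero (ihom_map A B D G)) \<in> extensional (Obj A)"
  "a \<in> Obj A \<Longrightarrow> ncmp (fzero (ihom_map A B D G)) a = fzero G"
  by (simp_all add: ihom_map_def)

lemma ihom_map_ftwo_simps [simp]:
  assumes "symmetric_monoidal_functor A B H" "symmetric_monoidal_functor A B K"
  shows "nsrc (ftwo (ihom_map A B D G) H K) = smf_tens A D (smf_comp A D G H) (smf_comp A D G K)"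
    "ntrg (ftwo (ihom_map A B D G) H K) = smf_comp A D G (smf_tens A B H K)"
    "ncmp (ftwo (ihom_map A B D G) H K) \<in> extensional (Obj A)"
    "a \<in> Obj A \<Longrightarrow> ncmp (ftwo (ihom_map A B D G) H K) a = ftwo G (fob H a) (fob K a)"
  using assms by (simp_all add: ihom_map_def)

lemma ihom_map_cell_simps [simp]:
  "nsrc (ihom_map_cell A B D \<sigma>) = ihom_map A B D (nsrc \<sigma>)"
  "ntrg (ihom_map_cell A B D \<sigma>) = ihom_map A B D (ntrg \<sigma>)"
  "symmetric_monoidal_functor A B H \<Longrightarrow> ncmp (ihom_map_cell A B D \<sigma>) H = whisker_right A D \<sigma> H"
  by (simp_all add: ihom_map_cell_def)

context smc_triple begin

text \<open>Precomposition with \<open>K\<close> is strict because pointwise structure can be evaluated at \<open>K\<close>.\<close>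

lemma smf_comp_unit:
  assumes [simp]: "XY.smf K"
  shows "smf_comp X Z (smf_unit Y Z) K = smf_unit X Z"
  by (rule smf_ext [where A = X and B = Z]) simp_all

lemma smf_comp_tens:
  assumes [simp]: "XY.smf K" "YZ.smf P" "YZ.smf Q"
  shows "smf_comp X Z (smf_tens Y Z P Q) K = smf_tens X Z (smf_comp X Z P K) (smf_comp X Z Q K)"
  by (rule smf_ext [where A = X and B = Z]) (simp_all add: Z.tens_merge)

lemma whisker_right_idt:
  assumes [simp]: "XY.smf K"
  shows "whisker_right X Z (Idt (Y \<Rrightarrow> Z) P) K = Idt (X \<Rrightarrow> Z) (smf_comp X Z P K)"
  by (rule mnt_ext [where A = X]) simp_all

sublocale hom: smc_pair "X \<Rrightarrow> Y" "X \<Rrightarrow> Z"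
  by (rule smc_pair.intro [OF XY.ihom_smc XZ.ihom_smc])

lemma ihom_map_fzero_mnt [simp]:
  assumes [simp]: "YZ.smf G"
  shows "XZ.mnt (fzero (ihom_map X Y Z G))"
  by (rule XZ.mntI) (simp_all add: YZ.ftwo_unit_unit)

lemma ihom_map_ftwo_mnt [simp]:
  assumes G [simp]: "YZ.smf G" and [simp]: "XY.smf H" "XY.smf K"
  shows "XZ.mnt (ftwo (ihom_map X Y Z G) H K)"
proof (rule XZ.mntI)
  let ?t = "ftwo (ihom_map X Y Z G) H K"
  show "ncmp ?t (Cod X f) \<cdot>\<^bsub>Z\<^esub> far (nsrc ?t) f = far (ntrg ?t) f \<cdot>\<^bsub>Z\<^esub> ncmp ?t (Dom X f)"
    if [simp]: "f \<in> Arr X" for f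
    by (simp add: far_ftwo_past)
  show "ncmp ?t (Unit X) \<cdot>\<^bsub>Z\<^esub> fzero (nsrc ?t) = fzero (ntrg ?t)"
  proof -
    let ?H = "fob H (Unit X)" and ?K = "fob K (Unit X)" and ?r = "inv_arr Z (RUnit Z (Unit Z))"
    have "ncmp ?t (Unit X) \<cdot>\<^bsub>Z\<^esub> fzero (nsrc ?t)
      = (ftwo G ?H ?K \<cdot>\<^bsub>Z\<^esub> (far G (fzero H) \<boxtimes>\<^bsub>Z\<^esub> far G (fzero K))) \<cdot>\<^bsub>Z\<^esub> (fzero G \<boxtimes>\<^bsub>Z\<^esub> fzero G) \<cdot>\<^bsub>Z\<^esub> ?r"
      by (simp add: Z.tens_merge)
    also have "\<dots> = far G (fzero H \<boxtimes>\<^bsub>Y\<^esub> fzero K) \<cdot>\<^bsub>Z\<^esub>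
        (ftwo G (Unit Y) (Unit Y) \<cdot>\<^bsub>Z\<^esub> (fzero G \<boxtimes>\<^bsub>Z\<^esub> fzero G) \<cdot>\<^bsub>Z\<^esub> ?r)"
      by (simp add: far_ftwo_past)
    also have "\<dots> = fzero (ntrg ?t)"
      by (simp only: YZ.ftwo_unit_unit_inv [OF G]) (simp add: YZ.far_comp_arr)
    finally show ?thesis .
  qed
  show "ncmp ?t (x \<otimes>\<^bsub>X\<^esub> y) \<cdot>\<^bsub>Z\<^esub> ftwo (nsrc ?t) x y = ftwo (ntrg ?t) x y \<cdot>\<^bsub>Z\<^esub> (ncmp ?t x \<boxtimes>\<^bsub>Z\<^esub> ncmp ?t y)"
    if [simp]: "x \<in> Obj X" "y \<in> Obj X" for x y
  proof -
    let ?m = "interchange Z (fob G (fob H x)) (fob G (fob K x)) (fob G (fob H y)) (fob G (fob K y))"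
    let ?n = "interchange Y (fob H x) (fob K x) (fob H y) (fob K y)"
    let ?h = "ftwo H x y" and ?k = "ftwo K x y" and ?G = "ftwo G"
    let ?hx = "fob H x" and ?hy = "fob H y" and ?kx = "fob K x" and ?ky = "fob K y"
    have "ncmp ?t (x \<otimes>\<^bsub>X\<^esub> y) \<cdot>\<^bsub>Z\<^esub> ftwo (nsrc ?t) x y
      = (?G (fob H (x \<otimes>\<^bsub>X\<^esub> y)) (fob K (x \<otimes>\<^bsub>X\<^esub> y)) \<cdot>\<^bsub>Z\<^esub> (far G ?h \<boxtimes>\<^bsub>Z\<^esub> far G ?k))
        \<cdot>\<^bsub>Z\<^esub> (?G ?hx ?hy \<boxtimes>\<^bsub>Z\<^esub> ?G ?kx ?ky) \<cdot>\<^bsub>Z\<^esub> ?m"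
      by (simp add: Z.tens_merge)
    also have "\<dots> = far G (?h \<boxtimes>\<^bsub>Y\<^esub> ?k)
        \<cdot>\<^bsub>Z\<^esub> (?G (?hx \<otimes>\<^bsub>Y\<^esub> ?hy) (?kx \<otimes>\<^bsub>Y\<^esub> ?ky) \<cdot>\<^bsub>Z\<^esub> (?G ?hx ?hy \<boxtimes>\<^bsub>Z\<^esub> ?G ?kx ?ky) \<cdot>\<^bsub>Z\<^esub> ?m)"
      by (simp add: far_ftwo_past)
    also have "?G (?hx \<otimes>\<^bsub>Y\<^esub> ?hy) (?kx \<otimes>\<^bsub>Y\<^esub> ?ky) \<cdot>\<^bsub>Z\<^esub> (?G ?hx ?hy \<boxtimes>\<^bsub>Z\<^esub> ?G ?kx ?ky) \<cdot>\<^bsub>Z\<^esub> ?m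
      = far G ?n \<cdot>\<^bsub>Z\<^esub> ?G (?hx \<otimes>\<^bsub>Y\<^esub> ?kx) (?hy \<otimes>\<^bsub>Y\<^esub> ?ky) \<cdot>\<^bsub>Z\<^esub> (?G ?hx ?kx \<boxtimes>\<^bsub>Z\<^esub> ?G ?hy ?ky)"
      by (rule YZ.ftwo_interchange [symmetric]) simp_all
    finally show ?thesis
      by (simp add: YZ.far_comp_arr)
  qed
qed simp_all

lemma ihom_map_smf [simp]:
  assumes [simp]: "YZ.smf G"
  shows "hom.smf (ihom_map X Y Z G)"
proof (rule hom.smfI)
  let ?M = "ihom_map X Y Z G"
  show "fob ?M \<in> extensional (Obj (X \<Rrightarrow> Y))" "far ?M \<in> extensional (Arr (X \<Rrightarrow> Y))" "ftwo ?M \<in> extensional (Obj (X \<Rrightarrow> Y))"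
    by (simp_all add: ihom_map_def)
  show "ftwo ?M H \<in> extensional (Obj (X \<Rrightarrow> Y))" if "H \<in> Obj (X \<Rrightarrow> Y)" for H
    using that by (simp add: ihom_map_def)
  show "far ?M (\<tau> \<cdot>\<^bsub>X \<Rrightarrow> Y\<^esub> \<sigma>) = far ?M \<tau> \<cdot>\<^bsub>X \<Rrightarrow> Z\<^esub> far ?M \<sigma>"
    if "\<sigma> \<in> Arr (X \<Rrightarrow> Y)" "\<tau> \<in> Arr (X \<Rrightarrow> Y)" "Dom (X \<Rrightarrow> Y) \<tau> = Cod (X \<Rrightarrow> Y) \<sigma>" for \<sigma> \<tau>
    by (rule mnt_ext [where A = X]) (use that in \<open>simp_all add: YZ.far_comp_arr\<close>)
  show "far ?M (Idt (X \<Rrightarrow> Y) H) = Idt (X \<Rrightarrow> Z) (fob ?M H)" if "H \<in> Obj (X \<Rrightarrow> Y)" for H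
    by (rule mnt_ext [where A = X]) (use that in simp_all)
  show "ftwo ?M (Cod (X \<Rrightarrow> Y) \<sigma>) (Cod (X \<Rrightarrow> Y) \<tau>) \<cdot>\<^bsub>X \<Rrightarrow> Z\<^esub> (far ?M \<sigma> \<boxtimes>\<^bsub>X \<Rrightarrow> Z\<^esub> far ?M \<tau>)
      = far ?M (\<sigma> \<boxtimes>\<^bsub>X \<Rrightarrow> Y\<^esub> \<tau>) \<cdot>\<^bsub>X \<Rrightarrow> Z\<^esub> ftwo ?M (Dom (X \<Rrightarrow> Y) \<sigma>) (Dom (X \<Rrightarrow> Y) \<tau>)"
    if "\<sigma> \<in> Arr (X \<Rrightarrow> Y)" "\<tau> \<in> Arr (X \<Rrightarrow> Y)" for \<sigma> \<tau>
    by (rule mnt_ext [where A = X]) (use that in \<open>simp_all add: far_ftwo_past\<close>)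
  fix H assume "H \<in> Obj (X \<Rrightarrow> Y)"
  then have H [simp]: "XY.smf H" by simp
  show "far ?M (RUnit (X \<Rrightarrow> Y) H) \<cdot>\<^bsub>X \<Rrightarrow> Z\<^esub> ftwo ?M H (Unit (X \<Rrightarrow> Y))
      \<cdot>\<^bsub>X \<Rrightarrow> Z\<^esub> (Idt (X \<Rrightarrow> Z) (fob ?M H) \<boxtimes>\<^bsub>X \<Rrightarrow> Z\<^esub> fzero ?M) = RUnit (X \<Rrightarrow> Z) (fob ?M H)"
    by (rule mnt_ext [where A = X]) (simp_all add: YZ.smf_ftwo_runit)
  show "far ?M (LUnit (X \<Rrightarrow> Y) H) \<cdot>\<^bsub>X \<Rrightarrow> Z\<^esub> ftwo ?M (Unit (X \<Rrightarrow> Y)) H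
      \<cdot>\<^bsub>X \<Rrightarrow> Z\<^esub> (fzero ?M \<boxtimes>\<^bsub>X \<Rrightarrow> Z\<^esub> Idt (X \<Rrightarrow> Z) (fob ?M H)) = LUnit (X \<Rrightarrow> Z) (fob ?M H)"
    by (rule mnt_ext [where A = X]) (simp_all add: YZ.smf_ftwo_lunit)
  fix K assume "K \<in> Obj (X \<Rrightarrow> Y)"
  then have K [simp]: "XY.smf K" by simp
  show "ftwo ?M K H \<cdot>\<^bsub>X \<Rrightarrow> Z\<^esub> Symm (X \<Rrightarrow> Z) (fob ?M H) (fob ?M K)
      = far ?M (Symm (X \<Rrightarrow> Y) H K) \<cdot>\<^bsub>X \<Rrightarrow> Z\<^esub> ftwo ?M H K"
    by (rule mnt_ext [where A = X]) (simp_all add: YZ.smf_ftwo_symm)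
  fix L assume "L \<in> Obj (X \<Rrightarrow> Y)"
  then have L [simp]: "XY.smf L" by simp
  show "ftwo ?M (H \<otimes>\<^bsub>X \<Rrightarrow> Y\<^esub> K) L \<cdot>\<^bsub>X \<Rrightarrow> Z\<^esub> (ftwo ?M H K \<boxtimes>\<^bsub>X \<Rrightarrow> Z\<^esub> Idt (X \<Rrightarrow> Z) (fob ?M L))
      \<cdot>\<^bsub>X \<Rrightarrow> Z\<^esub> Assoc (X \<Rrightarrow> Z) (fob ?M H) (fob ?M K) (fob ?M L)
    = far ?M (Assoc (X \<Rrightarrow> Y) H K L) \<cdot>\<^bsub>X \<Rrightarrow> Z\<^esub> ftwo ?M H (K \<otimes>\<^bsub>X \<Rrightarrow> Y\<^esub> L)
      \<cdot>\<^bsub>X \<Rrightarrow> Z\<^esub> (Idt (X \<Rrightarrow> Z) (fob ?M H) \<boxtimes>\<^bsub>X \<Rrightarrow> Z\<^esub> ftwo ?M K L)"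
    by (rule mnt_ext [where A = X]) (simp_all add: YZ.smf_ftwo_assoc)
qed simp_all

lemma ihom_map_cell_mnt [simp]:
  assumes [simp]: "YZ.mnt \<sigma>"
  shows "hom.mnt (ihom_map_cell X Y Z \<sigma>)"
proof (rule hom.mntI)
  let ?t = "ihom_map_cell X Y Z \<sigma>"
  show "ncmp ?t \<in> extensional (Obj (X \<Rrightarrow> Y))"
    by (simp add: ihom_map_cell_def)
  show "ncmp ?t (Cod (X \<Rrightarrow> Y) \<theta>) \<cdot>\<^bsub>X \<Rrightarrow> Z\<^esub> far (nsrc ?t) \<theta> = far (ntrg ?t) \<theta> \<cdot>\<^bsub>X \<Rrightarrow> Z\<^esub> ncmp ?t (Dom (X \<Rrightarrow> Y) \<theta>)"
    if "\<theta> \<in> Arr (X \<Rrightarrow> Y)" for \<theta>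
  proof (rule mnt_ext [where A = X])
    fix x assume "x \<in> Obj X"
    then show "ncmp (ncmp ?t (Cod (X \<Rrightarrow> Y) \<theta>) \<cdot>\<^bsub>X \<Rrightarrow> Z\<^esub> far (nsrc ?t) \<theta>) x
        = ncmp (far (ntrg ?t) \<theta> \<cdot>\<^bsub>X \<Rrightarrow> Z\<^esub> ncmp ?t (Dom (X \<Rrightarrow> Y) \<theta>)) x"
      using that YZ.ncmp_nat_arr [of \<sigma> "ncmp \<theta> x"] by simp
  qed (use that in simp_all)
  show "ncmp ?t (Unit (X \<Rrightarrow> Y)) \<cdot>\<^bsub>X \<Rrightarrow> Z\<^esub> fzero (nsrc ?t) = fzero (ntrg ?t)"
    by (rule mnt_ext [where A = X]) (simp_all add: YZ.mnt_unit)
  show "ncmp ?t (H \<otimes>\<^bsub>X \<Rrightarrow> Y\<^esub> K) \<cdot>\<^bsub>X \<Rrightarrow> Z\<^esub> ftwo (nsrc ?t) H K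
      = ftwo (ntrg ?t) H K \<cdot>\<^bsub>X \<Rrightarrow> Z\<^esub> (ncmp ?t H \<boxtimes>\<^bsub>X \<Rrightarrow> Z\<^esub> ncmp ?t K)"
    if "H \<in> Obj (X \<Rrightarrow> Y)" "K \<in> Obj (X \<Rrightarrow> Y)" for H K
    by (rule mnt_ext [where A = X]) (use that in \<open>simp_all add: YZ.mnt_tens\<close>)
qed simp_all

end

section \<open>Duality\<close>

lemma dual_at_simps [simp]:
  "a \<in> Obj A \<Longrightarrow> fob (dual_at A F b) a = fob (fob F a) b"
  "f \<in> Arr A \<Longrightarrow> far (dual_at A F b) f = ncmp (far F f) b"
  "fzero (dual_at A F b) = ncmp (fzero F) b"
  "a \<in> Obj A \<Longrightarrow> a' \<in> Obj A \<Longrightarrow> ftwo (dual_at A F b) a a' = ncmp (ftwo F a a') b"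
  by (simp_all add: dual_at_def)

lemma dual_simps [simp]:
  "b \<in> Obj B \<Longrightarrow> fob (dual A B C F) b = dual_at A F b"
  "g \<in> Arr B \<Longrightarrow> nsrc (far (dual A B C F) g) = dual_at A F (Dom B g)"
  "g \<in> Arr B \<Longrightarrow> ntrg (far (dual A B C F) g) = dual_at A F (Cod B g)"
  "g \<in> Arr B \<Longrightarrow> ncmp (far (dual A B C F) g) \<in> extensional (Obj A)"
  "g \<in> Arr B \<Longrightarrow> a \<in> Obj A \<Longrightarrow> ncmp (far (dual A B C F) g) a = far (fob F a) g"
  "nsrc (fzero (dual A B C F)) = smf_unit A C"
  "ntrg (fzero (dual A B C F)) = dual_at A F (Unit B)"
  "ncmp (fzero (dual A B C F)) \<in> extensional (Obj A)"
  "a \<in> Obj A \<Longrightarrow> ncmp (fzero (dual A B C F)) a = fzero (fob F a)"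
  "b \<in> Obj B \<Longrightarrow> b' \<in> Obj B \<Longrightarrow> nsrc (ftwo (dual A B C F) b b') = smf_tens A C (dual_at A F b) (dual_at A F b')"
  "b \<in> Obj B \<Longrightarrow> b' \<in> Obj B \<Longrightarrow> ntrg (ftwo (dual A B C F) b b') = dual_at A F (b \<otimes>\<^bsub>B\<^esub> b')"
  "b \<in> Obj B \<Longrightarrow> b' \<in> Obj B \<Longrightarrow> ncmp (ftwo (dual A B C F) b b') \<in> extensional (Obj A)"
  "b \<in> Obj B \<Longrightarrow> b' \<in> Obj B \<Longrightarrow> a \<in> Obj A \<Longrightarrow> ncmp (ftwo (dual A B C F) b b') a = ftwo (fob F a) b b'"
  by (simp_all add: dual_def)

lemma dual_cell_simps [simp]:
  "nsrc (dual_cell A B C \<theta>) = dual A B C (nsrc \<theta>)"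
  "ntrg (dual_cell A B C \<theta>) = dual A B C (ntrg \<theta>)"
  "ncmp (dual_cell A B C \<theta>) \<in> extensional (Obj B)"
  "b \<in> Obj B \<Longrightarrow> nsrc (ncmp (dual_cell A B C \<theta>) b) = dual_at A (nsrc \<theta>) b"
  "b \<in> Obj B \<Longrightarrow> ntrg (ncmp (dual_cell A B C \<theta>) b) = dual_at A (ntrg \<theta>) b"
  "b \<in> Obj B \<Longrightarrow> ncmp (ncmp (dual_cell A B C \<theta>) b) \<in> extensional (Obj A)"
  "b \<in> Obj B \<Longrightarrow> a \<in> Obj A \<Longrightarrow> ncmp (ncmp (dual_cell A B C \<theta>) b) a = ncmp (ncmp \<theta> a) b"
  by (simp_all add: dual_cell_def)

context smc_pair begin

lemma ncmp_inv_arr: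
  assumes "iso_arr (A \<Rrightarrow> B) \<theta>" and a: "a \<in> Obj A"
  shows "ncmp (inv_arr (A \<Rrightarrow> B) \<theta>) a = inv_arr B (ncmp \<theta> a)"
proof -
  interpret AB: symmetric_monoidal_category "A \<Rrightarrow> B" by (rule ihom_smc)
  let ?i = "inv_arr (A \<Rrightarrow> B) \<theta>"
  have "inverse_of (A \<Rrightarrow> B) \<theta> ?i"
    by (rule AB.inverse_of_inv_arr) fact
  then have [simp]: "mnt \<theta>" "mnt ?i" "nsrc ?i = ntrg \<theta>" "ntrg ?i = nsrc \<theta>"
    and eq: "?i \<cdot>\<^bsub>A \<Rrightarrow> B\<^esub> \<theta> = Idt (A \<Rrightarrow> B) (nsrc \<theta>)" "\<theta> \<cdot>\<^bsub>A \<Rrightarrow> B\<^esub> ?i = Idt (A \<Rrightarrow> B) (ntrg \<theta>)"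
    by (auto simp: inverse_of_def Hom_def)
  show ?thesis
    using a arg_cong [OF eq(1), of "\<lambda>t. ncmp t a"] arg_cong [OF eq(2), of "\<lambda>t. ncmp t a"]
    by (intro B.inv_arr_eqI' [symmetric]) simp_all
qed

lemma inv_arr_boundary:
  assumes "iso_arr (A \<Rrightarrow> B) \<theta>"
  shows "nsrc (inv_arr (A \<Rrightarrow> B) \<theta>) = ntrg \<theta>" "ntrg (inv_arr (A \<Rrightarrow> B) \<theta>) = nsrc \<theta>"
  using category.inv_arr_simps(2,3) [OF symmetric_monoidal_category.axioms(1) [OF ihom_smc] assms]
  by simp_all

lemma nsrc_interchange:
  assumes "smf F" "smf G" "smf H" "smf K"
  shows "nsrc (interchange (A \<Rrightarrow> B) F G H K) = smf_tens A B (smf_tens A B F G) (smf_tens A B H K)"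
  using symmetric_monoidal_category.interchange_simps(2) [OF ihom_smc, of F G H K] assms by simp

lemma ncmp_interchange:
  assumes [simp]: "smf F" "smf G" "smf H" "smf K" and a [simp]: "a \<in> Obj A"
  shows "ncmp (interchange (A \<Rrightarrow> B) F G H K) a = interchange B (fob F a) (fob G a) (fob H a) (fob K a)"
proof -
  interpret AB: symmetric_monoidal_category "A \<Rrightarrow> B" by (rule ihom_smc)
  show ?thesis
    by (simp add: interchange_def ncmp_inv_arr)
qed

end

locale smc_dual = A: symmetric_monoidal_category A + B: symmetric_monoidal_category B
  + C: symmetric_monoidal_category C
  for A :: "('oa, 'ma) smc_data" and B :: "('ob, 'mb) smc_data" and C :: "('oc, 'mc) smc_data"
begin

sublocale AC: smc_pair A C ..
sublocale BC: smc_pair B C ..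
sublocale A_BC: smc_pair A "B \<Rrightarrow> C" by (rule smc_pair.intro [OF A.symmetric_monoidal_category_axioms BC.ihom_smc])
sublocale B_AC: smc_pair B "A \<Rrightarrow> C" by (rule smc_pair.intro [OF B.symmetric_monoidal_category_axioms AC.ihom_smc])

lemmas unfold_ihom = ihom_Obj ihom_Arr ihom_Dom ihom_Cod ihom_Tens ihom_Unit
lemmas [simp] = A_BC.smf_simps [unfolded unfold_ihom] A_BC.mnt_simps [unfolded unfold_ihom]

text \<open>The axioms for \<open>F\<close> are equations between transformations. Their components at \<open>b\<close> are the axioms for
\<open>dual_at A F b\<close>.\<close>

lemma dual_at_smf [simp]:
  assumes F [simp]: "A_BC.smf F" and b [simp]: "b \<in> Obj B"
  shows "AC.smf (dual_at A F b)"
proof (rule AC.smfI)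
  let ?F = "dual_at A F b"
  show "fob ?F \<in> extensional (Obj A)" "far ?F \<in> extensional (Arr A)" "ftwo ?F \<in> extensional (Obj A)"
    by (simp_all add: dual_at_def)
  show "ftwo ?F x \<in> extensional (Obj A)" if "x \<in> Obj A" for x
    using that by (simp add: dual_at_def)
  show "far ?F (g \<cdot>\<^bsub>A\<^esub> f) = far ?F g \<cdot>\<^bsub>C\<^esub> far ?F f" if "f \<in> Arr A" "g \<in> Arr A" "Dom A g = Cod A f" for f g
    using that by (simp add: A_BC.far_comp_arr)
  show "ftwo ?F (Cod A f) (Cod A g) \<cdot>\<^bsub>C\<^esub> (far ?F f \<boxtimes>\<^bsub>C\<^esub> far ?F g)
      = far ?F (f \<boxtimes>\<^bsub>A\<^esub> g) \<cdot>\<^bsub>C\<^esub> ftwo ?F (Dom A f) (Dom A g)"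
    if "f \<in> Arr A" "g \<in> Arr A" for f g
    using that arg_cong [OF A_BC.ftwo_nat_arr [of F f g], of "\<lambda>t. ncmp t b"] by simp
  fix x assume x [simp]: "x \<in> Obj A"
  show "far ?F (RUnit A x) \<cdot>\<^bsub>C\<^esub> ftwo ?F x (Unit A) \<cdot>\<^bsub>C\<^esub> (Idt C (fob ?F x) \<boxtimes>\<^bsub>C\<^esub> fzero ?F) = RUnit C (fob ?F x)"
    using arg_cong [OF A_BC.smf_ftwo_runit [OF F x], of "\<lambda>t. ncmp t b"] by simp
  show "far ?F (LUnit A x) \<cdot>\<^bsub>C\<^esub> ftwo ?F (Unit A) x \<cdot>\<^bsub>C\<^esub> (fzero ?F \<boxtimes>\<^bsub>C\<^esub> Idt C (fob ?F x)) = LUnit C (fob ?F x)"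
    using arg_cong [OF A_BC.smf_ftwo_lunit [OF F x], of "\<lambda>t. ncmp t b"] by simp
  fix y assume y [simp]: "y \<in> Obj A"
  show "ftwo ?F y x \<cdot>\<^bsub>C\<^esub> Symm C (fob ?F x) (fob ?F y) = far ?F (Symm A x y) \<cdot>\<^bsub>C\<^esub> ftwo ?F x y"
    using arg_cong [OF A_BC.smf_ftwo_symm [OF F x y], of "\<lambda>t. ncmp t b"] by simp
  fix z assume z [simp]: "z \<in> Obj A"
  show "ftwo ?F (x \<otimes>\<^bsub>A\<^esub> y) z \<cdot>\<^bsub>C\<^esub> (ftwo ?F x y \<boxtimes>\<^bsub>C\<^esub> Idt C (fob ?F z)) \<cdot>\<^bsub>C\<^esub> Assoc C (fob ?F x) (fob ?F y) (fob ?F z)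
    = far ?F (Assoc A x y z) \<cdot>\<^bsub>C\<^esub> ftwo ?F x (y \<otimes>\<^bsub>A\<^esub> z) \<cdot>\<^bsub>C\<^esub> (Idt C (fob ?F x) \<boxtimes>\<^bsub>C\<^esub> ftwo ?F y z)"
    using arg_cong [OF A_BC.smf_ftwo_assoc [OF F x y z], of "\<lambda>t. ncmp t b"] by simp
qed simp_all

text \<open>Under duality the two kinds of conditions change places: that the values of \<open>F\<close> on arrows and its
structure arrows are natural and monoidal is what makes the values of the dual on arrows and the
structure arrows of the dual natural and monoidal.\<close>

lemma dual_far_mnt [simp]:
  assumes F [simp]: "A_BC.smf F" and g [simp]: "g \<in> Arr B"
  shows "AC.mnt (far (dual A B C F) g)"
proof (rule AC.mntI)
  let ?t = "far (dual A B C F) g"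
  show "ncmp ?t (Cod A f) \<cdot>\<^bsub>C\<^esub> far (nsrc ?t) f = far (ntrg ?t) f \<cdot>\<^bsub>C\<^esub> ncmp ?t (Dom A f)" if "f \<in> Arr A" for f
    using that BC.ncmp_nat_arr [of "far F f" g] by simp
  show "ncmp ?t (Unit A) \<cdot>\<^bsub>C\<^esub> fzero (nsrc ?t) = fzero (ntrg ?t)"
    using BC.ncmp_nat_arr [of "fzero F" g] by simp
  show "ncmp ?t (x \<otimes>\<^bsub>A\<^esub> y) \<cdot>\<^bsub>C\<^esub> ftwo (nsrc ?t) x y = ftwo (ntrg ?t) x y \<cdot>\<^bsub>C\<^esub> (ncmp ?t x \<boxtimes>\<^bsub>C\<^esub> ncmp ?t y)"
    if "x \<in> Obj A" "y \<in> Obj A" for x y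
    using that BC.ncmp_nat_arr [of "ftwo F x y" g] by simp
qed simp_all

lemma dual_fzero_mnt [simp]:
  assumes F [simp]: "A_BC.smf F"
  shows "AC.mnt (fzero (dual A B C F))"
proof (rule AC.mntI)
  let ?t = "fzero (dual A B C F)"
  show "ncmp ?t (Cod A f) \<cdot>\<^bsub>C\<^esub> far (nsrc ?t) f = far (ntrg ?t) f \<cdot>\<^bsub>C\<^esub> ncmp ?t (Dom A f)" if "f \<in> Arr A" for f
    using that BC.mnt_unit [of "far F f"] by simp
  show "ncmp ?t (Unit A) \<cdot>\<^bsub>C\<^esub> fzero (nsrc ?t) = fzero (ntrg ?t)"
    using BC.mnt_unit [of "fzero F"] by simp
  show "ncmp ?t (x \<otimes>\<^bsub>A\<^esub> y) \<cdot>\<^bsub>C\<^esub> ftwo (nsrc ?t) x y = ftwo (ntrg ?t) x y \<cdot>\<^bsub>C\<^esub> (ncmp ?t x \<boxtimes>\<^bsub>C\<^esub> ncmp ?t y)"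
    if [simp]: "x \<in> Obj A" "y \<in> Obj A" for x y
  proof -
    have "ncmp (ftwo F x y) (Unit B) \<cdot>\<^bsub>C\<^esub> ((fzero (fob F x) \<boxtimes>\<^bsub>C\<^esub> fzero (fob F y)) \<cdot>\<^bsub>C\<^esub> inv_arr C (RUnit C (Unit C)))
      = fzero (fob F (x \<otimes>\<^bsub>A\<^esub> y))"
      using BC.mnt_unit [of "ftwo F x y"] by simp
    then show ?thesis
      by (simp flip: \<open>_ = fzero (fob F (x \<otimes>\<^bsub>A\<^esub> y))\<close>)
  qed
qed simp_all

lemma dual_ftwo_mnt [simp]:
  assumes F [simp]: "A_BC.smf F" and [simp]: "b \<in> Obj B" "b' \<in> Obj B"
  shows "AC.mnt (ftwo (dual A B C F) b b')"
proof (rule AC.mntI)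
  let ?t = "ftwo (dual A B C F) b b'"
  show "ncmp ?t (Cod A f) \<cdot>\<^bsub>C\<^esub> far (nsrc ?t) f = far (ntrg ?t) f \<cdot>\<^bsub>C\<^esub> ncmp ?t (Dom A f)" if "f \<in> Arr A" for f
    using that BC.mnt_tens [of "far F f" b b'] by simp
  show "ncmp ?t (Unit A) \<cdot>\<^bsub>C\<^esub> fzero (nsrc ?t) = fzero (ntrg ?t)"
  proof -
    let ?r = "RUnit C (Unit C)"
    have eq: "ftwo (fob F (Unit A)) b b' \<cdot>\<^bsub>C\<^esub> (ncmp (fzero F) b \<boxtimes>\<^bsub>C\<^esub> ncmp (fzero F) b')
        = ncmp (fzero F) (b \<otimes>\<^bsub>B\<^esub> b') \<cdot>\<^bsub>C\<^esub> ?r"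
      using BC.mnt_tens [of "fzero F" b b'] by simp
    show ?thesis
      using C.comp_extend [OF eq, of "inv_arr C ?r"] by simp
  qed
  show "ncmp ?t (x \<otimes>\<^bsub>A\<^esub> y) \<cdot>\<^bsub>C\<^esub> ftwo (nsrc ?t) x y = ftwo (ntrg ?t) x y \<cdot>\<^bsub>C\<^esub> (ncmp ?t x \<boxtimes>\<^bsub>C\<^esub> ncmp ?t y)"
    if [simp]: "x \<in> Obj A" "y \<in> Obj A" for x y
  \<comment> \<open>the two sides take the four factors in orders that differ by an interchange, which is self-inverse\<close>
  proof -
    let ?x = "fob F x" and ?y = "fob F y"
    let ?m = "interchange C (fob ?x b) (fob ?x b') (fob ?y b) (fob ?y b')"
    have eq: "ftwo (fob F (x \<otimes>\<^bsub>A\<^esub> y)) b b' \<cdot>\<^bsub>C\<^esub> (ncmp (ftwo F x y) b \<boxtimes>\<^bsub>C\<^esub> ncmp (ftwo F x y) b')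
      = ncmp (ftwo F x y) (b \<otimes>\<^bsub>B\<^esub> b') \<cdot>\<^bsub>C\<^esub> (ftwo ?x b b' \<boxtimes>\<^bsub>C\<^esub> ftwo ?y b b')
        \<cdot>\<^bsub>C\<^esub> interchange C (fob ?x b) (fob ?y b) (fob ?x b') (fob ?y b')"
      using BC.mnt_tens [of "ftwo F x y" b b'] by simp
    show ?thesis
      using C.comp_extend [OF eq, of ?m] by simp
  qed
qed simp_all

lemma dual_smf [simp]:
  assumes F [simp]: "A_BC.smf F"
  shows "B_AC.smf (dual A B C F)"
proof (rule B_AC.smfI)
  let ?F = "dual A B C F"
  show "fob ?F \<in> extensional (Obj B)" "far ?F \<in> extensional (Arr B)" "ftwo ?F \<in> extensional (Obj B)"
    by (simp_all add: dual_def)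
  show "ftwo ?F x \<in> extensional (Obj B)" if "x \<in> Obj B" for x
    using that by (simp add: dual_def)
  show "far ?F (Idt B x) = Idt (A \<Rrightarrow> C) (fob ?F x)" if "x \<in> Obj B" for x
    by (rule mnt_ext [where A = A]) (use that in simp_all)
  show "far ?F (g \<cdot>\<^bsub>B\<^esub> f) = far ?F g \<cdot>\<^bsub>A \<Rrightarrow> C\<^esub> far ?F f" if "f \<in> Arr B" "g \<in> Arr B" "Dom B g = Cod B f" for f g
    by (rule mnt_ext [where A = A]) (use that in \<open>simp_all add: BC.far_comp_arr\<close>)
  show "ftwo ?F (Cod B f) (Cod B g) \<cdot>\<^bsub>A \<Rrightarrow> C\<^esub> (far ?F f \<boxtimes>\<^bsub>A \<Rrightarrow> C\<^esub> far ?F g)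
      = far ?F (f \<boxtimes>\<^bsub>B\<^esub> g) \<cdot>\<^bsub>A \<Rrightarrow> C\<^esub> ftwo ?F (Dom B f) (Dom B g)"
    if "f \<in> Arr B" "g \<in> Arr B" for f g
    by (rule mnt_ext [where A = A]) (use that in \<open>simp_all add: BC.ftwo_nat_arr\<close>)
  fix x assume x [simp]: "x \<in> Obj B"
  show "far ?F (RUnit B x) \<cdot>\<^bsub>A \<Rrightarrow> C\<^esub> ftwo ?F x (Unit B) \<cdot>\<^bsub>A \<Rrightarrow> C\<^esub> (Idt (A \<Rrightarrow> C) (fob ?F x) \<boxtimes>\<^bsub>A \<Rrightarrow> C\<^esub> fzero ?F)
      = RUnit (A \<Rrightarrow> C) (fob ?F x)"
    by (rule mnt_ext [where A = A]) (simp_all add: BC.smf_ftwo_runit)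
  show "far ?F (LUnit B x) \<cdot>\<^bsub>A \<Rrightarrow> C\<^esub> ftwo ?F (Unit B) x \<cdot>\<^bsub>A \<Rrightarrow> C\<^esub> (fzero ?F \<boxtimes>\<^bsub>A \<Rrightarrow> C\<^esub> Idt (A \<Rrightarrow> C) (fob ?F x))
      = LUnit (A \<Rrightarrow> C) (fob ?F x)"
    by (rule mnt_ext [where A = A]) (simp_all add: BC.smf_ftwo_lunit)
  fix y assume y [simp]: "y \<in> Obj B"
  show "ftwo ?F y x \<cdot>\<^bsub>A \<Rrightarrow> C\<^esub> Symm (A \<Rrightarrow> C) (fob ?F x) (fob ?F y) = far ?F (Symm B x y) \<cdot>\<^bsub>A \<Rrightarrow> C\<^esub> ftwo ?F x y"
    by (rule mnt_ext [where A = A]) (simp_all add: BC.smf_ftwo_symm)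
  fix z assume z [simp]: "z \<in> Obj B"
  show "ftwo ?F (x \<otimes>\<^bsub>B\<^esub> y) z \<cdot>\<^bsub>A \<Rrightarrow> C\<^esub> (ftwo ?F x y \<boxtimes>\<^bsub>A \<Rrightarrow> C\<^esub> Idt (A \<Rrightarrow> C) (fob ?F z))
      \<cdot>\<^bsub>A \<Rrightarrow> C\<^esub> Assoc (A \<Rrightarrow> C) (fob ?F x) (fob ?F y) (fob ?F z)
    = far ?F (Assoc B x y z) \<cdot>\<^bsub>A \<Rrightarrow> C\<^esub> ftwo ?F x (y \<otimes>\<^bsub>B\<^esub> z) \<cdot>\<^bsub>A \<Rrightarrow> C\<^esub> (Idt (A \<Rrightarrow> C) (fob ?F x) \<boxtimes>\<^bsub>A \<Rrightarrow> C\<^esub> ftwo ?F y z)"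
    by (rule mnt_ext [where A = A]) (simp_all add: BC.smf_ftwo_assoc)
qed simp_all

text \<open>Duality is strict because all structure is computed at a pair of objects, in whichever order the two
objects are supplied.\<close>

lemma dual_cell_idt: "dual_cell A B C (Idt (A \<Rrightarrow> B \<Rrightarrow> C) F) = Idt (B \<Rrightarrow> A \<Rrightarrow> C) (dual A B C F)"
proof (rule mnt_ext [where A = B])
  fix b assume "b \<in> Obj B"
  then show "ncmp (dual_cell A B C (Idt (A \<Rrightarrow> B \<Rrightarrow> C) F)) b = ncmp (Idt (B \<Rrightarrow> A \<Rrightarrow> C) (dual A B C F)) b"
    by (intro mnt_ext [where A = A]) simp_all
qed simp_all

lemma dual_at_unit: "b \<in> Obj B \<Longrightarrow> dual_at A (smf_unit A (B \<Rrightarrow> C)) b = smf_unit A C"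
  by (rule smf_ext [where A = A and B = C]) simp_all

lemma dual_unit: "dual A B C (smf_unit A (B \<Rrightarrow> C)) = smf_unit B (A \<Rrightarrow> C)"
proof (rule smf_ext [where A = B and B = "A \<Rrightarrow> C"])
  show "far (dual A B C (smf_unit A (B \<Rrightarrow> C))) g = far (smf_unit B (A \<Rrightarrow> C)) g" if "g \<in> Arr B" for g
    by (rule mnt_ext [where A = A]) (use that in \<open>simp_all add: dual_at_unit\<close>)
  show "fzero (dual A B C (smf_unit A (B \<Rrightarrow> C))) = fzero (smf_unit B (A \<Rrightarrow> C))"
    by (rule mnt_ext [where A = A]) (simp_all add: dual_at_unit)
  show "ftwo (dual A B C (smf_unit A (B \<Rrightarrow> C))) x y = ftwo (smf_unit B (A \<Rrightarrow> C)) x y"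
    if "x \<in> Obj B" "y \<in> Obj B" for x y
    by (rule mnt_ext [where A = A]) (use that in \<open>simp_all add: dual_at_unit\<close>)
qed (simp_all add: dual_at_unit)

lemma dual_at_tens:
  assumes [simp]: "A_BC.smf F" "A_BC.smf G" "b \<in> Obj B"
  shows "dual_at A (smf_tens A (B \<Rrightarrow> C) F G) b = smf_tens A C (dual_at A F b) (dual_at A G b)"
  by (rule smf_ext [where A = A and B = C]) (simp_all add: BC.ncmp_inv_arr BC.ncmp_interchange)

lemma dual_tens:
  assumes [simp]: "A_BC.smf F" "A_BC.smf G"
  shows "dual A B C (smf_tens A (B \<Rrightarrow> C) F G) = smf_tens B (A \<Rrightarrow> C) (dual A B C F) (dual A B C G)"
    (is "?l = ?r")
proof (rule smf_ext [where A = B and B = "A \<Rrightarrow> C"])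
  show "far ?l g = far ?r g" if "g \<in> Arr B" for g
    by (rule mnt_ext [where A = A]) (use that in \<open>simp_all add: dual_at_tens\<close>)
  show "fzero ?l = fzero ?r"
    by (rule mnt_ext [where A = A]) (simp_all add: dual_at_tens AC.ncmp_inv_arr AC.inv_arr_boundary)
  show "ftwo ?l x y = ftwo ?r x y" if "x \<in> Obj B" "y \<in> Obj B" for x y
    by (rule mnt_ext [where A = A]) (use that in \<open>simp_all add: dual_at_tens AC.ncmp_interchange AC.nsrc_interchange\<close>)
qed (simp_all add: dual_at_tens)

end

section \<open>The two composites\<close>

lemma strict_smf_cong:
  assumes "\<And>x. x \<in> Obj X \<Longrightarrow> ob x = ob' x" "\<And>f. f \<in> Arr X \<Longrightarrow> ar f = ar' f"
  shows "strict_smf X Y ob ar = strict_smf X Y ob' ar'"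
  using assms by (auto simp: strict_smf_def restrict_def fun_eq_iff)

text \<open>Each structure arrow of the composite is an identity followed by the image of an identity. Preservation
of unit and tensor by the outer map makes these two identities composable.\<close>

lemma smf_comp_strict:
  assumes Y: "symmetric_monoidal_category Y" and Z: "symmetric_monoidal_category Z"
    and 1: "\<And>x. x \<in> Obj X \<Longrightarrow> ob1 x \<in> Obj Y" "\<And>f. f \<in> Arr X \<Longrightarrow> ar1 f \<in> Arr Y"
    and 2: "\<And>y. y \<in> Obj Y \<Longrightarrow> ob2 y \<in> Obj Z"
      "\<And>y. y \<in> Obj Y \<Longrightarrow> ar2 (Idt Y y) = Idt Z (ob2 y)"
      "ob2 (Unit Y) = Unit Z"
      "\<And>y y'. y \<in> Obj Y \<Longrightarrow> y' \<in> Obj Y \<Longrightarrow> ob2 (y \<otimes>\<^bsub>Y\<^esub> y') = ob2 y \<otimes>\<^bsub>Z\<^esub> ob2 y'"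
  shows "smf_comp X Z (strict_smf Y Z ob2 ar2) (strict_smf X Y ob1 ar1)
    = strict_smf X Z (\<lambda>x. ob2 (ob1 x)) (\<lambda>f. ar2 (ar1 f))"
proof -
  interpret Y: symmetric_monoidal_category Y by fact
  interpret Z: symmetric_monoidal_category Z by fact
  show ?thesis
    by (auto simp: smf_comp_def strict_smf_def 1 2 restrict_def fun_eq_iff)
qed

locale smc_quadruple = A: symmetric_monoidal_category A + B: symmetric_monoidal_category B
  + C: symmetric_monoidal_category C + D: symmetric_monoidal_category D
  for A :: "('oa, 'ma) smc_data" and B :: "('ob, 'mb) smc_data"
    and C :: "('oc, 'mc) smc_data" and D :: "('od, 'md) smc_data"
begin

sublocale ACB: smc_dual A C B ..
sublocale CAD: smc_dual C A D ..
sublocale ABD: smc_triple A B D ..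
sublocale CBD: smc_triple C B D ..
sublocale along_dual: smc_triple C "A \<Rrightarrow> B" "A \<Rrightarrow> D" ..
sublocale along: smc_triple A "C \<Rrightarrow> B" "C \<Rrightarrow> D" ..

text \<open>Both functors send \<open>a\<close> to the functor with value \<open>G (F a c)\<close> at \<open>c\<close>. In both cases
the structure arrow at \<open>c\<close> is the structure arrow of \<open>G\<close> followed by the image under \<open>G\<close> of that of \<open>F\<close>.\<close>

lemma dual_ihom_map:
  assumes F [simp]: "ACB.A_BC.smf F" and G [simp]: "ABD.YZ.smf G"
  shows "dual C A D (smf_comp C (A \<Rrightarrow> D) (ihom_map A B D G) (dual A C B F))
    = smf_comp A (C \<Rrightarrow> D) (ihom_map C B D G) F" (is "dual C A D ?S = ?T")
proof -
  have at: "dual_at C ?S a = smf_comp C D G (fob F a)" if [simp]: "a \<in> Obj A" for a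
    by (rule smf_ext [where A = C and B = D]) simp_all
  show ?thesis
  proof (rule smf_ext [where A = A and B = "C \<Rrightarrow> D"])
    show "fob (dual C A D ?S) a = fob ?T a" if "a \<in> Obj A" for a
      using that by (simp add: at)
    show "far (dual C A D ?S) f = far ?T f" if "f \<in> Arr A" for f
      by (rule mnt_ext [where A = C]) (use that in \<open>simp_all add: at\<close>)
    show "fzero (dual C A D ?S) = fzero ?T"
      by (rule mnt_ext [where A = C]) (simp_all add: at)
    show "ftwo (dual C A D ?S) a b = ftwo ?T a b" if "a \<in> Obj A" "b \<in> Obj A" for a b
      by (rule mnt_ext [where A = C]) (use that in \<open>simp_all add: at\<close>)
  qed simp_all
qed

lemma dual_cell_ihom_map_cell:
  assumes F [simp]: "ACB.A_BC.smf F" and \<sigma> [simp]: "ABD.YZ.mnt \<sigma>"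
  shows "dual_cell C A D (whisker_right C (A \<Rrightarrow> D) (ihom_map_cell A B D \<sigma>) (dual A C B F))
    = whisker_right A (C \<Rrightarrow> D) (ihom_map_cell C B D \<sigma>) F" (is "?l = ?r")
proof (rule mnt_ext [where A = A])
  fix a assume [simp]: "a \<in> Obj A"
  have at: "dual_at C (smf_comp C (A \<Rrightarrow> D) (ihom_map A B D G) (dual A C B F)) a = smf_comp C D G (fob F a)"
    if [simp]: "ABD.YZ.smf G" for G
    using arg_cong [OF dual_ihom_map [OF F that], of "\<lambda>H. fob H a"] by simp
  show "ncmp ?l a = ncmp ?r a"
    by (rule mnt_ext [where A = C]) (simp_all add: at)
qed (simp_all add: dual_ihom_map)

end

theorem lemma10p8:
  fixes A :: "('oa, 'ma) smc_data" and B :: "('ob, 'mb) smc_data"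
    and C :: "('oc, 'mc) smc_data" and D :: "('od, 'md) smc_data"
    and F :: "('oa, 'ma, ('oc, 'mc, 'ob, 'mb) smf, ('oc, 'mc, 'ob, 'mb) mnt) smf"
  assumes "symmetric_monoidal_category A"
    and "symmetric_monoidal_category B"
    and "symmetric_monoidal_category C"
    and "symmetric_monoidal_category D"
    and "symmetric_monoidal_functor A (C \<Rrightarrow> B) F"
  shows "smf_comp (B \<Rrightarrow> D) (A \<Rrightarrow> C \<Rrightarrow> D)
           (duality C A D)
           (smf_comp (B \<Rrightarrow> D) (C \<Rrightarrow> A \<Rrightarrow> D)
             (precomp C (A \<Rrightarrow> B) (A \<Rrightarrow> D) (dual A C B F))
             (ihom_fun A B D))
       = smf_comp (B \<Rrightarrow> D) (A \<Rrightarrow> C \<Rrightarrow> D)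
           (precomp A (C \<Rrightarrow> B) (C \<Rrightarrow> D) F)
           (ihom_fun C B D)"
proof -
  interpret smc_quadruple A B C D
    using assms by (intro smc_quadruple.intro)
  note F [simp] = assms(5)
  let ?F = "dual A C B F"
  have "smf_comp (B \<Rrightarrow> D) (C \<Rrightarrow> A \<Rrightarrow> D) (precomp C (A \<Rrightarrow> B) (A \<Rrightarrow> D) ?F) (ihom_fun A B D)
    = strict_smf (B \<Rrightarrow> D) (C \<Rrightarrow> A \<Rrightarrow> D) (\<lambda>G. smf_comp C (A \<Rrightarrow> D) (ihom_map A B D G) ?F)
        (\<lambda>\<sigma>. whisker_right C (A \<Rrightarrow> D) (ihom_map_cell A B D \<sigma>) ?F)"
    unfolding precomp_def ihom_fun_def
    by (rule smf_comp_strict [OF ABD.hom.ihom_smc CAD.A_BC.ihom_smc])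
      (simp_all add: along_dual.smf_comp_unit along_dual.smf_comp_tens along_dual.whisker_right_idt)
  also have "smf_comp (B \<Rrightarrow> D) (A \<Rrightarrow> C \<Rrightarrow> D) (duality C A D) \<dots>
    = strict_smf (B \<Rrightarrow> D) (A \<Rrightarrow> C \<Rrightarrow> D) (\<lambda>G. dual C A D (smf_comp C (A \<Rrightarrow> D) (ihom_map A B D G) ?F))
        (\<lambda>\<sigma>. dual_cell C A D (whisker_right C (A \<Rrightarrow> D) (ihom_map_cell A B D \<sigma>) ?F))"
    unfolding duality_def
    by (rule smf_comp_strict [OF CAD.A_BC.ihom_smc CAD.B_AC.ihom_smc])
      (simp_all add: CAD.dual_unit CAD.dual_tens CAD.dual_cell_idt)
  also have "\<dots> = strict_smf (B \<Rrightarrow> D) (A \<Rrightarrow> C \<Rrightarrow> D) (\<lambda>G. smf_comp A (C \<Rrightarrow> D) (ihom_map C B D G) F)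
        (\<lambda>\<sigma>. whisker_right A (C \<Rrightarrow> D) (ihom_map_cell C B D \<sigma>) F)"
    by (rule strict_smf_cong) (simp_all add: dual_ihom_map dual_cell_ihom_map_cell)
  also have "\<dots> = smf_comp (B \<Rrightarrow> D) (A \<Rrightarrow> C \<Rrightarrow> D) (precomp A (C \<Rrightarrow> B) (C \<Rrightarrow> D) F) (ihom_fun C B D)"
    unfolding precomp_def ihom_fun_def
    by (rule smf_comp_strict [OF CBD.hom.ihom_smc CAD.B_AC.ihom_smc, symmetric])
      (simp_all add: along.smf_comp_unit along.smf_comp_tens along.whisker_right_idt)
  finally show ?thesis .
qed

end
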